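(* Let $A$ be a formula of $\mathcal{L}^\omega_*$ with free variables $\underline{a}$, and let $T_{\not\exists}$ be a set of $\exists$-free formulas. If $$\mathrm{IL}^{\omega}_*+\mathrm{AC}^{\omega}_*+\mathrm{IP}^*_{\not\exists}+T_{\not\exists}\vdash A(\underline{a}),$$ then there exist closed terms $\underline{t}$ such that $$\mathrm{IL}^{\omega}_*+T_{\not\exists}\vdash A_{HR}(\underline{a},\underline{t}\underline{a}),$$ where $A^{HR}\equiv\exists\underline{x}\,A_{HR}(\underline{a},\underline{x})$.
   Context: Fix a first-order language $\mathcal{L}$ with at least one constant symbol. Types: $G$; $\sigma\to\tau$; $\sigma^*$. Constants: function symbols of $\mathcal{L}$ (type $G\to\cdots\to G$); $\Pi_{\sigma,\tau}:\sigma\to\tau\to\sigma$; $\Sigma_{\rho,\sigma,\tau}:(\rho\to\sigma\to\tau)\to(\rho\to\sigma)\to\rho\to\tau$; $\mathfrak{s}_\sigma:\sigma\to\sigma^*$; $\cup_\sigma:\sigma^*\to\sigma^*\to\sigma^*$; $\bigcup_{\sigma,\tau}:\sigma^*\to(\sigma\to\tau^* )\to\tau^*$. Terms: constants, typed variables, applications. Atomic formulas: $\bot$, $t=_\rho q$, $t\in_\rho q$ ($q:\rho^*$), $R(t_1,\dots,t_n)$ with $R$ a relation symbol of $\mathcal{L}$. Formulas of $\mathcal{L}^\omega_*$: closed under $\lor,\land,\to,\forall x,\exists x$ and bounded quantifiers $\forall x\in t,\exists x\in t$ ($t:\rho^*$ not containing $x:\rho$). A formula is $\exists$-free if it contains no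 unbounded $\exists x$. $\mathrm{IL}^{\omega}_*$ is intuitionistic predicate logic in all finite types with: $x=x$; $x=y\land A\to A'$ for atomic $A$ ($A'$ replacing some $x$ by $y$); $\forall x\in t\,A\leftrightarrow\forall x(x\in t\to A)$; $\exists x\in t\,A\leftrightarrow\exists x(x\in t\land A)$; $\Sigma xyz=xz(yz)$; $\Pi xy=x$; $w\in\mathfrak{s}x\leftrightarrow w=x$; $w\in\cup xy\leftrightarrow w\in x\lor w\in y$; $z\in x\land w\in yz\to w\in\bigcup xy$; $\bigcup(\mathfrak{s}x)y=yx$; $\bigcup(\cup xy)z=\cup(\bigcup xz)(\bigcup yz)$. $\mathrm{AC}^{\omega}_*$ is the scheme $\forall x^\rho\exists y^\sigma A(x,y)\to\exists f^{\rho\to\sigma^*}\forall x\exists y\in fx\,A(x,y)$; $\mathrm{IP}^*_{\not\exists}$ is the scheme $(B(x)\to\exists y\,A(y))\to\exists w(B(x)\to\exists y\in w\,A(y))$ for $\exists$-free $B$. The herbrandized modified realizability assigns to each formula $A$ a formula $A^{HR}\equiv\exists\underline{x}\,A_{HR}(\underline{x})$ with the same free variables and $A_{HR}$ $\exists$-free: for atomic $A$, $A^{HR}:\equiv A_{HR}:\equiv A$; if $A^{HR}\equiv\exists\underline{x}A_{HR}(\underline{x})$, $B^{HR}\equiv\exists\underline{u}B_{HR}(\underline{u})$: $(A\lor B)^{HR}:\equiv\exists\underline{x},\underline{u}(A_{HR}(\underline{x})\lor B_{HR}(\underline{u}))$; $(A\land B)^{HR}:\equiv\exists\underline{x},\underline{u}(A_{HR}(\underline{x})\land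 B_{HR}(\underline{u}))$; $(A\to B)^{HR}:\equiv\exists\underline{U}\forall\underline{x}(A_{HR}(\underline{x})\to B_{HR}(\underline{U}\underline{x}))$; $(\exists zA(z))^{HR}:\equiv\exists Z,\underline{x}\,\exists z\in Z\,A_{HR}(z,\underline{x})$; $(\forall zA(z))^{HR}:\equiv\exists\underline{X}\forall z\,A_{HR}(z,\underline{X}z)$; $(\exists z\in t\,A(z))^{HR}:\equiv\exists\underline{x}\exists z\in t\,A_{HR}(z,\underline{x})$; $(\forall z\in t\,A(z))^{HR}:\equiv\exists\underline{x}\forall z\in t\,A_{HR}(z,\underline{x})$. $\underline{U}\underline{x}$, $\underline{t}\underline{a}$ denote tuples of applications of each component to all listed arguments. *)

theory Defs
  imports Main
begin

section \<open>Types, terms and formulas\<close>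

record ('f, 'r) language =
  funs :: "'f set"
  rels :: "'r set"
  fun_arity :: "'f \<Rightarrow> nat"
  rel_arity :: "'r \<Rightarrow> nat"

datatype ty = G | Arr ty ty (infixr \<open>\<rightarrow>\<^sub>t\<close> 65) | Star ty

fun arrs :: "ty list \<Rightarrow> ty \<Rightarrow> ty" where
  "arrs [] \<tau> = \<tau>"
| "arrs (\<sigma> # \<sigma>s) \<tau> = \<sigma> \<rightarrow>\<^sub>t arrs \<sigma>s \<tau>"

datatype 'f const =
    CFun 'f
  | CPi ty ty
  | CSigma ty ty ty
  | CSing ty
  | CUn ty
  | CBigUn ty ty

primrec const_type :: "('f, 'r) language \<Rightarrow> 'f const \<Rightarrow> ty" where
  "const_type L (CFun f) = arrs (replicate (fun_arity L f) G) G"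
| "const_type L (CPi \<sigma> \<tau>) = \<sigma> \<rightarrow>\<^sub>t \<tau> \<rightarrow>\<^sub>t \<sigma>"
| "const_type L (CSigma \<rho> \<sigma> \<tau>) = (\<rho> \<rightarrow>\<^sub>t \<sigma> \<rightarrow>\<^sub>t \<tau>) \<rightarrow>\<^sub>t (\<rho> \<rightarrow>\<^sub>t \<sigma>) \<rightarrow>\<^sub>t \<rho> \<rightarrow>\<^sub>t \<tau>"
| "const_type L (CSing \<sigma>) = \<sigma> \<rightarrow>\<^sub>t Star \<sigma>"
| "const_type L (CUn \<sigma>) = Star \<sigma> \<rightarrow>\<^sub>t Star \<sigma> \<rightarrow>\<^sub>t Star \<sigma>"
| "const_type L (CBigUn \<sigma> \<tau>) = Star \<sigma> \<rightarrow>\<^sub>t (\<sigma> \<rightarrow>\<^sub>t Star \<tau>) \<rightarrow>\<^sub>t Star \<tau>"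

primrec const_in :: "('f, 'r) language \<Rightarrow> 'f const \<Rightarrow> bool" where
  "const_in L (CFun f) \<longleftrightarrow> f \<in> funs L"
| "const_in L (CPi \<sigma> \<tau>) \<longleftrightarrow> True"
| "const_in L (CSigma \<rho> \<sigma> \<tau>) \<longleftrightarrow> True"
| "const_in L (CSing \<sigma>) \<longleftrightarrow> True"
| "const_in L (CUn \<sigma>) \<longleftrightarrow> True"
| "const_in L (CBigUn \<sigma> \<tau>) \<longleftrightarrow> True"

text \<open>
  De Bruijn representation with a separate index space for each type: \<open>Var \<sigma> n\<close> is the \<open>n\<close>-th
  variable of type \<open>\<sigma>\<close>, and a quantifier over type \<open>\<rho>\<close> binds \<open>Var \<rho> 0\<close>, shifting the indices of
  the variables of type \<open>\<rho>\<close> only. Every type thus has infinitely many variables and no typing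
  context is needed.
\<close>

datatype 'f tm =
    Con "'f const"
  | Var ty nat
  | App "'f tm" "'f tm" (infixl \<open>\<cdot>\<close> 75)

definition apps :: "'f tm \<Rightarrow> 'f tm list \<Rightarrow> 'f tm" where
  "apps t qs = foldl App t qs"

inductive has_type :: "('f, 'r) language \<Rightarrow> 'f tm \<Rightarrow> ty \<Rightarrow> bool" for L where
  Con: "const_in L c \<Longrightarrow> has_type L (Con c) (const_type L c)"
| Var: "has_type L (Var \<sigma> n) \<sigma>"
| App: "has_type L t (\<sigma> \<rightarrow>\<^sub>t \<tau>) \<Longrightarrow> has_type L q \<sigma> \<Longrightarrow> has_type L (t \<cdot> q) \<tau>"

text \<open>
  In the bounded quantifiers \<open>BAll \<rho> t A\<close> and \<open>BEx \<rho> t A\<close> the bound \<open>t\<close> lies outside the scope of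
  the bound variable, so the proviso that \<open>t\<close> does not contain it holds by construction.
\<close>

datatype ('f, 'r) fm =
    Bot
  | Eq ty "'f tm" "'f tm"
  | In ty "'f tm" "'f tm"
  | Rel 'r "'f tm list"
  | Or "('f, 'r) fm" "('f, 'r) fm"
  | And "('f, 'r) fm" "('f, 'r) fm"
  | Imp "('f, 'r) fm" "('f, 'r) fm"
  | All ty "('f, 'r) fm"
  | Ex ty "('f, 'r) fm"
  | BAll ty "'f tm" "('f, 'r) fm"
  | BEx ty "'f tm" "('f, 'r) fm"

abbreviation Iff :: "('f, 'r) fm \<Rightarrow> ('f, 'r) fm \<Rightarrow> ('f, 'r) fm" where
  "Iff A B \<equiv> And (Imp A B) (Imp B A)"

primrec wf_fm :: "('f, 'r) language \<Rightarrow> ('f, 'r) fm \<Rightarrow> bool" where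
  "wf_fm L Bot \<longleftrightarrow> True"
| "wf_fm L (Eq \<rho> t q) \<longleftrightarrow> has_type L t \<rho> \<and> has_type L q \<rho>"
| "wf_fm L (In \<rho> t q) \<longleftrightarrow> has_type L t \<rho> \<and> has_type L q (Star \<rho>)"
| "wf_fm L (Rel R ts) \<longleftrightarrow>
     R \<in> rels L \<and> length ts = rel_arity L R \<and> (\<forall>t\<in>set ts. has_type L t G)"
| "wf_fm L (Or A B) \<longleftrightarrow> wf_fm L A \<and> wf_fm L B"
| "wf_fm L (And A B) \<longleftrightarrow> wf_fm L A \<and> wf_fm L B"
| "wf_fm L (Imp A B) \<longleftrightarrow> wf_fm L A \<and> wf_fm L B"
| "wf_fm L (All \<rho> A) \<longleftrightarrow> wf_fm L A"
| "wf_fm L (Ex \<rho> A) \<longleftrightarrow> wf_fm L A"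
| "wf_fm L (BAll \<rho> t A) \<longleftrightarrow> has_type L t (Star \<rho>) \<and> wf_fm L A"
| "wf_fm L (BEx \<rho> t A) \<longleftrightarrow> has_type L t (Star \<rho>) \<and> wf_fm L A"

primrec ex_free :: "('f, 'r) fm \<Rightarrow> bool" where
  "ex_free Bot \<longleftrightarrow> True"
| "ex_free (Eq \<rho> t q) \<longleftrightarrow> True"
| "ex_free (In \<rho> t q) \<longleftrightarrow> True"
| "ex_free (Rel R ts) \<longleftrightarrow> True"
| "ex_free (Or A B) \<longleftrightarrow> ex_free A \<and> ex_free B"
| "ex_free (And A B) \<longleftrightarrow> ex_free A \<and> ex_free B"
| "ex_free (Imp A B) \<longleftrightarrow> ex_free A \<and> ex_free B"
| "ex_free (All \<rho> A) \<longleftrightarrow> ex_free A"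
| "ex_free (Ex \<rho> A) \<longleftrightarrow> False"
| "ex_free (BAll \<rho> t A) \<longleftrightarrow> ex_free A"
| "ex_free (BEx \<rho> t A) \<longleftrightarrow> ex_free A"


section \<open>Renaming, substitution and free variables\<close>

type_synonym ren = "ty \<Rightarrow> nat \<Rightarrow> nat"
type_synonym 'f sub = "ty \<Rightarrow> nat \<Rightarrow> 'f tm"

definition shift :: "ty \<Rightarrow> ren" where
  "shift \<rho> = (\<lambda>\<sigma> n. if \<sigma> = \<rho> then Suc n else n)"

definition up_ren :: "ty \<Rightarrow> ren \<Rightarrow> ren" where
  "up_ren \<rho> r = r(\<rho> := case_nat 0 (\<lambda>n. Suc (r \<rho> n)))"

primrec ren_tm :: "ren \<Rightarrow> 'f tm \<Rightarrow> 'f tm" where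
  "ren_tm r (Con c) = Con c"
| "ren_tm r (Var \<sigma> n) = Var \<sigma> (r \<sigma> n)"
| "ren_tm r (t \<cdot> q) = ren_tm r t \<cdot> ren_tm r q"

primrec ren_fm :: "ren \<Rightarrow> ('f, 'r) fm \<Rightarrow> ('f, 'r) fm" where
  "ren_fm r Bot = Bot"
| "ren_fm r (Eq \<rho> t q) = Eq \<rho> (ren_tm r t) (ren_tm r q)"
| "ren_fm r (In \<rho> t q) = In \<rho> (ren_tm r t) (ren_tm r q)"
| "ren_fm r (Rel R ts) = Rel R (map (ren_tm r) ts)"
| "ren_fm r (Or A B) = Or (ren_fm r A) (ren_fm r B)"
| "ren_fm r (And A B) = And (ren_fm r A) (ren_fm r B)"
| "ren_fm r (Imp A B) = Imp (ren_fm r A) (ren_fm r B)"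
| "ren_fm r (All \<rho> A) = All \<rho> (ren_fm (up_ren \<rho> r) A)"
| "ren_fm r (Ex \<rho> A) = Ex \<rho> (ren_fm (up_ren \<rho> r) A)"
| "ren_fm r (BAll \<rho> t A) = BAll \<rho> (ren_tm r t) (ren_fm (up_ren \<rho> r) A)"
| "ren_fm r (BEx \<rho> t A) = BEx \<rho> (ren_tm r t) (ren_fm (up_ren \<rho> r) A)"

abbreviation lift_tm :: "ty \<Rightarrow> 'f tm \<Rightarrow> 'f tm" where
  "lift_tm \<rho> \<equiv> ren_tm (shift \<rho>)"

abbreviation lift_fm :: "ty \<Rightarrow> ('f, 'r) fm \<Rightarrow> ('f, 'r) fm" where
  "lift_fm \<rho> \<equiv> ren_fm (shift \<rho>)"

definition up_sub :: "ty \<Rightarrow> 'f sub \<Rightarrow> 'f sub" where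
  "up_sub \<rho> s = (\<lambda>\<sigma> n. if \<sigma> = \<rho>
     then (case n of 0 \<Rightarrow> Var \<rho> 0 | Suc m \<Rightarrow> lift_tm \<rho> (s \<rho> m))
     else lift_tm \<rho> (s \<sigma> n))"

primrec sub_tm :: "'f sub \<Rightarrow> 'f tm \<Rightarrow> 'f tm" where
  "sub_tm s (Con c) = Con c"
| "sub_tm s (Var \<sigma> n) = s \<sigma> n"
| "sub_tm s (t \<cdot> q) = sub_tm s t \<cdot> sub_tm s q"

primrec sub_fm :: "'f sub \<Rightarrow> ('f, 'r) fm \<Rightarrow> ('f, 'r) fm" where
  "sub_fm s Bot = Bot"
| "sub_fm s (Eq \<rho> t q) = Eq \<rho> (sub_tm s t) (sub_tm s q)"
| "sub_fm s (In \<rho> t q) = In \<rho> (sub_tm s t) (sub_tm s q)"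
| "sub_fm s (Rel R ts) = Rel R (map (sub_tm s) ts)"
| "sub_fm s (Or A B) = Or (sub_fm s A) (sub_fm s B)"
| "sub_fm s (And A B) = And (sub_fm s A) (sub_fm s B)"
| "sub_fm s (Imp A B) = Imp (sub_fm s A) (sub_fm s B)"
| "sub_fm s (All \<rho> A) = All \<rho> (sub_fm (up_sub \<rho> s) A)"
| "sub_fm s (Ex \<rho> A) = Ex \<rho> (sub_fm (up_sub \<rho> s) A)"
| "sub_fm s (BAll \<rho> t A) = BAll \<rho> (sub_tm s t) (sub_fm (up_sub \<rho> s) A)"
| "sub_fm s (BEx \<rho> t A) = BEx \<rho> (sub_tm s t) (sub_fm (up_sub \<rho> s) A)"

text \<open>
  \<open>inst \<rho> t A\<close> is the body \<open>A\<close> of a quantifier over type \<open>\<rho>\<close> with the bound variable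
  replaced by \<open>t\<close>.
\<close>

definition inst :: "ty \<Rightarrow> 'f tm \<Rightarrow> ('f, 'r) fm \<Rightarrow> ('f, 'r) fm" where
  "inst \<rho> t = sub_fm (Var(\<rho> := case_nat t (Var \<rho>)))"

primrec fv_tm :: "'f tm \<Rightarrow> (ty \<times> nat) set" where
  "fv_tm (Con c) = {}"
| "fv_tm (Var \<sigma> n) = {(\<sigma>, n)}"
| "fv_tm (t \<cdot> q) = fv_tm t \<union> fv_tm q"

definition unbind :: "ty \<Rightarrow> (ty \<times> nat) set \<Rightarrow> (ty \<times> nat) set" where
  "unbind \<rho> V = {(\<sigma>, n). (\<sigma>, shift \<rho> \<sigma> n) \<in> V}"

primrec fv_fm :: "('f, 'r) fm \<Rightarrow> (ty \<times> nat) set" where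
  "fv_fm Bot = {}"
| "fv_fm (Eq \<rho> t q) = fv_tm t \<union> fv_tm q"
| "fv_fm (In \<rho> t q) = fv_tm t \<union> fv_tm q"
| "fv_fm (Rel R ts) = (\<Union>t\<in>set ts. fv_tm t)"
| "fv_fm (Or A B) = fv_fm A \<union> fv_fm B"
| "fv_fm (And A B) = fv_fm A \<union> fv_fm B"
| "fv_fm (Imp A B) = fv_fm A \<union> fv_fm B"
| "fv_fm (All \<rho> A) = unbind \<rho> (fv_fm A)"
| "fv_fm (Ex \<rho> A) = unbind \<rho> (fv_fm A)"
| "fv_fm (BAll \<rho> t A) = fv_tm t \<union> unbind \<rho> (fv_fm A)"
| "fv_fm (BEx \<rho> t A) = fv_tm t \<union> unbind \<rho> (fv_fm A)"


section \<open>The calculus\<close>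

text \<open>\<open>repl_fm x y A A'\<close>: \<open>A\<close> is atomic and \<open>A'\<close> results from it by replacing some \<open>x\<close> by \<open>y\<close>.\<close>

inductive repl_tm :: "'f tm \<Rightarrow> 'f tm \<Rightarrow> 'f tm \<Rightarrow> 'f tm \<Rightarrow> bool" for x y where
  keep: "repl_tm x y t t"
| here: "repl_tm x y x y"
| App: "repl_tm x y t t' \<Longrightarrow> repl_tm x y q q' \<Longrightarrow> repl_tm x y (t \<cdot> q) (t' \<cdot> q')"

inductive repl_fm :: "'f tm \<Rightarrow> 'f tm \<Rightarrow> ('f, 'r) fm \<Rightarrow> ('f, 'r) fm \<Rightarrow> bool" for x y where
  Bot: "repl_fm x y Bot Bot"
| Eq: "repl_tm x y t t' \<Longrightarrow> repl_tm x y q q' \<Longrightarrow> repl_fm x y (Eq \<rho> t q) (Eq \<rho> t' q')"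
| In: "repl_tm x y t t' \<Longrightarrow> repl_tm x y q q' \<Longrightarrow> repl_fm x y (In \<rho> t q) (In \<rho> t' q')"
| Rel: "list_all2 (repl_tm x y) ts ts' \<Longrightarrow> repl_fm x y (Rel R ts) (Rel R ts')"

inductive il_axiom :: "('f, 'r) language \<Rightarrow> ('f, 'r) fm \<Rightarrow> bool" for L where
  K: "il_axiom L (Imp A (Imp B A))"
| S: "il_axiom L (Imp (Imp A (Imp B C)) (Imp (Imp A B) (Imp A C)))"
| AndI: "il_axiom L (Imp A (Imp B (And A B)))"
| AndE1: "il_axiom L (Imp (And A B) A)"
| AndE2: "il_axiom L (Imp (And A B) B)"
| OrI1: "il_axiom L (Imp A (Or A B))"
| OrI2: "il_axiom L (Imp B (Or A B))"
| OrE: "il_axiom L (Imp (Imp A C) (Imp (Imp B C) (Imp (Or A B) C)))"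
| BotE: "il_axiom L (Imp Bot A)"
| AllE: "has_type L t \<rho> \<Longrightarrow> il_axiom L (Imp (All \<rho> A) (inst \<rho> t A))"
| ExI: "has_type L t \<rho> \<Longrightarrow> il_axiom L (Imp (inst \<rho> t A) (Ex \<rho> A))"
| eq_refl: "x = Var \<rho> i \<Longrightarrow> il_axiom L (Eq \<rho> x x)"
| eq_repl: "x = Var \<rho> i \<Longrightarrow> y = Var \<rho> j \<Longrightarrow> repl_fm x y A A' \<Longrightarrow>
    il_axiom L (Imp (And (Eq \<rho> x y) A) A')"
| BAll: "il_axiom L (Iff (BAll \<rho> t A) (All \<rho> (Imp (In \<rho> (Var \<rho> 0) (lift_tm \<rho> t)) A)))"
| BEx: "il_axiom L (Iff (BEx \<rho> t A) (Ex \<rho> (And (In \<rho> (Var \<rho> 0) (lift_tm \<rho> t)) A)))"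
| Sigma: "x = Var (\<rho> \<rightarrow>\<^sub>t \<sigma> \<rightarrow>\<^sub>t \<tau>) i \<Longrightarrow> y = Var (\<rho> \<rightarrow>\<^sub>t \<sigma>) j \<Longrightarrow> z = Var \<rho> k \<Longrightarrow>
    il_axiom L (Eq \<tau> (Con (CSigma \<rho> \<sigma> \<tau>) \<cdot> x \<cdot> y \<cdot> z) (x \<cdot> z \<cdot> (y \<cdot> z)))"
| Pi: "x = Var \<sigma> i \<Longrightarrow> y = Var \<tau> j \<Longrightarrow>
    il_axiom L (Eq \<sigma> (Con (CPi \<sigma> \<tau>) \<cdot> x \<cdot> y) x)"
| in_sing: "w = Var \<sigma> i \<Longrightarrow> x = Var \<sigma> j \<Longrightarrow>
    il_axiom L (Iff (In \<sigma> w (Con (CSing \<sigma>) \<cdot> x)) (Eq \<sigma> w x))"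
| in_un: "w = Var \<sigma> i \<Longrightarrow> x = Var (Star \<sigma>) j \<Longrightarrow> y = Var (Star \<sigma>) k \<Longrightarrow>
    il_axiom L (Iff (In \<sigma> w (Con (CUn \<sigma>) \<cdot> x \<cdot> y)) (Or (In \<sigma> w x) (In \<sigma> w y)))"
| in_bigun: "x = Var (Star \<sigma>) i \<Longrightarrow> y = Var (\<sigma> \<rightarrow>\<^sub>t Star \<tau>) j \<Longrightarrow> z = Var \<sigma> k \<Longrightarrow> w = Var \<tau> l \<Longrightarrow>
    il_axiom L (Imp (And (In \<sigma> z x) (In \<tau> w (y \<cdot> z))) (In \<tau> w (Con (CBigUn \<sigma> \<tau>) \<cdot> x \<cdot> y)))"
| bigun_sing: "x = Var \<sigma> i \<Longrightarrow> y = Var (\<sigma> \<rightarrow>\<^sub>t Star \<tau>) j \<Longrightarrow>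
    il_axiom L (Eq (Star \<tau>) (Con (CBigUn \<sigma> \<tau>) \<cdot> (Con (CSing \<sigma>) \<cdot> x) \<cdot> y) (y \<cdot> x))"
| bigun_un: "x = Var (Star \<sigma>) i \<Longrightarrow> y = Var (Star \<sigma>) j \<Longrightarrow> z = Var (\<sigma> \<rightarrow>\<^sub>t Star \<tau>) k \<Longrightarrow>
    il_axiom L (Eq (Star \<tau>)
      (Con (CBigUn \<sigma> \<tau>) \<cdot> (Con (CUn \<sigma>) \<cdot> x \<cdot> y) \<cdot> z)
      (Con (CUn \<tau>) \<cdot> (Con (CBigUn \<sigma> \<tau>) \<cdot> x \<cdot> z) \<cdot> (Con (CBigUn \<sigma> \<tau>) \<cdot> y \<cdot> z)))"

text \<open>
  \<open>provable L \<Delta> A\<close>: derivability of \<open>A\<close> when the formulas of \<open>\<Delta>\<close> are added as axioms. As usual for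
  the axioms of a theory, the free variables of members of \<open>\<Delta>\<close> may be generalized. In \<open>AllI\<close> and
  \<open>ExE\<close> the lifting of \<open>B\<close> expresses that the quantified variable is not free in \<open>B\<close>.
\<close>

inductive provable :: "('f, 'r) language \<Rightarrow> ('f, 'r) fm set \<Rightarrow> ('f, 'r) fm \<Rightarrow> bool" for L \<Delta> where
  logical: "il_axiom L A \<Longrightarrow> wf_fm L A \<Longrightarrow> provable L \<Delta> A"
| nonlogical: "A \<in> \<Delta> \<Longrightarrow> wf_fm L A \<Longrightarrow> provable L \<Delta> A"
| MP: "provable L \<Delta> (Imp A B) \<Longrightarrow> provable L \<Delta> A \<Longrightarrow> provable L \<Delta> B"
| AllI: "provable L \<Delta> (Imp (lift_fm \<rho> B) A) \<Longrightarrow> provable L \<Delta> (Imp B (All \<rho> A))"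
| ExE: "provable L \<Delta> (Imp A (lift_fm \<rho> B)) \<Longrightarrow> provable L \<Delta> (Imp (Ex \<rho> A) B)"

text \<open>
  In the two schemes below, the body \<open>A\<close> is moved under the new quantifier over \<open>f\<close>, respectively
  \<open>w\<close>; the renamings shift its parameters past that quantifier and fix the variables bound inside.
\<close>

definition AC :: "('f, 'r) fm set" where
  "AC = {Imp (All \<rho> (Ex \<sigma> A))
             (Ex (\<rho> \<rightarrow>\<^sub>t Star \<sigma>) (All \<rho>
               (BEx \<sigma> (lift_tm \<rho> (Var (\<rho> \<rightarrow>\<^sub>t Star \<sigma>) 0) \<cdot> Var \<rho> 0)
                 (ren_fm (up_ren \<sigma> (up_ren \<rho> (shift (\<rho> \<rightarrow>\<^sub>t Star \<sigma>)))) A))))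
         | \<rho> \<sigma> A. True}"

definition IP :: "('f, 'r) fm set" where
  "IP = {Imp (Imp B (Ex \<sigma> A))
             (Ex (Star \<sigma>) (Imp (lift_fm (Star \<sigma>) B)
               (BEx \<sigma> (Var (Star \<sigma>) 0) (ren_fm (up_ren \<sigma> (shift (Star \<sigma>))) A))))
         | B \<sigma> A. ex_free B}"


section \<open>Herbrandized modified realizability\<close>

primrec hr_types :: "('f, 'r) fm \<Rightarrow> ty list" where
  "hr_types Bot = []"
| "hr_types (Eq \<rho> t q) = []"
| "hr_types (In \<rho> t q) = []"
| "hr_types (Rel R ts) = []"
| "hr_types (Or A B) = hr_types A @ hr_types B"
| "hr_types (And A B) = hr_types A @ hr_types B"
| "hr_types (Imp A B) = map (arrs (hr_types A)) (hr_types B)"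
| "hr_types (All \<rho> A) = map (Arr \<rho>) (hr_types A)"
| "hr_types (Ex \<rho> A) = Star \<rho> # hr_types A"
| "hr_types (BAll \<rho> t A) = hr_types A"
| "hr_types (BEx \<rho> t A) = hr_types A"

text \<open>
  Blocks of quantifiers: under a block over \<open>\<rho>s\<close>, the block's own variables are \<open>block_vars \<rho>s\<close>,
  and anything from outside is lifted by \<open>lifts_tm \<rho>s\<close> or \<open>lifts_fm \<rho>s\<close>.
\<close>

abbreviation Alls :: "ty list \<Rightarrow> ('f, 'r) fm \<Rightarrow> ('f, 'r) fm" where
  "Alls \<rho>s A \<equiv> foldr All \<rho>s A"

abbreviation Exs :: "ty list \<Rightarrow> ('f, 'r) fm \<Rightarrow> ('f, 'r) fm" where
  "Exs \<rho>s A \<equiv> foldr Ex \<rho>s A"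

abbreviation lifts_tm :: "ty list \<Rightarrow> 'f tm \<Rightarrow> 'f tm" where
  "lifts_tm \<rho>s t \<equiv> fold lift_tm \<rho>s t"

abbreviation lifts_fm :: "ty list \<Rightarrow> ('f, 'r) fm \<Rightarrow> ('f, 'r) fm" where
  "lifts_fm \<rho>s A \<equiv> fold lift_fm \<rho>s A"

fun block_vars :: "ty list \<Rightarrow> 'f tm list" where
  "block_vars [] = []"
| "block_vars (\<rho> # \<rho>s) = lifts_tm \<rho>s (Var \<rho> 0) # block_vars \<rho>s"

primrec height :: "('f, 'r) fm \<Rightarrow> nat" where
  "height Bot = 0"
| "height (Eq \<rho> t q) = 0"
| "height (In \<rho> t q) = 0"
| "height (Rel R ts) = 0"
| "height (Or A B) = Suc (max (height A) (height B))"
| "height (And A B) = Suc (max (height A) (height B))"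
| "height (Imp A B) = Suc (max (height A) (height B))"
| "height (All \<rho> A) = Suc (height A)"
| "height (Ex \<rho> A) = Suc (height A)"
| "height (BAll \<rho> t A) = Suc (height A)"
| "height (BEx \<rho> t A) = Suc (height A)"

lemma height_ren_fm [simp]: "height (ren_fm r A) = height A"
  by (induction A arbitrary: r) auto

lemma height_lifts_fm [simp]: "height (lifts_fm \<rho>s A) = height A"
  by (induction \<rho>s arbitrary: A) auto

text \<open>
  \<open>hr_matrix A xs\<close> is the matrix $A_{HR}(\underline{x})$ taken at a tuple of terms \<open>xs\<close>, which has to
  be of types \<open>hr_types A\<close>; the tuple is lifted whenever it is moved under a quantifier.
\<close>

function hr_matrix :: "('f, 'r) fm \<Rightarrow> 'f tm list \<Rightarrow> ('f, 'r) fm" where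
  "hr_matrix Bot xs = Bot"
| "hr_matrix (Eq \<rho> t q) xs = Eq \<rho> t q"
| "hr_matrix (In \<rho> t q) xs = In \<rho> t q"
| "hr_matrix (Rel R ts) xs = Rel R ts"
| "hr_matrix (Or A B) xs =
     Or (hr_matrix A (take (length (hr_types A)) xs)) (hr_matrix B (drop (length (hr_types A)) xs))"
| "hr_matrix (And A B) xs =
     And (hr_matrix A (take (length (hr_types A)) xs)) (hr_matrix B (drop (length (hr_types A)) xs))"
| "hr_matrix (Imp A B) us =
     (let \<rho>s = hr_types A; xs = block_vars \<rho>s in
      Alls \<rho>s (Imp (hr_matrix (lifts_fm \<rho>s A) xs)
                   (hr_matrix (lifts_fm \<rho>s B) (map (\<lambda>u. apps (lifts_tm \<rho>s u) xs) us))))"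
| "hr_matrix (All \<rho> A) xs = All \<rho> (hr_matrix A (map (\<lambda>x. lift_tm \<rho> x \<cdot> Var \<rho> 0) xs))"
| "hr_matrix (Ex \<rho> A) xs = BEx \<rho> (hd xs) (hr_matrix A (map (lift_tm \<rho>) (tl xs)))"
| "hr_matrix (BAll \<rho> t A) xs = BAll \<rho> t (hr_matrix A (map (lift_tm \<rho>) xs))"
| "hr_matrix (BEx \<rho> t A) xs = BEx \<rho> t (hr_matrix A (map (lift_tm \<rho>) xs))"
  by pat_completeness auto
termination
  by (relation "measure (\<lambda>(A, xs). height A)") auto

definition HR :: "('f, 'r) fm \<Rightarrow> ('f, 'r) fm" where
  "HR A = Exs (hr_types A) (hr_matrix (lifts_fm (hr_types A) A) (block_vars (hr_types A)))"

lemma ex_free_Alls [simp]: "ex_free (Alls \<rho>s A) = ex_free A"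
  by (induction \<rho>s) auto

lemma ex_free_hr_matrix: "ex_free (hr_matrix A xs)"
  by (induction A xs rule: hr_matrix.induct) (simp_all add: Let_def)

lemma hr_types_ex_free: "ex_free A \<Longrightarrow> hr_types A = []"
  by (induction A) auto

lemma hr_matrix_ex_free: "ex_free A \<Longrightarrow> hr_matrix A [] = A"
  by (induction A) (auto simp: hr_types_ex_free)

lemma has_type_ren_tm: "has_type L t \<tau> \<Longrightarrow> has_type L (ren_tm r t) \<tau>"
  by (induction rule: has_type.induct) (auto intro: has_type.intros)

lemma wf_fm_ren_fm: "wf_fm L A \<Longrightarrow> wf_fm L (ren_fm r A)"
  by (induction A arbitrary: r) (auto intro: has_type_ren_tm)

lemma hr_types_ren_fm [simp]: "hr_types (ren_fm r A) = hr_types A"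
  by (induction A arbitrary: r) auto

lemma hr_types_lifts_fm [simp]: "hr_types (lifts_fm \<rho>s A) = hr_types A"
  by (induction \<rho>s arbitrary: A) auto

lemma has_type_lifts_tm: "has_type L t \<tau> \<Longrightarrow> has_type L (lifts_tm \<rho>s t) \<tau>"
  by (induction \<rho>s arbitrary: t) (auto intro: has_type_ren_tm)

lemma wf_fm_lifts_fm: "wf_fm L A \<Longrightarrow> wf_fm L (lifts_fm \<rho>s A)"
  by (induction \<rho>s arbitrary: A) (auto intro: wf_fm_ren_fm)

lemma wf_fm_Alls [simp]: "wf_fm L (Alls \<rho>s A) = wf_fm L A"
  by (induction \<rho>s) auto

lemma has_type_block_vars: "list_all2 (has_type L) (block_vars \<rho>s) \<rho>s"
  by (induction \<rho>s) (auto intro: has_type_lifts_tm has_type.Var)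

lemma has_type_apps:
  "has_type L t (arrs \<rho>s \<tau>) \<Longrightarrow> list_all2 (has_type L) qs \<rho>s \<Longrightarrow> has_type L (apps t qs) \<tau>"
  unfolding apps_def
proof (induction \<rho>s arbitrary: t qs)
  case (Cons \<rho> \<rho>s)
  from Cons.prems(2) obtain q qs' where qs: "qs = q # qs'" "has_type L q \<rho>"
    "list_all2 (has_type L) qs' \<rho>s"
    by (auto simp: list_all2_Cons2)
  from Cons.prems(1) qs(2) have "has_type L (t \<cdot> q) (arrs \<rho>s \<tau>)"
    by (auto intro: has_type.App)
  with Cons.IH qs show ?case
    by simp
qed simp

lemma has_type_map_ren_tm:
  "list_all2 (has_type L) ts \<tau>s \<Longrightarrow> list_all2 (has_type L) (map (ren_tm r) ts) \<tau>s"
  by (auto simp: list_all2_conv_all_nth intro: has_type_ren_tm)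

lemma wf_fm_hr_matrix:
  "wf_fm L A \<Longrightarrow> list_all2 (has_type L) xs (hr_types A) \<Longrightarrow> wf_fm L (hr_matrix A xs)"
proof (induction A xs rule: hr_matrix.induct)
  case (7 A B us)
  let ?\<rho>s = "hr_types A"
  have "list_all2 (has_type L) (map (\<lambda>u. apps (lifts_tm ?\<rho>s u) (block_vars ?\<rho>s)) us) (hr_types B)"
    using 7(4)
    by (auto simp: list_all2_conv_all_nth
        intro!: has_type_apps[OF has_type_lifts_tm has_type_block_vars])
  then show ?case
    using 7 by (auto simp: Let_def wf_fm_lifts_fm has_type_block_vars)
next
  case (8 \<rho> A xs)
  have "list_all2 (has_type L) (map (\<lambda>x. lift_tm \<rho> x \<cdot> Var \<rho> 0) xs) (hr_types A)"
    using 8(3)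
    by (auto simp: list_all2_conv_all_nth
        intro!: has_type.App[OF has_type_ren_tm has_type.Var])
  with 8 show ?case
    by simp
next
  case (9 \<rho> A xs)
  then show ?case
    by (auto simp: list_all2_Cons2 has_type_map_ren_tm)
qed (auto simp: list_all2_append2 list_all2_lengthD has_type_map_ren_tm)

end

theory Submission
  imports Defs
begin

text \<open>
  Every realizer has a type ending in some \<open>\<sigma>\<^sup>*\<close>, so realizers are ordered by pointwise inclusion,
  and the matrix $A_{HR}(\underline{x})$ is monotone in $\underline{x}$ for this order. Pointwise
  unions, available as closed combinators built from \<open>\<union>\<close> and \<open>\<Union>\<close>, therefore merge the realizers
  coming from the two branches of a disjunction elimination, or from all the elements of a bounding
  set in the elimination of \<open>\<exists>z\<close> and in the introduction of \<open>\<forall>z\<in>t\<close>.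

  Say that a context \<open>\<Gamma>\<close> forces \<open>A\<close> if \<open>\<Gamma>\<close> derives $A_{HR}(\underline{t})$ for some terms
  $\underline{t}$. With contexts as worlds and typed substitutions as the accessibility relation,
  forcing satisfies the Kripke clauses for \<open>\<and>\<close>, \<open>\<rightarrow>\<close> and \<open>\<forall>\<close>: a realizer of an implication is
  obtained by abstracting over the variables of a generic realizer of the premise. So intuitionistic
  logic is sound for Kripke consequence. Both \<open>AC\<close> and \<open>IP\<close> hold because the realizers of premise and
  conclusion agree except that the witness \<open>Z\<close> becomes the singleton \<open>{Z}\<close>. At the end, variables
  that are not free in \<open>A\<close> are replaced by closed terms and the others are abstracted.
\<close>

section \<open>Substitution\<close>

definition ren_sub :: "ren \<Rightarrow> 'f sub" where
  "ren_sub r = (\<lambda>\<sigma> n. Var \<sigma> (r \<sigma> n))"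

definition comp_sub :: "'f sub \<Rightarrow> 'f sub \<Rightarrow> 'f sub" (infixl \<open>\<odot>\<close> 55) where
  "s \<odot> s' = (\<lambda>\<sigma> n. sub_tm s (s' \<sigma> n))"

definition sub_cons :: "ty \<Rightarrow> 'f tm \<Rightarrow> 'f sub \<Rightarrow> 'f sub" where
  "sub_cons \<rho> t s = s(\<rho> := case_nat t (s \<rho>))"

abbreviation shift_sub :: "ty \<Rightarrow> 'f sub" where
  "shift_sub \<rho> \<equiv> ren_sub (shift \<rho>)"

lemma ren_sub_apply [simp]: "ren_sub r \<sigma> n = Var \<sigma> (r \<sigma> n)"
  by (simp add: ren_sub_def)

lemma comp_sub_apply [simp]: "(s \<odot> s') \<sigma> n = sub_tm s (s' \<sigma> n)"
  by (simp add: comp_sub_def)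

lemma up_ren_apply [simp]:
  "up_ren \<rho> r \<rho> 0 = 0"
  "up_ren \<rho> r \<sigma> (shift \<rho> \<sigma> n) = shift \<rho> \<sigma> (r \<sigma> n)"
  by (auto simp: up_ren_def shift_def)

lemma up_sub_apply [simp]:
  "up_sub \<rho> s \<rho> 0 = Var \<rho> 0"
  "up_sub \<rho> s \<sigma> (shift \<rho> \<sigma> n) = lift_tm \<rho> (s \<sigma> n)"
  by (auto simp: up_sub_def shift_def)

lemma sub_cons_apply [simp]:
  "sub_cons \<rho> t s \<rho> 0 = t"
  "sub_cons \<rho> t s \<rho> (Suc n) = s \<rho> n"
  "sub_cons \<rho> t s \<sigma> (shift \<rho> \<sigma> n) = s \<sigma> n"
  by (auto simp: sub_cons_def shift_def)

lemma shift_cases: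
  obtains "\<sigma> = \<rho>" "n = 0" | m where "n = shift \<rho> \<sigma> m"
  by (cases "\<sigma> = \<rho>"; cases n) (auto simp: shift_def)

lemma ext_by_shift_cases:
  assumes "f \<rho> 0 = g \<rho> 0" and "\<And>\<sigma> n. f \<sigma> (shift \<rho> \<sigma> n) = g \<sigma> (shift \<rho> \<sigma> n)"
  shows "f = g"
proof (intro ext)
  fix \<sigma> n
  show "f \<sigma> n = g \<sigma> n"
    using assms by (cases \<sigma> \<rho> n rule: shift_cases) auto
qed

lemma inst_eq_sub_fm: "inst \<rho> t = sub_fm (sub_cons \<rho> t Var)"
  by (simp add: inst_def sub_cons_def)

lemma sub_tm_Var [simp]: "sub_tm Var t = t"
  by (induction t) auto

lemma map_sub_tm_Var [simp]: "map (sub_tm Var) ts = ts"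
  by (simp add: map_idI)

lemma up_sub_Var [simp]: "up_sub \<rho> Var = Var"
  by (rule ext_by_shift_cases[of _ \<rho>]) auto

lemma sub_fm_Var [simp]: "sub_fm Var A = A"
  by (induction A) auto

lemma comp_sub_Var [simp]: "s \<odot> Var = s" "Var \<odot> s = s"
  by (auto simp: comp_sub_def)

lemma sub_tm_sub_tm: "sub_tm s (sub_tm s' t) = sub_tm (s \<odot> s') t"
  by (induction t) auto

lemma ren_tm_eq_sub_tm: "ren_tm r t = sub_tm (ren_sub r) t"
  by (induction t) auto

lemma up_sub_ren_sub: "up_sub \<rho> (ren_sub r) = ren_sub (up_ren \<rho> r)"
  by (rule ext_by_shift_cases[of _ \<rho>]) auto

lemma ren_fm_eq_sub_fm: "ren_fm r A = sub_fm (ren_sub r) A"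
  by (induction A arbitrary: r) (auto simp: ren_tm_eq_sub_tm up_sub_ren_sub)

lemma sub_cons_comp_shift_sub [simp]: "sub_cons \<rho> t s \<odot> shift_sub \<rho> = s"
  by (intro ext) simp

lemma sub_cons_shift_sub [simp]: "sub_cons \<rho> (Var \<rho> 0) (shift_sub \<rho>) = Var"
  by (rule ext_by_shift_cases[of _ \<rho>]) auto

lemma up_sub_comp_shift_sub: "up_sub \<rho> s \<odot> shift_sub \<rho> = shift_sub \<rho> \<odot> s"
  by (intro ext) (simp add: ren_tm_eq_sub_tm)

lemma sub_tm_up_sub_lift_tm: "sub_tm (up_sub \<rho> s) (lift_tm \<rho> t) = lift_tm \<rho> (sub_tm s t)"
  by (simp add: ren_tm_eq_sub_tm sub_tm_sub_tm up_sub_comp_shift_sub)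

lemma up_sub_comp_up_sub: "up_sub \<rho> s \<odot> up_sub \<rho> s' = up_sub \<rho> (s \<odot> s')"
  by (rule ext_by_shift_cases[of _ \<rho>]) (auto simp: sub_tm_up_sub_lift_tm)

lemma sub_fm_sub_fm: "sub_fm s (sub_fm s' A) = sub_fm (s \<odot> s') A"
  by (induction A arbitrary: s s') (auto simp: sub_tm_sub_tm up_sub_comp_up_sub)

lemma sub_fm_up_sub_lift_fm: "sub_fm (up_sub \<rho> s) (lift_fm \<rho> A) = lift_fm \<rho> (sub_fm s A)"
  by (simp add: ren_fm_eq_sub_fm sub_fm_sub_fm up_sub_comp_shift_sub)

lemma sub_tm_sub_cons_lift_tm [simp]: "sub_tm (sub_cons \<rho> t s) (lift_tm \<rho> u) = sub_tm s u"
  by (simp add: ren_tm_eq_sub_tm sub_tm_sub_tm)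

lemma sub_fm_sub_cons_lift_fm [simp]: "sub_fm (sub_cons \<rho> t s) (lift_fm \<rho> A) = sub_fm s A"
  by (simp add: ren_fm_eq_sub_fm sub_fm_sub_fm)

lemma sub_cons_comp_up_sub: "sub_cons \<rho> t s \<odot> up_sub \<rho> s' = sub_cons \<rho> t (s \<odot> s')"
  by (rule ext_by_shift_cases[of _ \<rho>]) auto

lemma comp_sub_cons: "s \<odot> sub_cons \<rho> t s' = sub_cons \<rho> (sub_tm s t) (s \<odot> s')"
  by (rule ext_by_shift_cases[of _ \<rho>]) auto

lemma inst_sub_fm_up_sub: "inst \<rho> t (sub_fm (up_sub \<rho> s) A) = sub_fm (sub_cons \<rho> t s) A"
  by (simp add: inst_eq_sub_fm sub_fm_sub_fm sub_cons_comp_up_sub)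

lemma sub_fm_inst: "sub_fm s (inst \<rho> t A) = inst \<rho> (sub_tm s t) (sub_fm (up_sub \<rho> s) A)"
  by (simp add: inst_eq_sub_fm sub_fm_sub_fm comp_sub_cons sub_cons_comp_up_sub)

lemma inst_Var_lift_fm_body [simp]: "inst \<rho> (Var \<rho> 0) (ren_fm (up_ren \<rho> (shift \<rho>)) A) = A"
  by (simp add: ren_fm_eq_sub_fm inst_sub_fm_up_sub flip: up_sub_ren_sub)

definition agree_on :: "(ty \<times> nat) set \<Rightarrow> 'f sub \<Rightarrow> 'f sub \<Rightarrow> bool" where
  "agree_on V s s' \<longleftrightarrow> (\<forall>(\<sigma>, n)\<in>V. s \<sigma> n = s' \<sigma> n)"

lemma agree_on_Un [simp]: "agree_on (V \<union> W) s s' \<longleftrightarrow> agree_on V s s' \<and> agree_on W s s'"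
  by (auto simp: agree_on_def)

lemma sub_tm_cong: "agree_on (fv_tm t) s s' \<Longrightarrow> sub_tm s t = sub_tm s' t"
  by (induction t) (auto simp: agree_on_def)

lemma agree_on_up_sub: "agree_on (unbind \<rho> V) s s' \<Longrightarrow> agree_on V (up_sub \<rho> s) (up_sub \<rho> s')"
  unfolding agree_on_def
proof safe
  fix \<sigma> n assume "\<forall>(\<sigma>, n)\<in>unbind \<rho> V. s \<sigma> n = s' \<sigma> n" and "(\<sigma>, n) \<in> V"
  then show "up_sub \<rho> s \<sigma> n = up_sub \<rho> s' \<sigma> n"
    by (cases \<sigma> \<rho> n rule: shift_cases) (auto simp: unbind_def)
qed

lemma sub_fm_cong: "agree_on (fv_fm A) s s' \<Longrightarrow> sub_fm s A = sub_fm s' A"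
proof (induction A arbitrary: s s')
  case (Rel R ts)
  then have "agree_on (fv_tm t) s s'" if "t \<in> set ts" for t
    using that by (auto simp: agree_on_def)
  then show ?case
    by (auto intro: sub_tm_cong)
qed (auto intro: sub_tm_cong agree_on_up_sub)

lemma sub_tm_closed: "fv_tm t = {} \<Longrightarrow> sub_tm s t = t"
  using sub_tm_cong[of t s Var] by (simp add: agree_on_def)

lemma fv_sub_tm: "fv_tm (sub_tm s t) = (\<Union>(\<sigma>, n)\<in>fv_tm t. fv_tm (s \<sigma> n))"
  by (induction t) auto

lemma ex_lift_tm: "(\<rho>, 0) \<notin> fv_tm t \<Longrightarrow> \<exists>u. t = lift_tm \<rho> u"
proof (induction t)
  case (Con c)
  have "Con c = lift_tm \<rho> (Con c)" by simp
  then show ?case by blast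
next
  case (Var \<sigma> n)
  then obtain m where "n = shift \<rho> \<sigma> m"
    by (cases \<sigma> \<rho> n rule: shift_cases) auto
  then have "Var \<sigma> n = lift_tm \<rho> (Var \<sigma> m)" by simp
  then show ?case by blast
next
  case (App t q)
  then obtain u v where "t \<cdot> q = lift_tm \<rho> (u \<cdot> v)" by auto
  then show ?case by blast
qed

lemma finite_fv_tm: "finite (fv_tm t)"
  by (induction t) auto

lemma finite_unbind:
  assumes "finite V"
  shows "finite (unbind \<rho> V)"
proof -
  have "inj_on (\<lambda>(\<sigma>, n). (\<sigma>, shift \<rho> \<sigma> n)) UNIV"
    by (auto simp: inj_on_def shift_def split: if_splits)
  moreover have "unbind \<rho> V = (\<lambda>(\<sigma>, n). (\<sigma>, shift \<rho> \<sigma> n)) -` V"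
    by (auto simp: unbind_def)
  ultimately show ?thesis
    using assms by (simp add: finite_vimageI)
qed

lemma finite_fv_fm: "finite (fv_fm A)"
  by (induction A) (auto simp: finite_fv_tm finite_unbind)

lemma apps_Nil [simp]: "apps t [] = t"
  and apps_Cons [simp]: "apps t (q # qs) = apps (t \<cdot> q) qs"
  by (simp_all add: apps_def)

lemma sub_tm_apps [simp]: "sub_tm s (apps t qs) = apps (sub_tm s t) (map (sub_tm s) qs)"
  by (induction qs arbitrary: t) auto


subsection \<open>Blocks of quantifiers\<close>

definition lifts_sub :: "ty list \<Rightarrow> 'f sub" where
  "lifts_sub \<rho>s = (\<lambda>\<sigma> n. lifts_tm \<rho>s (Var \<sigma> n))"

abbreviation up_subs :: "ty list \<Rightarrow> 'f sub \<Rightarrow> 'f sub" where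
  "up_subs \<equiv> fold up_sub"

fun sub_conss :: "ty list \<Rightarrow> 'f tm list \<Rightarrow> 'f sub \<Rightarrow> 'f sub" where
  "sub_conss (\<rho> # \<rho>s) (t # ts) s = sub_conss \<rho>s ts (sub_cons \<rho> t s)"
| "sub_conss _ _ s = s"

abbreviation apply_block :: "ty list \<Rightarrow> 'f tm \<Rightarrow> 'f tm" where
  "apply_block \<rho>s u \<equiv> apps (lifts_tm \<rho>s u) (block_vars \<rho>s)"

lemma length_block_vars [simp]: "length (block_vars \<rho>s) = length \<rho>s"
  by (induction \<rho>s) auto

lemma lifts_sub_Nil: "lifts_sub [] = Var"
  by (simp add: lifts_sub_def)

lemma lifts_sub_Cons: "lifts_sub (\<rho> # \<rho>s) = lifts_sub \<rho>s \<odot> shift_sub \<rho>"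
  by (simp add: lifts_sub_def comp_sub_def)

lemma lifts_tm_eq_sub_tm: "lifts_tm \<rho>s t = sub_tm (lifts_sub \<rho>s) t"
proof (induction \<rho>s arbitrary: t)
  case (Cons \<rho> \<rho>s)
  then show ?case
    by (simp add: ren_tm_eq_sub_tm sub_tm_sub_tm lifts_sub_Cons comp_sub_def)
qed (simp add: lifts_sub_Nil)

lemma lifts_fm_eq_sub_fm: "lifts_fm \<rho>s A = sub_fm (lifts_sub \<rho>s) A"
proof (induction \<rho>s arbitrary: A)
  case (Cons \<rho> \<rho>s)
  then show ?case
    by (simp add: ren_fm_eq_sub_fm sub_fm_sub_fm lifts_sub_Cons comp_sub_def)
qed (simp add: lifts_sub_Nil)

lemma sub_fm_Alls: "sub_fm s (Alls \<rho>s A) = Alls \<rho>s (sub_fm (up_subs \<rho>s s) A)"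
  by (induction \<rho>s arbitrary: s) auto

lemma sub_tm_up_subs_lifts_tm: "sub_tm (up_subs \<rho>s s) (lifts_tm \<rho>s t) = lifts_tm \<rho>s (sub_tm s t)"
  by (induction \<rho>s arbitrary: s t) (auto simp: sub_tm_up_sub_lift_tm)

lemma sub_fm_up_subs_lifts_fm: "sub_fm (up_subs \<rho>s s) (lifts_fm \<rho>s A) = lifts_fm \<rho>s (sub_fm s A)"
  by (induction \<rho>s arbitrary: s A) (auto simp: sub_fm_up_sub_lift_fm)

lemma map_up_subs_block_vars: "map (sub_tm (up_subs \<rho>s s)) (block_vars \<rho>s) = block_vars \<rho>s"
  by (induction \<rho>s arbitrary: s) (auto simp: sub_tm_up_subs_lifts_tm)

lemma sub_tm_sub_conss_lifts_tm:
  "length ts = length \<rho>s \<Longrightarrow> sub_tm (sub_conss \<rho>s ts s) (lifts_tm \<rho>s t) = sub_tm s t"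
  by (induction \<rho>s ts arbitrary: s t rule: list_induct2') auto

lemma sub_fm_sub_conss_lifts_fm:
  "length ts = length \<rho>s \<Longrightarrow> sub_fm (sub_conss \<rho>s ts s) (lifts_fm \<rho>s A) = sub_fm s A"
  by (induction \<rho>s ts arbitrary: s A rule: list_induct2') auto

lemma map_sub_conss_block_vars:
  "length ts = length \<rho>s \<Longrightarrow> map (sub_tm (sub_conss \<rho>s ts s)) (block_vars \<rho>s) = ts"
  by (induction \<rho>s ts arbitrary: s rule: list_induct2') (auto simp: sub_tm_sub_conss_lifts_tm)


subsection \<open>The realizability matrix\<close>

lemma hr_types_sub_fm [simp]: "hr_types (sub_fm s A) = hr_types A"
  by (induction A arbitrary: s) auto

lemma ex_free_sub_fm [simp]: "ex_free (sub_fm s A) = ex_free A"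
  by (induction A arbitrary: s) auto

lemma sub_fm_hr_matrix:
  "length xs = length (hr_types A) \<Longrightarrow>
   sub_fm s (hr_matrix A xs) = hr_matrix (sub_fm s A) (map (sub_tm s) xs)"
proof (induction A xs arbitrary: s rule: hr_matrix.induct)
  case (7 A B us)
  let ?\<rho>s = "hr_types A"
  have premise: "sub_fm s' (hr_matrix (lifts_fm ?\<rho>s A) (block_vars ?\<rho>s)) =
      hr_matrix (sub_fm s' (lifts_fm ?\<rho>s A)) (map (sub_tm s') (block_vars ?\<rho>s))" for s'
    using 7 by simp
  have conclusion: "sub_fm s' (hr_matrix (lifts_fm ?\<rho>s B)
        (map (apply_block ?\<rho>s) us)) =
      hr_matrix (sub_fm s' (lifts_fm ?\<rho>s B))
        (map (sub_tm s') (map (apply_block ?\<rho>s) us))" for s'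
    using 7 by simp
  show ?case
    by (simp add: Let_def sub_fm_Alls premise conclusion sub_fm_up_subs_lifts_fm
        map_up_subs_block_vars sub_tm_up_subs_lifts_tm o_def)
next
  case (9 \<rho> A xs)
  then show ?case
    by (cases xs) (auto simp: o_def sub_tm_up_sub_lift_tm)
qed (auto simp: o_def sub_tm_up_sub_lift_tm take_map drop_map)


section \<open>Typing\<close>

lemma has_type_Con_iff [simp]: "has_type L (Con c) \<tau> \<longleftrightarrow> const_in L c \<and> \<tau> = const_type L c"
  and has_type_Var_iff [simp]: "has_type L (Var \<sigma> n) \<tau> \<longleftrightarrow> \<sigma> = \<tau>"
  and has_type_App_iff: "has_type L (t \<cdot> q) \<tau> \<longleftrightarrow> (\<exists>\<sigma>. has_type L t (\<sigma> \<rightarrow>\<^sub>t \<tau>) \<and> has_type L q \<sigma>)"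
  by (auto elim: has_type.cases intro: has_type.intros)

lemma has_type_ren_tm_iff [simp]: "has_type L (ren_tm r t) \<tau> \<longleftrightarrow> has_type L t \<tau>"
  by (induction t arbitrary: \<tau>) (simp_all add: has_type_App_iff)

lemma wf_fm_ren_fm_iff [simp]: "wf_fm L (ren_fm r A) \<longleftrightarrow> wf_fm L A"
  by (induction A arbitrary: r) simp_all

lemma provable_wf_fm: "provable L \<Delta> A \<Longrightarrow> wf_fm L A"
  by (induction rule: provable.induct) auto

definition typed_sub :: "('f, 'r) language \<Rightarrow> 'f sub \<Rightarrow> bool" where
  "typed_sub L s \<longleftrightarrow> (\<forall>\<sigma> n. has_type L (s \<sigma> n) \<sigma>)"

lemma typed_subD: "typed_sub L s \<Longrightarrow> has_type L (s \<sigma> n) \<sigma>"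
  by (simp add: typed_sub_def)

lemma typed_sub_Var [simp]: "typed_sub L Var"
  by (simp add: typed_sub_def)

lemma typed_sub_ren_sub [simp]: "typed_sub L (ren_sub r)"
  by (simp add: typed_sub_def)

lemma typed_sub_lifts_sub [simp]: "typed_sub L (lifts_sub \<rho>s)"
  by (simp add: typed_sub_def lifts_sub_def has_type_lifts_tm)

lemma typed_sub_up_sub: "typed_sub L s \<Longrightarrow> typed_sub L (up_sub \<rho> s)"
  by (auto simp: typed_sub_def up_sub_def split: nat.split)

lemma typed_sub_sub_cons: "typed_sub L s \<Longrightarrow> has_type L t \<rho> \<Longrightarrow> typed_sub L (sub_cons \<rho> t s)"
  by (auto simp: typed_sub_def sub_cons_def split: nat.split)

lemma has_type_sub_tm: "has_type L t \<tau> \<Longrightarrow> typed_sub L s \<Longrightarrow> has_type L (sub_tm s t) \<tau>"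
  by (induction rule: has_type.induct) (auto intro: has_type.intros typed_subD)

lemma typed_sub_comp_sub: "typed_sub L s \<Longrightarrow> typed_sub L s' \<Longrightarrow> typed_sub L (s \<odot> s')"
  by (simp add: typed_sub_def has_type_sub_tm)

lemma wf_fm_sub_fm: "wf_fm L A \<Longrightarrow> typed_sub L s \<Longrightarrow> wf_fm L (sub_fm s A)"
  by (induction A arbitrary: s) (auto intro: has_type_sub_tm typed_sub_up_sub)

lemma wf_fm_inst: "wf_fm L A \<Longrightarrow> has_type L t \<rho> \<Longrightarrow> wf_fm L (inst \<rho> t A)"
  by (simp add: inst_eq_sub_fm wf_fm_sub_fm typed_sub_sub_cons)

section \<open>Derivability from a list of hypotheses\<close>

locale il_theory =
  fixes L :: "('f, 'r) language" and T :: "('f, 'r) fm set"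
begin

abbreviation typed :: "'f tm \<Rightarrow> ty \<Rightarrow> bool" where
  "typed \<equiv> has_type L"

abbreviation typeds :: "'f tm list \<Rightarrow> ty list \<Rightarrow> bool" where
  "typeds \<equiv> list_all2 (has_type L)"

abbreviation wfs :: "('f, 'r) fm list \<Rightarrow> bool" where
  "wfs \<Gamma> \<equiv> \<forall>A\<in>set \<Gamma>. wf_fm L A"

definition entails :: "('f, 'r) fm list \<Rightarrow> ('f, 'r) fm \<Rightarrow> bool" (infix \<open>\<turnstile>\<close> 50) where
  "\<Gamma> \<turnstile> A \<longleftrightarrow> provable L T (fold Imp \<Gamma> A)"

lemma entails_Nil: "[] \<turnstile> A \<longleftrightarrow> provable L T A"
  by (simp add: entails_def)

lemma entails_Cons: "A # \<Gamma> \<turnstile> B \<longleftrightarrow> \<Gamma> \<turnstile> Imp A B"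
  by (simp add: entails_def)

lemma wf_fm_fold_Imp: "wf_fm L (fold Imp \<Gamma> A) \<longleftrightarrow> wfs \<Gamma> \<and> wf_fm L A"
  by (induction \<Gamma> arbitrary: A) auto

lemma entails_wf: "\<Gamma> \<turnstile> A \<Longrightarrow> wfs \<Gamma> \<and> wf_fm L A"
  unfolding entails_def by (auto simp: wf_fm_fold_Imp dest: provable_wf_fm)

lemma entails_provable: "provable L T A \<Longrightarrow> wfs \<Gamma> \<Longrightarrow> \<Gamma> \<turnstile> A"
proof (induction \<Gamma> arbitrary: A)
  case (Cons B \<Gamma>)
  from Cons.prems have "provable L T (Imp A (Imp B A))"
    by (intro provable.logical il_axiom.K) (auto dest: provable_wf_fm)
  then have "provable L T (Imp B A)"
    using Cons.prems(1) by (rule provable.MP)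
  with Cons show ?case
    by (simp add: entails_Cons)
qed (simp add: entails_Nil)

lemma entails_axiom: "il_axiom L A \<Longrightarrow> wf_fm L A \<Longrightarrow> wfs \<Gamma> \<Longrightarrow> \<Gamma> \<turnstile> A"
  by (intro entails_provable provable.logical)

lemma entails_MP: "\<Gamma> \<turnstile> Imp A B \<Longrightarrow> \<Gamma> \<turnstile> A \<Longrightarrow> \<Gamma> \<turnstile> B"
proof (induction \<Gamma> arbitrary: A B)
  case (Cons C \<Gamma>)
  then have imps: "\<Gamma> \<turnstile> Imp C (Imp A B)" "\<Gamma> \<turnstile> Imp C A"
    by (simp_all add: entails_Cons)
  then have "\<Gamma> \<turnstile> Imp (Imp C (Imp A B)) (Imp (Imp C A) (Imp C B))"
    by (intro entails_axiom il_axiom.S) (auto dest: entails_wf)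
  with imps show ?case
    unfolding entails_Cons by (blast intro: Cons.IH)
qed (auto simp: entails_Nil intro: provable.MP)

lemma entails_axiom_MP: "il_axiom L (Imp A B) \<Longrightarrow> wf_fm L B \<Longrightarrow> \<Gamma> \<turnstile> A \<Longrightarrow> \<Gamma> \<turnstile> B"
  by (rule entails_MP[OF entails_axiom]) (auto dest: entails_wf)

lemma entails_Imp_const: "\<Gamma> \<turnstile> B \<Longrightarrow> wf_fm L A \<Longrightarrow> \<Gamma> \<turnstile> Imp A B"
  by (rule entails_axiom_MP[OF il_axiom.K]) (auto dest: entails_wf)

lemma entails_Imp_self:
  assumes "wf_fm L A" "wfs \<Gamma>"
  shows "\<Gamma> \<turnstile> Imp A A"
proof -
  have "\<Gamma> \<turnstile> Imp (Imp A (Imp (Imp A A) A)) (Imp (Imp A (Imp A A)) (Imp A A))"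
    using assms by (intro entails_axiom il_axiom.S) auto
  moreover have "\<Gamma> \<turnstile> Imp A (Imp (Imp A A) A)" "\<Gamma> \<turnstile> Imp A (Imp A A)"
    using assms by (auto intro!: entails_axiom il_axiom.K)
  ultimately show ?thesis
    by (blast intro: entails_MP)
qed

lemma entails_assm: "wfs \<Gamma> \<Longrightarrow> A \<in> set \<Gamma> \<Longrightarrow> \<Gamma> \<turnstile> A"
  by (induction \<Gamma>) (auto simp: entails_Cons intro: entails_Imp_self entails_Imp_const)

lemma entails_cut: "\<Gamma> \<turnstile> B \<Longrightarrow> (\<And>A. A \<in> set \<Gamma> \<Longrightarrow> \<Delta> \<turnstile> A) \<Longrightarrow> wfs \<Delta> \<Longrightarrow> \<Delta> \<turnstile> B"
proof (induction \<Gamma> arbitrary: B)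
  case (Cons A \<Gamma>)
  then have "\<Delta> \<turnstile> Imp A B" "\<Delta> \<turnstile> A"
    by (auto simp: entails_Cons)
  then show ?case by (rule entails_MP)
qed (simp add: entails_Nil entails_provable)

lemma entails_weaken: "\<Gamma> \<turnstile> B \<Longrightarrow> set \<Gamma> \<subseteq> set \<Delta> \<Longrightarrow> wfs \<Delta> \<Longrightarrow> \<Delta> \<turnstile> B"
  by (rule entails_cut) (auto intro: entails_assm)

lemma entails_AndI: "\<Gamma> \<turnstile> A \<Longrightarrow> \<Gamma> \<turnstile> B \<Longrightarrow> \<Gamma> \<turnstile> And A B"
  by (rule entails_MP[OF entails_axiom_MP[OF il_axiom.AndI]]) (auto dest: entails_wf)

lemma entails_AndE1: "\<Gamma> \<turnstile> And A B \<Longrightarrow> \<Gamma> \<turnstile> A"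
  by (rule entails_axiom_MP[OF il_axiom.AndE1]) (auto dest: entails_wf)

lemma entails_AndE2: "\<Gamma> \<turnstile> And A B \<Longrightarrow> \<Gamma> \<turnstile> B"
  by (rule entails_axiom_MP[OF il_axiom.AndE2]) (auto dest: entails_wf)

lemma entails_OrI1: "\<Gamma> \<turnstile> A \<Longrightarrow> wf_fm L B \<Longrightarrow> \<Gamma> \<turnstile> Or A B"
  by (rule entails_axiom_MP[OF il_axiom.OrI1]) (auto dest: entails_wf)

lemma entails_OrI2: "\<Gamma> \<turnstile> B \<Longrightarrow> wf_fm L A \<Longrightarrow> \<Gamma> \<turnstile> Or A B"
  by (rule entails_axiom_MP[OF il_axiom.OrI2]) (auto dest: entails_wf)

lemma entails_OrE:
  assumes "\<Gamma> \<turnstile> Or A B" "A # \<Gamma> \<turnstile> C" "B # \<Gamma> \<turnstile> C"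
  shows "\<Gamma> \<turnstile> C"
proof -
  have "\<Gamma> \<turnstile> Imp (Imp A C) (Imp (Imp B C) (Imp (Or A B) C))"
    using assms by (intro entails_axiom il_axiom.OrE) (auto dest: entails_wf)
  then show ?thesis
    using assms unfolding entails_Cons by (blast intro: entails_MP)
qed

lemma entails_BotE: "\<Gamma> \<turnstile> Bot \<Longrightarrow> wf_fm L A \<Longrightarrow> \<Gamma> \<turnstile> A"
  by (rule entails_axiom_MP[OF il_axiom.BotE])

lemma entails_AllE: "\<Gamma> \<turnstile> All \<rho> A \<Longrightarrow> typed t \<rho> \<Longrightarrow> \<Gamma> \<turnstile> inst \<rho> t A"
  by (rule entails_axiom_MP[OF il_axiom.AllE]) (auto dest!: entails_wf intro: wf_fm_inst)

lemma entails_ExI: "\<Gamma> \<turnstile> inst \<rho> t A \<Longrightarrow> typed t \<rho> \<Longrightarrow> wf_fm L A \<Longrightarrow> \<Gamma> \<turnstile> Ex \<rho> A"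
  by (rule entails_axiom_MP[OF il_axiom.ExI]) auto

text \<open>
  The quantifier rules \<open>AllI\<close> and \<open>ExE\<close> of the calculus have room for a single side formula, into
  which the whole context is packed.
\<close>

definition conj_list :: "('f, 'r) fm list \<Rightarrow> ('f, 'r) fm" where
  "conj_list \<Delta> = foldr And \<Delta> (Imp Bot Bot)"

lemma lift_fm_conj_list: "lift_fm \<rho> (conj_list \<Delta>) = conj_list (map (lift_fm \<rho>) \<Delta>)"
  by (induction \<Delta>) (simp_all add: conj_list_def)

lemma entails_conj_list_iff: "\<Gamma> \<turnstile> conj_list \<Delta> \<longleftrightarrow> wfs \<Gamma> \<and> (\<forall>A\<in>set \<Delta>. \<Gamma> \<turnstile> A)"
proof (induction \<Delta>)
  case Nil
  show ?case
    using entails_Imp_self[of Bot \<Gamma>] by (auto simp: conj_list_def dest: entails_wf)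
next
  case (Cons A \<Delta>)
  then show ?case
    by (auto simp: conj_list_def intro: entails_AndI entails_AndE1 entails_AndE2)
qed

lemma entails_conj_list: "\<Gamma> \<turnstile> A \<Longrightarrow> [conj_list \<Gamma>] \<turnstile> A"
proof (rule entails_cut)
  assume "\<Gamma> \<turnstile> A"
  then have "\<Gamma> \<turnstile> conj_list \<Gamma>"
    by (auto simp: entails_conj_list_iff dest: entails_wf intro: entails_assm)
  then show "wfs [conj_list \<Gamma>]"
    by (auto dest: entails_wf)
  then have "[conj_list \<Gamma>] \<turnstile> conj_list \<Gamma>"
    by (intro entails_assm) auto
  then show "[conj_list \<Gamma>] \<turnstile> B" if "B \<in> set \<Gamma>" for B
    using that by (simp add: entails_conj_list_iff)
qed

lemma entails_conj_listD: "[conj_list \<Gamma>] \<turnstile> A \<Longrightarrow> wfs \<Gamma> \<Longrightarrow> \<Gamma> \<turnstile> A"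
  by (rule entails_cut) (auto simp: entails_conj_list_iff intro: entails_assm)

lemma entails_AllI:
  assumes "map (lift_fm \<rho>) \<Gamma> \<turnstile> A"
  shows "\<Gamma> \<turnstile> All \<rho> A"
proof (rule entails_conj_listD)
  have "[lift_fm \<rho> (conj_list \<Gamma>)] \<turnstile> A"
    using entails_conj_list[OF assms] by (simp add: lift_fm_conj_list)
  then show "[conj_list \<Gamma>] \<turnstile> All \<rho> A"
    by (auto simp: entails_Cons entails_Nil intro: provable.AllI)
  show "wfs \<Gamma>"
    using entails_wf[OF assms] by simp
qed

lemma entails_ExE:
  assumes "\<Gamma> \<turnstile> Ex \<rho> A" "A # map (lift_fm \<rho>) \<Gamma> \<turnstile> lift_fm \<rho> C"
  shows "\<Gamma> \<turnstile> C"
proof -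
  have "[lift_fm \<rho> (conj_list \<Gamma>)] \<turnstile> Imp A (lift_fm \<rho> C)"
    using assms(2) unfolding lift_fm_conj_list by (intro entails_conj_list) (simp add: entails_Cons)
  then have swapped: "[A, lift_fm \<rho> (conj_list \<Gamma>)] \<turnstile> lift_fm \<rho> C"
    by (simp add: entails_Cons)
  then have "[lift_fm \<rho> (conj_list \<Gamma>), A] \<turnstile> lift_fm \<rho> C"
    by (rule entails_weaken) (use entails_wf[OF swapped] in auto)
  then have "provable L T (Imp A (lift_fm \<rho> (Imp (conj_list \<Gamma>) C)))"
    by (simp add: entails_Cons entails_Nil)
  then have "provable L T (Imp (Ex \<rho> A) (Imp (conj_list \<Gamma>) C))"
    by (rule provable.ExE)
  then have "\<Gamma> \<turnstile> Imp (Ex \<rho> A) (Imp (conj_list \<Gamma>) C)"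
    using entails_wf[OF assms(1)] by (intro entails_provable) auto
  moreover have "\<Gamma> \<turnstile> conj_list \<Gamma>"
    using entails_wf[OF assms(1)] by (auto simp: entails_conj_list_iff intro: entails_assm)
  ultimately show ?thesis
    using assms(1) by (blast intro: entails_MP)
qed

abbreviation in_bound :: "ty \<Rightarrow> 'f tm \<Rightarrow> ('f, 'r) fm" where
  "in_bound \<rho> t \<equiv> In \<rho> (Var \<rho> 0) (lift_tm \<rho> t)"

lemma inst_in_bound [simp]: "inst \<rho> q (in_bound \<rho> t) = In \<rho> q t"
  by (simp add: inst_eq_sub_fm)

lemma inst_Imp [simp]: "inst \<rho> t (Imp A B) = Imp (inst \<rho> t A) (inst \<rho> t B)"
  and inst_And [simp]: "inst \<rho> t (And A B) = And (inst \<rho> t A) (inst \<rho> t B)"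
  by (simp_all add: inst_eq_sub_fm)

lemma entails_Iff_cong: "\<Gamma> \<turnstile> Iff A B \<Longrightarrow> \<Gamma> \<turnstile> A \<longleftrightarrow> \<Gamma> \<turnstile> B"
  by (blast intro: entails_MP entails_AndE1 entails_AndE2)

lemma entails_BAll_iff: "\<Gamma> \<turnstile> BAll \<rho> t A \<longleftrightarrow> typed t (Star \<rho>) \<and> \<Gamma> \<turnstile> All \<rho> (Imp (in_bound \<rho> t) A)"
proof -
  have "\<Gamma> \<turnstile> Iff (BAll \<rho> t A) (All \<rho> (Imp (in_bound \<rho> t) A))"
    if "typed t (Star \<rho>)" "wf_fm L A" "wfs \<Gamma>"
    using that by (intro entails_axiom il_axiom.BAll) auto
  from entails_Iff_cong[OF this] show ?thesis
    using entails_wf[of \<Gamma> "BAll \<rho> t A"] entails_wf[of \<Gamma> "All \<rho> (Imp (in_bound \<rho> t) A)"] by auto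
qed

lemma entails_BEx_iff: "\<Gamma> \<turnstile> BEx \<rho> t A \<longleftrightarrow> typed t (Star \<rho>) \<and> \<Gamma> \<turnstile> Ex \<rho> (And (in_bound \<rho> t) A)"
proof -
  have "\<Gamma> \<turnstile> Iff (BEx \<rho> t A) (Ex \<rho> (And (in_bound \<rho> t) A))"
    if "typed t (Star \<rho>)" "wf_fm L A" "wfs \<Gamma>"
    using that by (intro entails_axiom il_axiom.BEx) auto
  from entails_Iff_cong[OF this] show ?thesis
    using entails_wf[of \<Gamma> "BEx \<rho> t A"] entails_wf[of \<Gamma> "Ex \<rho> (And (in_bound \<rho> t) A)"] by auto
qed

lemma entails_BAllI:
  assumes "in_bound \<rho> t # map (lift_fm \<rho>) \<Gamma> \<turnstile> A"
  shows "\<Gamma> \<turnstile> BAll \<rho> t A"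
proof -
  have "typed t (Star \<rho>)"
    using entails_wf[OF assms] by simp
  then show ?thesis
    using assms by (auto simp: entails_BAll_iff entails_Cons intro: entails_AllI)
qed

lemma entails_BExI:
  assumes "\<Gamma> \<turnstile> In \<rho> q t" "\<Gamma> \<turnstile> inst \<rho> q A" "wf_fm L A"
  shows "\<Gamma> \<turnstile> BEx \<rho> t A"
proof -
  have "typed q \<rho>" "typed t (Star \<rho>)"
    using entails_wf[OF assms(1)] by auto
  with assms show ?thesis
    by (auto simp: entails_BEx_iff intro!: entails_ExI[of _ _ q] entails_AndI)
qed

lemma entails_BExE:
  assumes "\<Gamma> \<turnstile> BEx \<rho> t A" "A # in_bound \<rho> t # map (lift_fm \<rho>) \<Gamma> \<turnstile> lift_fm \<rho> C"
  shows "\<Gamma> \<turnstile> C"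
proof (rule entails_ExE)
  show "\<Gamma> \<turnstile> Ex \<rho> (And (in_bound \<rho> t) A)"
    using assms(1) by (simp add: entails_BEx_iff)
  have wfs: "wfs (And (in_bound \<rho> t) A # map (lift_fm \<rho>) \<Gamma>)"
    using entails_wf[OF assms(2)] by auto
  then have "And (in_bound \<rho> t) A # map (lift_fm \<rho>) \<Gamma> \<turnstile> B"
    if "B \<in> set (And (in_bound \<rho> t) A # map (lift_fm \<rho>) \<Gamma>)" for B
    using that by (intro entails_assm) auto
  with wfs show "And (in_bound \<rho> t) A # map (lift_fm \<rho>) \<Gamma> \<turnstile> lift_fm \<rho> C"
    by (intro entails_cut[OF assms(2)]) (auto intro: entails_AndE1 entails_AndE2)
qed

lemma entails_AllsI: "map (lifts_fm \<rho>s) \<Gamma> \<turnstile> A \<Longrightarrow> \<Gamma> \<turnstile> Alls \<rho>s A"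
proof (induction \<rho>s arbitrary: \<Gamma>)
  case (Cons \<rho> \<rho>s)
  then show ?case
    using Cons.IH[of "map (lift_fm \<rho>) \<Gamma>"] by (auto intro: entails_AllI simp: o_def)
qed (simp add: map_idI)

lemma entails_AllsE:
  "\<Gamma> \<turnstile> sub_fm s (Alls \<rho>s A) \<Longrightarrow> typeds ts \<rho>s \<Longrightarrow> \<Gamma> \<turnstile> sub_fm (sub_conss \<rho>s ts s) A"
proof (induction \<rho>s arbitrary: ts s)
  case (Cons \<rho> \<rho>s)
  from Cons.prems(2) obtain t ts' where ts: "ts = t # ts'" "typed t \<rho>" "typeds ts' \<rho>s"
    by (auto simp: list_all2_Cons2)
  have "\<Gamma> \<turnstile> All \<rho> (sub_fm (up_sub \<rho> s) (Alls \<rho>s A))"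
    using Cons.prems(1) by simp
  from entails_AllE[OF this ts(2)] have "\<Gamma> \<turnstile> sub_fm (sub_cons \<rho> t s) (Alls \<rho>s A)"
    by (simp only: inst_sub_fm_up_sub)
  from Cons.IH[OF this ts(3)] ts(1) show ?case by simp
qed auto


subsection \<open>Closure under substitution\<close>

lemma provable_sub_fm_sub_cons:
  assumes "\<And>A. provable L T A \<Longrightarrow> provable L T (sub_fm s A)" "typed t \<rho>" "provable L T A"
  shows "provable L T (sub_fm (sub_cons \<rho> t s) A)"
proof -
  have "[] \<turnstile> All \<rho> A"
    using assms(3) by (intro entails_AllI) (simp add: entails_Nil)
  then have "[] \<turnstile> All \<rho> (sub_fm (up_sub \<rho> s) A)"
    using assms(1) by (simp add: entails_Nil flip: sub_fm.simps)
  then show ?thesis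
    using entails_AllE[OF _ assms(2)] by (fastforce simp: entails_Nil inst_sub_fm_up_sub)
qed

lemma ex_provable_sub_agreeing:
  assumes "typed_sub L s"
  shows "\<exists>u. (\<forall>A. provable L T A \<longrightarrow> provable L T (sub_fm u A)) \<and>
    (\<forall>\<sigma> n. n < count_list \<rho>s \<sigma> \<longrightarrow> u \<sigma> n = s \<sigma> n)"
  using assms
proof (induction \<rho>s arbitrary: s)
  case Nil
  show ?case
    by (intro exI[of _ Var]) simp
next
  case (Cons \<rho> \<rho>s)
  have "typed_sub L (s \<odot> shift_sub \<rho>)"
    using Cons.prems by (simp add: typed_sub_comp_sub)
  from Cons.IH[OF this] obtain u
    where u: "\<And>A. provable L T A \<Longrightarrow> provable L T (sub_fm u A)"
      "\<And>\<sigma> n. n < count_list \<rho>s \<sigma> \<Longrightarrow> u \<sigma> n = s \<sigma> (shift \<rho> \<sigma> n)"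
    by auto
  have "sub_cons \<rho> (s \<rho> 0) u \<sigma> n = s \<sigma> n" if "n < count_list (\<rho> # \<rho>s) \<sigma>" for \<sigma> n
    using that u(2) by (cases \<sigma> \<rho> n rule: shift_cases) (auto simp: shift_def sub_cons_def)
  moreover have "provable L T (sub_fm (sub_cons \<rho> (s \<rho> 0) u) A)" if "provable L T A" for A
    using u(1) typed_subD[OF Cons.prems] that by (rule provable_sub_fm_sub_cons)
  ultimately show ?case by blast
qed

lemma ex_count_list_gt:
  assumes "finite V"
  shows "\<exists>\<rho>s. \<forall>(\<sigma>, n)\<in>V. n < count_list \<rho>s \<sigma>"
  using assms
proof induction
  case (insert v V)
  then obtain \<rho>s where \<rho>s: "\<forall>(\<sigma>, n)\<in>V. n < count_list \<rho>s \<sigma>" by blast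
  obtain \<tau> m where v: "v = (\<tau>, m)" by fastforce
  have "count_list (replicate (Suc m) \<tau>) \<tau> = Suc m"
    by (induction m) auto
  then have "\<forall>(\<sigma>, n)\<in>insert v V. n < count_list (replicate (Suc m) \<tau> @ \<rho>s) \<sigma>"
    using \<rho>s by (auto simp: v)
  then show ?case by blast
qed simp

text \<open>
  Formulas of \<open>T\<close> are not closed under substitution, so this does not go by induction on the
  derivation: generalize the variables of \<open>A\<close> one after the other, then instantiate.
\<close>

lemma provable_sub_fm:
  assumes "provable L T A" "typed_sub L s"
  shows "provable L T (sub_fm s A)"
proof -
  obtain \<rho>s where \<rho>s: "\<forall>(\<sigma>, n)\<in>fv_fm A. n < count_list \<rho>s \<sigma>"
    using ex_count_list_gt[OF finite_fv_fm] by blast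
  obtain u where u: "\<And>A. provable L T A \<Longrightarrow> provable L T (sub_fm u A)"
    "\<And>\<sigma> n. n < count_list \<rho>s \<sigma> \<Longrightarrow> u \<sigma> n = s \<sigma> n"
    using ex_provable_sub_agreeing[OF assms(2)] by blast
  have "sub_fm u A = sub_fm s A"
    using \<rho>s u(2) by (intro sub_fm_cong) (auto simp: agree_on_def)
  with u(1)[OF assms(1)] show ?thesis by simp
qed

lemma entails_sub_fm: "\<Gamma> \<turnstile> A \<Longrightarrow> typed_sub L s \<Longrightarrow> map (sub_fm s) \<Gamma> \<turnstile> sub_fm s A"
proof (induction \<Gamma> arbitrary: A)
  case (Cons B \<Gamma>)
  then show ?case
    using Cons.IH[of "Imp B A"] by (simp add: entails_Cons)
qed (simp add: entails_Nil provable_sub_fm)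


subsection \<open>Worlds\<close>

definition access :: "('f, 'r) fm list \<Rightarrow> 'f sub \<Rightarrow> ('f, 'r) fm list \<Rightarrow> bool"
    (\<open>_ \<leadsto>\<^bsub>_\<^esub> _\<close> [51, 0, 51] 50) where
  "\<Gamma> \<leadsto>\<^bsub>s\<^esub> \<Gamma>' \<longleftrightarrow> typed_sub L s \<and> sub_fm s ` set \<Gamma> \<subseteq> set \<Gamma>' \<and> wfs \<Gamma>'"

lemma access_typed_sub: "\<Gamma> \<leadsto>\<^bsub>s\<^esub> \<Gamma>' \<Longrightarrow> typed_sub L s"
  and access_wfs: "\<Gamma> \<leadsto>\<^bsub>s\<^esub> \<Gamma>' \<Longrightarrow> wfs \<Gamma>'"
  by (simp_all add: access_def)

lemma access_Nil: "[] \<leadsto>\<^bsub>s\<^esub> \<Gamma> \<longleftrightarrow> typed_sub L s \<and> wfs \<Gamma>"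
  by (simp add: access_def)

lemma access_Var: "\<Gamma> \<leadsto>\<^bsub>Var\<^esub> \<Gamma>' \<longleftrightarrow> set \<Gamma> \<subseteq> set \<Gamma>' \<and> wfs \<Gamma>'"
  by (simp add: access_def)

lemma access_shift_sub: "\<Gamma> \<leadsto>\<^bsub>shift_sub \<rho>\<^esub> \<Gamma>' \<longleftrightarrow> lift_fm \<rho> ` set \<Gamma> \<subseteq> set \<Gamma>' \<and> wfs \<Gamma>'"
  by (simp add: access_def ren_fm_eq_sub_fm)

lemma access_lifts_sub: "\<Gamma> \<leadsto>\<^bsub>lifts_sub \<rho>s\<^esub> \<Gamma>' \<longleftrightarrow> lifts_fm \<rho>s ` set \<Gamma> \<subseteq> set \<Gamma>' \<and> wfs \<Gamma>'"
  by (simp add: access_def lifts_fm_eq_sub_fm)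

lemma access_comp_sub: "\<Gamma> \<leadsto>\<^bsub>s\<^esub> \<Gamma>' \<Longrightarrow> \<Gamma>' \<leadsto>\<^bsub>s'\<^esub> \<Gamma>'' \<Longrightarrow> \<Gamma> \<leadsto>\<^bsub>s' \<odot> s\<^esub> \<Gamma>''"
  by (force simp: access_def typed_sub_comp_sub simp flip: sub_fm_sub_fm)

lemma typed_access: "typed t \<tau> \<Longrightarrow> \<Gamma> \<leadsto>\<^bsub>s\<^esub> \<Gamma>' \<Longrightarrow> typed (sub_tm s t) \<tau>"
  by (auto intro: has_type_sub_tm access_typed_sub)

lemma entails_access: "\<Gamma> \<turnstile> A \<Longrightarrow> \<Gamma> \<leadsto>\<^bsub>s\<^esub> \<Gamma>' \<Longrightarrow> \<Gamma>' \<turnstile> sub_fm s A"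
  by (rule entails_weaken[OF entails_sub_fm]) (auto simp: access_def)

lemma entails_AllD: "\<Gamma> \<turnstile> All \<rho> A \<Longrightarrow> map (lift_fm \<rho>) \<Gamma> \<turnstile> A"
proof -
  assume all: "\<Gamma> \<turnstile> All \<rho> A"
  then have "\<Gamma> \<leadsto>\<^bsub>shift_sub \<rho>\<^esub> map (lift_fm \<rho>) \<Gamma>"
    by (auto simp: access_shift_sub dest: entails_wf)
  from entails_access[OF all this]
  have "map (lift_fm \<rho>) \<Gamma> \<turnstile> All \<rho> (sub_fm (up_sub \<rho> (shift_sub \<rho>)) A)"
    by simp
  from entails_AllE[OF this, of "Var \<rho> 0"] show ?thesis
    by (simp add: inst_sub_fm_up_sub)
qed

lemma entails_BAllD: "\<Gamma> \<turnstile> BAll \<rho> t A \<Longrightarrow> in_bound \<rho> t # map (lift_fm \<rho>) \<Gamma> \<turnstile> A"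
  by (auto simp: entails_BAll_iff entails_Cons dest: entails_AllD)

lemma entails_Or_mono:
  assumes "\<Gamma> \<turnstile> Or A B" "wf_fm L A'" "wf_fm L B'"
    and "\<And>\<Gamma>'. \<Gamma> \<leadsto>\<^bsub>Var\<^esub> \<Gamma>' \<Longrightarrow> \<Gamma>' \<turnstile> A \<Longrightarrow> \<Gamma>' \<turnstile> A'"
    and "\<And>\<Gamma>'. \<Gamma> \<leadsto>\<^bsub>Var\<^esub> \<Gamma>' \<Longrightarrow> \<Gamma>' \<turnstile> B \<Longrightarrow> \<Gamma>' \<turnstile> B'"
  shows "\<Gamma> \<turnstile> Or A' B'"
proof (rule entails_OrE[OF assms(1)])
  have wfs: "wfs (A # \<Gamma>)" "wfs (B # \<Gamma>)"
    using entails_wf[OF assms(1)] by auto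
  then have "A # \<Gamma> \<turnstile> A'" "B # \<Gamma> \<turnstile> B'"
    using entails_assm[OF wfs(1), of A] entails_assm[OF wfs(2), of B]
    by (auto simp: access_Var intro!: assms(4,5))
  then show "A # \<Gamma> \<turnstile> Or A' B'" "B # \<Gamma> \<turnstile> Or A' B'"
    using assms(2,3) by (auto intro: entails_OrI1 entails_OrI2)
qed

lemma entails_All_mono:
  assumes "\<Gamma> \<turnstile> All \<rho> A" "\<And>\<Gamma>'. \<Gamma> \<leadsto>\<^bsub>shift_sub \<rho>\<^esub> \<Gamma>' \<Longrightarrow> \<Gamma>' \<turnstile> A \<Longrightarrow> \<Gamma>' \<turnstile> B"
  shows "\<Gamma> \<turnstile> All \<rho> B"
proof (rule entails_AllI, rule assms(2))
  show "map (lift_fm \<rho>) \<Gamma> \<turnstile> A"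
    using assms(1) by (rule entails_AllD)
  then show "\<Gamma> \<leadsto>\<^bsub>shift_sub \<rho>\<^esub> map (lift_fm \<rho>) \<Gamma>"
    by (auto simp: access_shift_sub dest: entails_wf)
qed

lemma entails_BAll_mono:
  assumes "\<Gamma> \<turnstile> BAll \<rho> t A" "\<And>\<Gamma>'. \<Gamma> \<leadsto>\<^bsub>shift_sub \<rho>\<^esub> \<Gamma>' \<Longrightarrow> \<Gamma>' \<turnstile> A \<Longrightarrow> \<Gamma>' \<turnstile> B"
  shows "\<Gamma> \<turnstile> BAll \<rho> t B"
proof (rule entails_BAllI, rule assms(2))
  show "in_bound \<rho> t # map (lift_fm \<rho>) \<Gamma> \<turnstile> A"
    using assms(1) by (rule entails_BAllD)
  then show "\<Gamma> \<leadsto>\<^bsub>shift_sub \<rho>\<^esub> in_bound \<rho> t # map (lift_fm \<rho>) \<Gamma>"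
    by (auto simp: access_shift_sub dest: entails_wf)
qed

lemma entails_BEx_mono:
  assumes "\<Gamma> \<turnstile> BEx \<rho> t A"
    and "\<And>\<Gamma>'. \<Gamma> \<leadsto>\<^bsub>shift_sub \<rho>\<^esub> \<Gamma>' \<Longrightarrow> \<Gamma>' \<turnstile> in_bound \<rho> t \<Longrightarrow> \<Gamma>' \<turnstile> A \<Longrightarrow> \<Gamma>' \<turnstile> in_bound \<rho> t'"
    and "\<And>\<Gamma>'. \<Gamma> \<leadsto>\<^bsub>shift_sub \<rho>\<^esub> \<Gamma>' \<Longrightarrow> \<Gamma>' \<turnstile> in_bound \<rho> t \<Longrightarrow> \<Gamma>' \<turnstile> A \<Longrightarrow> \<Gamma>' \<turnstile> B"
  shows "\<Gamma> \<turnstile> BEx \<rho> t' B"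
proof (rule entails_BExE[OF assms(1)])
  let ?\<Gamma> = "A # in_bound \<rho> t # map (lift_fm \<rho>) \<Gamma>"
  have wfs: "wfs ?\<Gamma>"
    using entails_wf[OF assms(1)] by auto
  then have "\<Gamma> \<leadsto>\<^bsub>shift_sub \<rho>\<^esub> ?\<Gamma>" "?\<Gamma> \<turnstile> in_bound \<rho> t" "?\<Gamma> \<turnstile> A"
    by (auto simp: access_shift_sub intro!: entails_assm)
  then have B: "?\<Gamma> \<turnstile> in_bound \<rho> t'" "?\<Gamma> \<turnstile> B"
    by (rule assms(2,3))+
  then show "?\<Gamma> \<turnstile> lift_fm \<rho> (BEx \<rho> t' B)"
    using entails_wf[OF B(2)] by (auto intro: entails_BExI[of _ _ "Var \<rho> 0"])
qed


section \<open>Equality and combinatory completeness\<close>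

definition atomic :: "('f, 'r) fm \<Rightarrow> bool" where
  "atomic A \<longleftrightarrow> height A = 0"

lemma repl_tm_sub_tm:
  "(\<And>\<sigma> n. repl_tm x y (s \<sigma> n) (s' \<sigma> n)) \<Longrightarrow> repl_tm x y (sub_tm s t) (sub_tm s' t)"
  by (induction t) (auto intro: repl_tm.intros)

lemma repl_fm_sub_fm:
  assumes "atomic A" "\<And>\<sigma> n. repl_tm x y (s \<sigma> n) (s' \<sigma> n)"
  shows "repl_fm x y (sub_fm s A) (sub_fm s' A)"
  using assms(1) repl_tm_sub_tm[OF assms(2)]
  by (cases A) (auto simp: atomic_def list_all2_conv_all_nth intro!: repl_fm.intros)

lemma entails_Eq_subst:
  assumes eq: "\<Gamma> \<turnstile> Eq \<rho> x y" and "\<Gamma> \<turnstile> inst \<rho> x A" and A: "atomic A" "wf_fm L A"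
  shows "\<Gamma> \<turnstile> inst \<rho> y A"
proof -
  let ?u = "\<lambda>i. sub_cons \<rho> (Var \<rho> i) (shift_sub \<rho> \<odot> shift_sub \<rho>)"
  let ?s = "sub_cons \<rho> x (sub_cons \<rho> y Var)"
  have "repl_tm (Var \<rho> 0) (Var \<rho> (Suc 0)) (?u 0 \<sigma> n) (?u (Suc 0) \<sigma> n)" for \<sigma> n
    by (cases \<sigma> \<rho> n rule: shift_cases) (auto intro: repl_tm.intros)
  then have "il_axiom L (Imp (And (Eq \<rho> (Var \<rho> 0) (Var \<rho> (Suc 0))) (sub_fm (?u 0) A))
      (sub_fm (?u (Suc 0)) A))" (is "il_axiom L ?leibniz")
    by (intro il_axiom.eq_repl[OF refl refl] repl_fm_sub_fm A(1))
  moreover have "wf_fm L ?leibniz"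
    using A(2) by (auto intro!: wf_fm_sub_fm typed_sub_sub_cons typed_sub_comp_sub)
  ultimately have "\<Gamma> \<turnstile> sub_fm ?s ?leibniz"
    using entails_wf[OF eq]
    by (intro entails_provable provable_sub_fm provable.logical typed_sub_sub_cons) auto
  moreover have "?s \<odot> (shift_sub \<rho> \<odot> shift_sub \<rho>) = Var"
    by (intro ext) simp
  ultimately have "\<Gamma> \<turnstile> Imp (And (Eq \<rho> x y) (inst \<rho> x A)) (inst \<rho> y A)"
    by (simp add: inst_eq_sub_fm sub_fm_sub_fm comp_sub_cons)
  then show ?thesis
    using assms(1,2) by (blast intro: entails_MP entails_AndI)
qed

lemma atomic_Eq [simp]: "atomic (Eq \<rho> t q)"
  and atomic_In [simp]: "atomic (In \<rho> t q)"
  by (simp_all add: atomic_def)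

lemma entails_In_Eq: "\<Gamma> \<turnstile> Eq (Star \<rho>) x y \<Longrightarrow> \<Gamma> \<turnstile> In \<rho> w x \<Longrightarrow> \<Gamma> \<turnstile> In \<rho> w y"
  using entails_Eq_subst[of \<Gamma> "Star \<rho>" x y "In \<rho> (lift_tm (Star \<rho>) w) (Var (Star \<rho>) 0)"]
  by (auto simp: inst_eq_sub_fm dest: entails_wf)

definition assign :: "ty list \<Rightarrow> 'f tm list \<Rightarrow> 'f sub" where
  "assign \<sigma>s ts = (\<lambda>\<sigma> n. if n < length \<sigma>s \<and> \<sigma>s ! n = \<sigma> then ts ! n else Var \<sigma> n)"

lemma typed_sub_assign: "typeds ts \<sigma>s \<Longrightarrow> typed_sub L (assign \<sigma>s ts)"
  by (auto simp: typed_sub_def assign_def list_all2_conv_all_nth)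

lemma entails_assign: "provable L T A \<Longrightarrow> typeds ts \<sigma>s \<Longrightarrow> wfs \<Gamma> \<Longrightarrow> \<Gamma> \<turnstile> sub_fm (assign \<sigma>s ts) A"
  by (intro entails_provable provable_sub_fm typed_sub_assign)

lemma entails_assign_axiom:
  "il_axiom L A \<Longrightarrow> wf_fm L A \<Longrightarrow> typeds ts \<sigma>s \<Longrightarrow> wfs \<Gamma> \<Longrightarrow> \<Gamma> \<turnstile> sub_fm (assign \<sigma>s ts) A"
  by (intro entails_assign provable.logical)

lemma entails_Eq_refl: "typed t \<rho> \<Longrightarrow> wfs \<Gamma> \<Longrightarrow> \<Gamma> \<turnstile> Eq \<rho> t t"
  using entails_assign_axiom[OF il_axiom.eq_refl[of "Var \<rho> 0" \<rho> 0 L], of "[t]" "[\<rho>]" \<Gamma>]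
  by (simp add: assign_def)

lemma entails_Eq_sym:
  assumes "\<Gamma> \<turnstile> Eq \<rho> x y"
  shows "\<Gamma> \<turnstile> Eq \<rho> y x"
proof -
  have "\<Gamma> \<turnstile> Eq \<rho> x x"
    using entails_wf[OF assms] by (intro entails_Eq_refl) auto
  then show ?thesis
    using entails_Eq_subst[OF assms, of "Eq \<rho> (Var \<rho> 0) (lift_tm \<rho> x)"] entails_wf[OF assms]
    by (simp add: inst_eq_sub_fm)
qed

lemma entails_Eq_trans: "\<Gamma> \<turnstile> Eq \<rho> x y \<Longrightarrow> \<Gamma> \<turnstile> Eq \<rho> y z \<Longrightarrow> \<Gamma> \<turnstile> Eq \<rho> x z"
  using entails_Eq_subst[of \<Gamma> \<rho> y z "Eq \<rho> (lift_tm \<rho> x) (Var \<rho> 0)"]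
  by (auto simp: inst_eq_sub_fm dest: entails_wf)

lemma entails_Eq_App_left:
  assumes "\<Gamma> \<turnstile> Eq (\<sigma> \<rightarrow>\<^sub>t \<tau>) f g" "typed x \<sigma>"
  shows "\<Gamma> \<turnstile> Eq \<tau> (f \<cdot> x) (g \<cdot> x)"
proof -
  let ?A = "Eq \<tau> (lift_tm (\<sigma> \<rightarrow>\<^sub>t \<tau>) (f \<cdot> x)) (Var (\<sigma> \<rightarrow>\<^sub>t \<tau>) 0 \<cdot> lift_tm (\<sigma> \<rightarrow>\<^sub>t \<tau>) x)"
  have "typed (f \<cdot> x) \<tau>" "wf_fm L ?A"
    using entails_wf[OF assms(1)] assms(2) by (auto simp: has_type_App_iff)
  then show ?thesis
    using entails_Eq_subst[OF assms(1), of ?A] entails_wf[OF assms(1)]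
    by (simp add: inst_eq_sub_fm entails_Eq_refl)
qed

lemma entails_Eq_App_right:
  assumes "\<Gamma> \<turnstile> Eq \<sigma> x y" "typed f (\<sigma> \<rightarrow>\<^sub>t \<tau>)"
  shows "\<Gamma> \<turnstile> Eq \<tau> (f \<cdot> x) (f \<cdot> y)"
proof -
  let ?A = "Eq \<tau> (lift_tm \<sigma> (f \<cdot> x)) (lift_tm \<sigma> f \<cdot> Var \<sigma> 0)"
  have "typed (f \<cdot> x) \<tau>" "wf_fm L ?A"
    using entails_wf[OF assms(1)] assms(2) by (auto simp: has_type_App_iff)
  then show ?thesis
    using entails_Eq_subst[OF assms(1), of ?A] entails_wf[OF assms(1)]
    by (simp add: inst_eq_sub_fm entails_Eq_refl)
qed

lemma entails_Eq_App:
  assumes "\<Gamma> \<turnstile> Eq (\<sigma> \<rightarrow>\<^sub>t \<tau>) f g" "\<Gamma> \<turnstile> Eq \<sigma> x y"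
  shows "\<Gamma> \<turnstile> Eq \<tau> (f \<cdot> x) (g \<cdot> y)"
proof (rule entails_Eq_trans)
  show "\<Gamma> \<turnstile> Eq \<tau> (f \<cdot> x) (g \<cdot> x)"
    using assms entails_wf[OF assms(2)] by (auto intro: entails_Eq_App_left)
  show "\<Gamma> \<turnstile> Eq \<tau> (g \<cdot> x) (g \<cdot> y)"
    using assms entails_wf[OF assms(1)] by (auto intro: entails_Eq_App_right)
qed

lemma entails_Eq_apps:
  "\<Gamma> \<turnstile> Eq (arrs \<rho>s \<tau>) x y \<Longrightarrow> typeds qs \<rho>s \<Longrightarrow> \<Gamma> \<turnstile> Eq \<tau> (apps x qs) (apps y qs)"
proof (induction \<rho>s arbitrary: x y qs)
  case (Cons \<rho> \<rho>s)
  then show ?case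
    by (auto simp: list_all2_Cons2 dest: entails_Eq_App_left)
qed simp

lemma entails_Eq_Pi:
  assumes "typed x \<sigma>" "typed y \<tau>" "wfs \<Gamma>"
  shows "\<Gamma> \<turnstile> Eq \<sigma> (Con (CPi \<sigma> \<tau>) \<cdot> x \<cdot> y) x"
  using entails_assign_axiom[OF il_axiom.Pi[OF refl refl, of L \<sigma> \<tau> 0 1], of "[x, y]" "[\<sigma>, \<tau>]" \<Gamma>]
    assms
  by (simp add: has_type_App_iff assign_def)

lemma entails_Eq_Sigma:
  assumes "typed x (\<rho> \<rightarrow>\<^sub>t \<sigma> \<rightarrow>\<^sub>t \<tau>)" "typed y (\<rho> \<rightarrow>\<^sub>t \<sigma>)" "typed z \<rho>" "wfs \<Gamma>"
  shows "\<Gamma> \<turnstile> Eq \<tau> (Con (CSigma \<rho> \<sigma> \<tau>) \<cdot> x \<cdot> y \<cdot> z) (x \<cdot> z \<cdot> (y \<cdot> z))"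
  using entails_assign_axiom[OF il_axiom.Sigma[OF refl refl refl, of L \<tau> \<rho> \<sigma> 0 1 2],
      of "[x, y, z]" "[\<rho> \<rightarrow>\<^sub>t \<sigma> \<rightarrow>\<^sub>t \<tau>, \<rho> \<rightarrow>\<^sub>t \<sigma>, \<rho>]" \<Gamma>] assms
  by (simp add: has_type_App_iff assign_def)

lemma entails_In_Sing:
  assumes "typed x \<sigma>" "wfs \<Gamma>"
  shows "\<Gamma> \<turnstile> In \<sigma> x (Con (CSing \<sigma>) \<cdot> x)"
proof -
  have "\<Gamma> \<turnstile> Iff (In \<sigma> x (Con (CSing \<sigma>) \<cdot> x)) (Eq \<sigma> x x)"
    using entails_assign_axiom[OF il_axiom.in_sing[OF refl refl, of L \<sigma> 0 1],
        of "[x, x]" "[\<sigma>, \<sigma>]" \<Gamma>] assms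
    by (simp add: has_type_App_iff assign_def)
  from entails_Iff_cong[OF this] show ?thesis
    using assms by (simp add: entails_Eq_refl)
qed

lemma entails_In_Un_iff:
  assumes "typed w \<sigma>" "typed x (Star \<sigma>)" "typed y (Star \<sigma>)" "wfs \<Gamma>"
  shows "\<Gamma> \<turnstile> In \<sigma> w (Con (CUn \<sigma>) \<cdot> x \<cdot> y) \<longleftrightarrow> \<Gamma> \<turnstile> Or (In \<sigma> w x) (In \<sigma> w y)"
proof (rule entails_Iff_cong)
  show "\<Gamma> \<turnstile> Iff (In \<sigma> w (Con (CUn \<sigma>) \<cdot> x \<cdot> y)) (Or (In \<sigma> w x) (In \<sigma> w y))"
    using entails_assign_axiom[OF il_axiom.in_un[OF refl refl refl, of L \<sigma> 0 1 2],
        of "[w, x, y]" "[\<sigma>, Star \<sigma>, Star \<sigma>]" \<Gamma>] assms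
    by (simp add: has_type_App_iff assign_def)
qed

lemma entails_In_BigUn:
  assumes "typed y (\<sigma> \<rightarrow>\<^sub>t Star \<tau>)" "\<Gamma> \<turnstile> In \<sigma> z x" "\<Gamma> \<turnstile> In \<tau> w (y \<cdot> z)"
  shows "\<Gamma> \<turnstile> In \<tau> w (Con (CBigUn \<sigma> \<tau>) \<cdot> x \<cdot> y)"
proof -
  have "\<Gamma> \<turnstile> Imp (And (In \<sigma> z x) (In \<tau> w (y \<cdot> z))) (In \<tau> w (Con (CBigUn \<sigma> \<tau>) \<cdot> x \<cdot> y))"
    using entails_assign_axiom[OF il_axiom.in_bigun[OF refl refl refl refl, of L \<sigma> 2 0 \<tau> 3 1],
        of "[x, y, z, w]" "[Star \<sigma>, \<sigma> \<rightarrow>\<^sub>t Star \<tau>, \<sigma>, \<tau>]" \<Gamma>]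
      assms(1) entails_wf[OF assms(2)] entails_wf[OF assms(3)]
    by (simp add: has_type_App_iff assign_def)
  then show ?thesis
    using assms by (blast intro: entails_MP entails_AndI)
qed

definition abstracts :: "'f tm \<Rightarrow> ty \<Rightarrow> nat \<Rightarrow> 'f tm \<Rightarrow> ty \<Rightarrow> bool" where
  "abstracts u \<rho> n t \<tau> \<longleftrightarrow> typed u (\<rho> \<rightarrow>\<^sub>t \<tau>) \<and> fv_tm u \<subseteq> fv_tm t - {(\<rho>, n)} \<and>
     [] \<turnstile> Eq \<tau> (u \<cdot> Var \<rho> n) t"

lemma abstracts_constantly:
  assumes "typed t \<tau>" "(\<rho>, n) \<notin> fv_tm t"
  shows "abstracts (Con (CPi \<tau> \<rho>) \<cdot> t) \<rho> n t \<tau>"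
  using assms entails_Eq_Pi[OF assms(1), of "Var \<rho> n" \<rho> "[]"]
  by (auto simp: abstracts_def has_type_App_iff)

lemma abstracts_identity:
  "abstracts (Con (CSigma \<rho> (\<rho> \<rightarrow>\<^sub>t \<rho>) \<rho>) \<cdot> Con (CPi \<rho> (\<rho> \<rightarrow>\<^sub>t \<rho>)) \<cdot> Con (CPi \<rho> \<rho>)) \<rho> n (Var \<rho> n) \<rho>"
    (is "abstracts (?S \<cdot> ?K \<cdot> ?K') \<rho> n ?x \<rho>")
proof -
  have "[] \<turnstile> Eq \<rho> (?S \<cdot> ?K \<cdot> ?K' \<cdot> ?x) (?K \<cdot> ?x \<cdot> (?K' \<cdot> ?x))"
    by (rule entails_Eq_Sigma) auto
  moreover have "[] \<turnstile> Eq \<rho> (?K \<cdot> ?x \<cdot> (?K' \<cdot> ?x)) ?x"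
    by (rule entails_Eq_Pi) (auto simp: has_type_App_iff)
  ultimately have "[] \<turnstile> Eq \<rho> (?S \<cdot> ?K \<cdot> ?K' \<cdot> ?x) ?x"
    by (rule entails_Eq_trans)
  then show ?thesis
    by (simp add: abstracts_def has_type_App_iff)
qed

lemma abstracts_App:
  assumes "abstracts u \<rho> n t (\<sigma> \<rightarrow>\<^sub>t \<tau>)" "abstracts v \<rho> n q \<sigma>"
  shows "abstracts (Con (CSigma \<rho> \<sigma> \<tau>) \<cdot> u \<cdot> v) \<rho> n (t \<cdot> q) \<tau>"
proof -
  have "[] \<turnstile> Eq \<tau> (Con (CSigma \<rho> \<sigma> \<tau>) \<cdot> u \<cdot> v \<cdot> Var \<rho> n) (u \<cdot> Var \<rho> n \<cdot> (v \<cdot> Var \<rho> n))"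
    using assms by (intro entails_Eq_Sigma) (auto simp: abstracts_def)
  moreover have "[] \<turnstile> Eq \<tau> (u \<cdot> Var \<rho> n \<cdot> (v \<cdot> Var \<rho> n)) (t \<cdot> q)"
    using assms by (auto simp: abstracts_def intro: entails_Eq_App)
  ultimately have "[] \<turnstile> Eq \<tau> (Con (CSigma \<rho> \<sigma> \<tau>) \<cdot> u \<cdot> v \<cdot> Var \<rho> n) (t \<cdot> q)"
    by (rule entails_Eq_trans)
  then show ?thesis
    using assms by (auto simp: abstracts_def has_type_App_iff)
qed

lemma ex_abstracts: "typed t \<tau> \<Longrightarrow> \<exists>u. abstracts u \<rho> n t \<tau>"
proof (induction rule: has_type.induct)
  case (Con c)
  then show ?case
    using abstracts_constantly[of "Con c"] by auto
next
  case (Var \<sigma> m)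
  show ?case
    using abstracts_identity abstracts_constantly[of "Var \<sigma> m" \<sigma> \<rho> n]
    by (cases "(\<sigma>, m) = (\<rho>, n)") auto
next
  case (App t \<sigma> \<tau> q)
  then show ?case
    by (blast intro: abstracts_App)
qed

abbreviation vars :: "(ty \<times> nat) list \<Rightarrow> 'f tm list" where
  "vars vs \<equiv> map (\<lambda>(\<sigma>, n). Var \<sigma> n) vs"

lemma typeds_vars: "typeds (vars vs) (map fst vs)"
  by (auto simp: list_all2_conv_all_nth case_prod_beta)

lemma ex_abstraction_vars:
  assumes "typed t \<tau>"
  shows "\<exists>u. typed u (arrs (map fst vs) \<tau>) \<and> fv_tm u \<subseteq> fv_tm t - set vs \<and>
    [] \<turnstile> Eq \<tau> (apps u (vars vs)) t"
proof (induction vs)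
  case Nil
  then show ?case
    using assms by (intro exI[of _ t]) (simp add: entails_Eq_refl)
next
  case (Cons v vs)
  then obtain u where u: "typed u (arrs (map fst vs) \<tau>)" "fv_tm u \<subseteq> fv_tm t - set vs"
    "[] \<turnstile> Eq \<tau> (apps u (vars vs)) t" by auto
  obtain \<rho> n where v: "v = (\<rho>, n)" by fastforce
  from ex_abstracts[OF u(1)] obtain u' where u': "abstracts u' \<rho> n u (arrs (map fst vs) \<tau>)"
    by blast
  then have "[] \<turnstile> Eq \<tau> (apps (u' \<cdot> Var \<rho> n) (vars vs)) (apps u (vars vs))"
    using entails_Eq_apps[OF _ typeds_vars] by (auto simp: abstracts_def)
  then have "[] \<turnstile> Eq \<tau> (apps (u' \<cdot> Var \<rho> n) (vars vs)) t"
    using u(3) by (rule entails_Eq_trans)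
  then show ?case
    using u(2) u' by (intro exI[of _ u']) (auto simp: v abstracts_def)
qed

lemma combinatory_completeness:
  assumes "typed t \<tau>" "\<forall>(\<sigma>, n)\<in>fv_tm t. n < length \<sigma>s \<and> \<sigma>s ! n = \<sigma>"
  obtains c where "fv_tm c = {}" "typed c (arrs \<sigma>s \<tau>)"
    "\<And>\<Gamma> qs. wfs \<Gamma> \<Longrightarrow> typeds qs \<sigma>s \<Longrightarrow> \<Gamma> \<turnstile> Eq \<tau> (apps c qs) (sub_tm (assign \<sigma>s qs) t)"
proof -
  let ?vs = "zip \<sigma>s [0..<length \<sigma>s]"
  have "fv_tm t \<subseteq> set ?vs"
    using assms(2) by (fastforce simp: set_zip)
  with ex_abstraction_vars[OF assms(1), of ?vs] obtain c
    where c: "fv_tm c = {}" "typed c (arrs \<sigma>s \<tau>)" "provable L T (Eq \<tau> (apps c (vars ?vs)) t)"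
    by (auto simp: entails_Nil)
  have "\<Gamma> \<turnstile> Eq \<tau> (apps c qs) (sub_tm (assign \<sigma>s qs) t)" if "wfs \<Gamma>" "typeds qs \<sigma>s" for \<Gamma> qs
  proof -
    have "map (sub_tm (assign \<sigma>s qs)) (vars ?vs) = qs"
      using that(2) by (auto simp: assign_def list_all2_lengthD intro: nth_equalityI)
    then show ?thesis
      using entails_assign[OF c(3) that(2,1)] by (simp add: sub_tm_closed[OF c(1)])
  qed
  with c(1,2) show thesis by (rule that)
qed

lemma ex_abstraction_block:
  assumes "typed t \<tau>"
  shows "\<exists>u. typed u (arrs \<rho>s \<tau>) \<and> [] \<turnstile> Eq \<tau> (apply_block \<rho>s u) t"
proof (induction \<rho>s)
  case Nil
  then show ?case
    using assms by (intro exI[of _ t]) (simp add: entails_Eq_refl)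
next
  case (Cons \<rho> \<rho>s)
  then obtain u where u: "typed u (arrs \<rho>s \<tau>)"
    "[] \<turnstile> Eq \<tau> (apply_block \<rho>s u) t" by auto
  obtain u' where u': "abstracts u' \<rho> 0 u (arrs \<rho>s \<tau>)"
    using ex_abstracts[OF u(1)] by blast
  then obtain v where v: "u' = lift_tm \<rho> v"
    using ex_lift_tm[of \<rho> u'] by (auto simp: abstracts_def)
  have "[] \<turnstile> Eq (arrs \<rho>s \<tau>) (lifts_tm \<rho>s (u' \<cdot> Var \<rho> 0)) (lifts_tm \<rho>s u)"
    using entails_sub_fm[of "[]" _ "lifts_sub \<rho>s"] u'
    by (fastforce simp: abstracts_def lifts_tm_eq_sub_tm)
  then have "[] \<turnstile> Eq \<tau> (apply_block \<rho>s (u' \<cdot> Var \<rho> 0)) (apply_block \<rho>s u)"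
    by (rule entails_Eq_apps[OF _ has_type_block_vars])
  then have "[] \<turnstile> Eq \<tau> (apply_block \<rho>s (u' \<cdot> Var \<rho> 0)) t"
    using u(2) by (rule entails_Eq_trans)
  moreover have "lifts_tm \<rho>s (u' \<cdot> Var \<rho> 0) = lifts_tm (\<rho> # \<rho>s) v \<cdot> lifts_tm \<rho>s (Var \<rho> 0)"
    by (simp add: lifts_tm_eq_sub_tm v)
  moreover have "typed v (arrs (\<rho> # \<rho>s) \<tau>)"
    using u' by (simp add: abstracts_def v)
  ultimately show ?case
    by (intro exI[of _ v]) simp
qed

section \<open>Inclusion of realizers\<close>

text \<open>
  Realizers have types ending in some \<open>Star \<sigma>\<close>, so the value at base type never matters; \<open>True\<close>
  makes equal terms comparable at every type.
\<close>

primrec incl :: "ty \<Rightarrow> ('f, 'r) fm list \<Rightarrow> 'f tm \<Rightarrow> 'f tm \<Rightarrow> bool" where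
  "incl G = (\<lambda>\<Gamma> x y. True)"
| "incl (\<rho> \<rightarrow>\<^sub>t \<tau>) = (\<lambda>\<Gamma> x y. \<forall>s \<Gamma>' q. \<Gamma> \<leadsto>\<^bsub>s\<^esub> \<Gamma>' \<longrightarrow> typed q \<rho> \<longrightarrow>
     incl \<tau> \<Gamma>' (sub_tm s x \<cdot> q) (sub_tm s y \<cdot> q))"
| "incl (Star \<sigma>) = (\<lambda>\<Gamma> x y. \<forall>s \<Gamma>' w. \<Gamma> \<leadsto>\<^bsub>s\<^esub> \<Gamma>' \<longrightarrow>
     \<Gamma>' \<turnstile> In \<sigma> w (sub_tm s x) \<longrightarrow> \<Gamma>' \<turnstile> In \<sigma> w (sub_tm s y))"

lemma incl_access: "incl \<tau> \<Gamma> x y \<Longrightarrow> \<Gamma> \<leadsto>\<^bsub>s\<^esub> \<Gamma>' \<Longrightarrow> incl \<tau> \<Gamma>' (sub_tm s x) (sub_tm s y)"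
  using access_comp_sub[of \<Gamma> s \<Gamma>'] by (cases \<tau>) (fastforce simp: sub_tm_sub_tm)+

lemma incl_trans: "incl \<tau> \<Gamma> x y \<Longrightarrow> incl \<tau> \<Gamma> y z \<Longrightarrow> incl \<tau> \<Gamma> x z"
  by (induction \<tau> arbitrary: \<Gamma> x y z) (simp, simp, blast, simp)

lemma incl_Eq: "\<Gamma> \<turnstile> Eq \<tau> x y \<Longrightarrow> incl \<tau> \<Gamma> x y"
proof (induction \<tau> arbitrary: \<Gamma> x y)
  case (Arr \<rho> \<tau>)
  show ?case
    unfolding incl.simps
  proof (intro allI impI)
    fix s \<Gamma>' q assume "\<Gamma> \<leadsto>\<^bsub>s\<^esub> \<Gamma>'" "typed q \<rho>"
    then have "\<Gamma>' \<turnstile> Eq \<tau> (sub_tm s x \<cdot> q) (sub_tm s y \<cdot> q)"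
      using entails_access[OF Arr.prems, of s \<Gamma>'] by (simp add: entails_Eq_App_left)
    then show "incl \<tau> \<Gamma>' (sub_tm s x \<cdot> q) (sub_tm s y \<cdot> q)"
      by (rule Arr.IH)
  qed
next
  case (Star \<sigma>)
  show ?case
    unfolding incl.simps
  proof (intro allI impI)
    fix s \<Gamma>' w assume "\<Gamma> \<leadsto>\<^bsub>s\<^esub> \<Gamma>'" and elem: "\<Gamma>' \<turnstile> In \<sigma> w (sub_tm s x)"
    then have "\<Gamma>' \<turnstile> Eq (Star \<sigma>) (sub_tm s x) (sub_tm s y)"
      using entails_access[OF Star.prems, of s \<Gamma>'] by simp
    then show "\<Gamma>' \<turnstile> In \<sigma> w (sub_tm s y)"
      using elem by (rule entails_In_Eq)
  qed
qed simp

lemma incl_provable_Eq: "[] \<turnstile> Eq \<tau> y x \<Longrightarrow> wfs \<Gamma> \<Longrightarrow> incl \<tau> \<Gamma> x y"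
  by (rule incl_Eq[OF entails_Eq_sym[OF entails_provable]]) (simp_all add: entails_Nil)

lemma incl_App:
  assumes "incl (\<rho> \<rightarrow>\<^sub>t \<tau>) \<Gamma> x y" "typed q \<rho>" "wfs \<Gamma>"
  shows "incl \<tau> \<Gamma> (x \<cdot> q) (y \<cdot> q)"
proof -
  have "\<Gamma> \<leadsto>\<^bsub>Var\<^esub> \<Gamma>"
    using assms(3) by (simp add: access_Var)
  with assms(1,2) have "incl \<tau> \<Gamma> (sub_tm Var x \<cdot> q) (sub_tm Var y \<cdot> q)"
    unfolding incl.simps by blast
  then show ?thesis by simp
qed

lemma incl_apps: "incl (arrs \<rho>s \<tau>) \<Gamma> x y \<Longrightarrow> typeds qs \<rho>s \<Longrightarrow> wfs \<Gamma> \<Longrightarrow> incl \<tau> \<Gamma> (apps x qs) (apps y qs)"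
proof (induction \<rho>s arbitrary: x y qs)
  case (Cons \<rho> \<rho>s)
  then show ?case
    by (auto simp: list_all2_Cons2 simp del: incl.simps dest: incl_App)
qed simp

lemma entails_In_incl:
  assumes "incl (Star \<sigma>) \<Gamma> x y" "\<Gamma> \<turnstile> In \<sigma> w x"
  shows "\<Gamma> \<turnstile> In \<sigma> w y"
proof -
  have "\<Gamma> \<leadsto>\<^bsub>Var\<^esub> \<Gamma>"
    using entails_wf[OF assms(2)] by (simp add: access_Var)
  moreover have "\<Gamma> \<turnstile> In \<sigma> w (sub_tm Var x)"
    using assms(2) by simp
  ultimately have "\<Gamma> \<turnstile> In \<sigma> w (sub_tm Var y)"
    using assms(1) unfolding incl.simps by blast
  then show ?thesis by simp
qed

fun incls :: "ty list \<Rightarrow> ('f, 'r) fm list \<Rightarrow> 'f tm list \<Rightarrow> 'f tm list \<Rightarrow> bool" where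
  "incls [] \<Gamma> [] [] \<longleftrightarrow> True"
| "incls (\<tau> # \<tau>s) \<Gamma> (x # xs) (y # ys) \<longleftrightarrow>
     typed x \<tau> \<and> typed y \<tau> \<and> incl \<tau> \<Gamma> x y \<and> incls \<tau>s \<Gamma> xs ys"
| "incls _ _ _ _ \<longleftrightarrow> False"

lemma incls_typeds: "incls \<tau>s \<Gamma> xs ys \<Longrightarrow> typeds xs \<tau>s \<and> typeds ys \<tau>s"
  by (induction \<tau>s \<Gamma> xs ys rule: incls.induct) auto

lemma incls_Cons_iff:
  "incls (\<tau> # \<tau>s) \<Gamma> xs ys \<longleftrightarrow>
     (\<exists>x xs' y ys'. xs = x # xs' \<and> ys = y # ys' \<and> typed x \<tau> \<and> typed y \<tau> \<and> incl \<tau> \<Gamma> x y \<and>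
        incls \<tau>s \<Gamma> xs' ys')"
  by (cases xs; cases ys) auto

lemma incls_access:
  "incls \<tau>s \<Gamma> xs ys \<Longrightarrow> \<Gamma> \<leadsto>\<^bsub>s\<^esub> \<Gamma>' \<Longrightarrow> incls \<tau>s \<Gamma>' (map (sub_tm s) xs) (map (sub_tm s) ys)"
  by (induction \<tau>s \<Gamma> xs ys rule: incls.induct) (auto intro: incl_access typed_access)

lemma incls_access_Var: "incls \<tau>s \<Gamma> xs ys \<Longrightarrow> \<Gamma> \<leadsto>\<^bsub>Var\<^esub> \<Gamma>' \<Longrightarrow> incls \<tau>s \<Gamma>' xs ys"
  using incls_access[of \<tau>s \<Gamma> xs ys Var] by simp

lemma incls_access_shift_sub:
  "incls \<tau>s \<Gamma> xs ys \<Longrightarrow> \<Gamma> \<leadsto>\<^bsub>shift_sub \<rho>\<^esub> \<Gamma>' \<Longrightarrow>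
   incls \<tau>s \<Gamma>' (map (lift_tm \<rho>) xs) (map (lift_tm \<rho>) ys)"
  by (simp add: incls_access ren_tm_eq_sub_tm[abs_def])

lemma incls_apps:
  "incls (map (arrs \<rho>s) \<tau>s) \<Gamma> xs ys \<Longrightarrow> typeds qs \<rho>s \<Longrightarrow> wfs \<Gamma> \<Longrightarrow>
   incls \<tau>s \<Gamma> (map (\<lambda>x. apps x qs) xs) (map (\<lambda>y. apps y qs) ys)"
proof (induction \<tau>s arbitrary: xs ys)
  case Nil
  then show ?case by (cases xs; cases ys) auto
next
  case (Cons \<tau> \<tau>s)
  then show ?case by (auto simp: incls_Cons_iff intro: incl_apps has_type_apps)
qed

lemma incls_append:
  "incls (\<rho>s @ \<tau>s) \<Gamma> xs ys \<Longrightarrow>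
   incls \<rho>s \<Gamma> (take (length \<rho>s) xs) (take (length \<rho>s) ys) \<and>
   incls \<tau>s \<Gamma> (drop (length \<rho>s) xs) (drop (length \<rho>s) ys)"
  by (induction \<rho>s arbitrary: xs ys) (auto simp: incls_Cons_iff)


subsection \<open>Monotonicity of the matrix\<close>

definition hr_monotone :: "('f, 'r) fm \<Rightarrow> bool" where
  "hr_monotone A \<longleftrightarrow>
     (\<forall>\<Gamma> xs ys. incls (hr_types A) \<Gamma> xs ys \<longrightarrow> \<Gamma> \<turnstile> hr_matrix A xs \<longrightarrow> \<Gamma> \<turnstile> hr_matrix A ys)"

lemma hr_monotoneD:
  "hr_monotone A \<Longrightarrow> incls (hr_types A) \<Gamma> xs ys \<Longrightarrow> \<Gamma> \<turnstile> hr_matrix A xs \<Longrightarrow> \<Gamma> \<turnstile> hr_matrix A ys"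
  by (simp add: hr_monotone_def)

lemma hr_monotone_Or:
  assumes "hr_monotone A" "hr_monotone B" "wf_fm L (Or A B)"
  shows "hr_monotone (Or A B)"
  unfolding hr_monotone_def
proof (intro allI impI)
  fix \<Gamma> xs ys assume incls: "incls (hr_types (Or A B)) \<Gamma> xs ys" and "\<Gamma> \<turnstile> hr_matrix (Or A B) xs"
  moreover have "wf_fm L (hr_matrix (Or A B) ys)"
    using assms(3) incls_typeds[OF incls] by (blast intro: wf_fm_hr_matrix)
  ultimately show "\<Gamma> \<turnstile> hr_matrix (Or A B) ys"
    using assms(1,2) incls_append[of "hr_types A" "hr_types B" \<Gamma> xs ys]
    by (auto elim!: entails_Or_mono intro: hr_monotoneD incls_access_Var)
qed

lemma hr_monotone_And:
  assumes "hr_monotone A" "hr_monotone B"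
  shows "hr_monotone (And A B)"
  unfolding hr_monotone_def
proof (intro allI impI)
  fix \<Gamma> xs ys assume "incls (hr_types (And A B)) \<Gamma> xs ys" "\<Gamma> \<turnstile> hr_matrix (And A B) xs"
  then show "\<Gamma> \<turnstile> hr_matrix (And A B) ys"
    using assms incls_append[of "hr_types A" "hr_types B" \<Gamma> xs ys]
    by (auto intro!: entails_AndI intro: hr_monotoneD dest: entails_AndE1 entails_AndE2)
qed

text \<open>The block variables serve as a generic realizer of the premise \<open>A\<close> of an implication.\<close>

definition generic :: "('f, 'r) fm \<Rightarrow> ('f, 'r) fm list \<Rightarrow> ('f, 'r) fm list" where
  "generic A \<Gamma> = hr_matrix (lifts_fm (hr_types A) A) (block_vars (hr_types A)) #
     map (lifts_fm (hr_types A)) \<Gamma>"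

lemma entails_hr_matrix_ImpI:
  "generic A \<Gamma> \<turnstile> hr_matrix (lifts_fm (hr_types A) B) (map (apply_block (hr_types A)) us) \<Longrightarrow>
   \<Gamma> \<turnstile> hr_matrix (Imp A B) us"
  by (auto simp: generic_def Let_def entails_Cons intro!: entails_AllsI)

lemma entails_hr_matrix_ImpE:
  assumes "\<Gamma> \<turnstile> hr_matrix (Imp A B) us" "length us = length (hr_types B)"
    and "typeds xs (hr_types A)" "\<Gamma> \<turnstile> hr_matrix A xs"
  shows "\<Gamma> \<turnstile> hr_matrix B (map (\<lambda>u. apps u xs) us)"
proof -
  let ?\<rho>s = "hr_types A"
  let ?body = "Imp (hr_matrix (lifts_fm ?\<rho>s A) (block_vars ?\<rho>s))
    (hr_matrix (lifts_fm ?\<rho>s B) (map (apply_block ?\<rho>s) us))"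
  have len: "length xs = length ?\<rho>s"
    using assms(3) by (rule list_all2_lengthD)
  have "\<Gamma> \<turnstile> sub_fm Var (Alls ?\<rho>s ?body)"
    using assms(1) by (simp add: Let_def)
  then have "\<Gamma> \<turnstile> sub_fm (sub_conss ?\<rho>s xs Var) ?body"
    using assms(3) by (rule entails_AllsE)
  then have "\<Gamma> \<turnstile> Imp (hr_matrix A xs) (hr_matrix B (map (\<lambda>u. apps u xs) us))"
    using len assms(2)
    by (simp add: sub_fm_hr_matrix sub_fm_sub_conss_lifts_fm map_sub_conss_block_vars
        sub_tm_sub_conss_lifts_tm o_def)
  then show ?thesis
    using assms(4) by (rule entails_MP)
qed

lemma access_generic: "wf_fm L A \<Longrightarrow> wfs \<Gamma> \<Longrightarrow> \<Gamma> \<leadsto>\<^bsub>lifts_sub (hr_types A)\<^esub> generic A \<Gamma>"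
  by (auto simp: access_lifts_sub generic_def wf_fm_lifts_fm has_type_block_vars
      intro!: wf_fm_hr_matrix)

lemma entails_generic:
  assumes "wf_fm L A" "wfs \<Gamma>"
  shows "generic A \<Gamma> \<turnstile> hr_matrix (lifts_fm (hr_types A) A) (block_vars (hr_types A))"
  using access_wfs[OF access_generic[OF assms]] by (intro entails_assm) (auto simp: generic_def)

lemma hr_monotone_Imp:
  assumes "hr_monotone (lifts_fm (hr_types A) B)" "wf_fm L A"
  shows "hr_monotone (Imp A B)"
  unfolding hr_monotone_def
proof (intro allI impI)
  let ?\<rho>s = "hr_types A"
  fix \<Gamma> xs ys assume incls: "incls (hr_types (Imp A B)) \<Gamma> xs ys"
    and imp: "\<Gamma> \<turnstile> hr_matrix (Imp A B) xs"
  have len: "length xs = length (hr_types B)"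
    using incls_typeds[OF incls] by (auto dest: list_all2_lengthD)
  have wfs: "wfs \<Gamma>"
    using entails_wf[OF imp] by blast
  note access = access_generic[OF assms(2) wfs]
  have "generic A \<Gamma> \<turnstile> hr_matrix (Imp (lifts_fm ?\<rho>s A) (lifts_fm ?\<rho>s B)) (map (lifts_tm ?\<rho>s) xs)"
    using entails_access[OF imp access] sub_fm_hr_matrix[of xs "Imp A B" "lifts_sub ?\<rho>s"] len
    by (simp add: lifts_fm_eq_sub_fm lifts_tm_eq_sub_tm del: hr_matrix.simps)
  from entails_hr_matrix_ImpE[OF this _ _ entails_generic]
  have "generic A \<Gamma> \<turnstile>
      hr_matrix (lifts_fm ?\<rho>s B) (map (\<lambda>u. apps u (block_vars ?\<rho>s)) (map (lifts_tm ?\<rho>s) xs))"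
    using assms(2) wfs len by (simp add: has_type_block_vars del: map_map)
  moreover have "incls (map (arrs ?\<rho>s) (hr_types B)) (generic A \<Gamma>)
      (map (lifts_tm ?\<rho>s) xs) (map (lifts_tm ?\<rho>s) ys)"
    using incls_access[OF incls access] by (simp add: lifts_tm_eq_sub_tm)
  then have "incls (hr_types (lifts_fm ?\<rho>s B)) (generic A \<Gamma>)
      (map (\<lambda>u. apps u (block_vars ?\<rho>s)) (map (lifts_tm ?\<rho>s) xs))
      (map (\<lambda>u. apps u (block_vars ?\<rho>s)) (map (lifts_tm ?\<rho>s) ys))"
    unfolding hr_types_lifts_fm using has_type_block_vars access_wfs[OF access] by (rule incls_apps)
  ultimately have "generic A \<Gamma> \<turnstile>
      hr_matrix (lifts_fm ?\<rho>s B) (map (\<lambda>u. apps u (block_vars ?\<rho>s)) (map (lifts_tm ?\<rho>s) ys))"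
    using assms(1) by (blast intro: hr_monotoneD)
  then show "\<Gamma> \<turnstile> hr_matrix (Imp A B) ys"
    by (intro entails_hr_matrix_ImpI) (simp add: o_def)
qed

lemma arrs_singleton: "arrs [\<rho>] = Arr \<rho>"
  by (rule ext) simp

lemma hr_monotone_All:
  assumes "hr_monotone A"
  shows "hr_monotone (All \<rho> A)"
  unfolding hr_monotone_def
proof (intro allI impI)
  fix \<Gamma> xs ys assume incls: "incls (hr_types (All \<rho> A)) \<Gamma> xs ys"
    and all: "\<Gamma> \<turnstile> hr_matrix (All \<rho> A) xs"
  have "incls (hr_types A) \<Gamma>'
      (map (\<lambda>x. lift_tm \<rho> x \<cdot> Var \<rho> 0) xs) (map (\<lambda>y. lift_tm \<rho> y \<cdot> Var \<rho> 0) ys)"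
    if "\<Gamma> \<leadsto>\<^bsub>shift_sub \<rho>\<^esub> \<Gamma>'" for \<Gamma>'
  proof -
    have "incls (map (arrs [\<rho>]) (hr_types A)) \<Gamma>' (map (lift_tm \<rho>) xs) (map (lift_tm \<rho>) ys)"
      using incls_access_shift_sub[OF incls that] by (simp add: arrs_singleton)
    from incls_apps[OF this, of "[Var \<rho> 0]"] access_wfs[OF that] show ?thesis
      by (simp add: o_def)
  qed
  with all show "\<Gamma> \<turnstile> hr_matrix (All \<rho> A) ys"
    by (auto elim!: entails_All_mono intro: hr_monotoneD[OF assms])
qed

lemma hr_monotone_Ex:
  assumes "hr_monotone A"
  shows "hr_monotone (Ex \<rho> A)"
  unfolding hr_monotone_def
proof (intro allI impI)
  fix \<Gamma> xs ys assume "incls (hr_types (Ex \<rho> A)) \<Gamma> xs ys" "\<Gamma> \<turnstile> hr_matrix (Ex \<rho> A) xs"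
  then obtain X xs' Y ys' where "xs = X # xs'" and ys: "ys = Y # ys'"
    and incl: "incl (Star \<rho>) \<Gamma> X Y" and incls: "incls (hr_types A) \<Gamma> xs' ys'"
    and ex: "\<Gamma> \<turnstile> BEx \<rho> X (hr_matrix A (map (lift_tm \<rho>) xs'))"
    by (auto simp: incls_Cons_iff simp del: incl.simps)
  from ex have "\<Gamma> \<turnstile> BEx \<rho> Y (hr_matrix A (map (lift_tm \<rho>) ys'))"
  proof (rule entails_BEx_mono)
    fix \<Gamma>' assume access: "\<Gamma> \<leadsto>\<^bsub>shift_sub \<rho>\<^esub> \<Gamma>'"
    show "\<Gamma>' \<turnstile> in_bound \<rho> Y" if "\<Gamma>' \<turnstile> in_bound \<rho> X"
      using entails_In_incl[OF incl_access[OF incl access]] that by (simp add: ren_tm_eq_sub_tm)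
    show "\<Gamma>' \<turnstile> hr_matrix A (map (lift_tm \<rho>) ys')" if "\<Gamma>' \<turnstile> hr_matrix A (map (lift_tm \<rho>) xs')"
      using assms incls_access_shift_sub[OF incls access] that by (rule hr_monotoneD)
  qed
  then show "\<Gamma> \<turnstile> hr_matrix (Ex \<rho> A) ys"
    by (simp add: ys)
qed

lemma hr_monotone_BAll:
  assumes "hr_monotone A"
  shows "hr_monotone (BAll \<rho> t A)"
  using assms unfolding hr_monotone_def
  by (auto elim!: entails_BAll_mono intro: incls_access_shift_sub)

lemma hr_monotone_BEx:
  assumes "hr_monotone A"
  shows "hr_monotone (BEx \<rho> t A)"
  using assms unfolding hr_monotone_def
  by (auto elim!: entails_BEx_mono intro: incls_access_shift_sub)

lemma wf_fm_hr_monotone: "wf_fm L A \<Longrightarrow> hr_monotone A"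
proof (induction "height A" arbitrary: A rule: less_induct)
  case less
  then show ?case
    by (cases A) (auto simp: hr_monotone_def[of Bot] hr_monotone_def[of "Eq _ _ _"]
        hr_monotone_def[of "In _ _ _"] hr_monotone_def[of "Rel _ _"] wf_fm_lifts_fm
        intro!: hr_monotone_Or hr_monotone_And hr_monotone_Imp hr_monotone_All hr_monotone_Ex
          hr_monotone_BAll hr_monotone_BEx)
qed

lemma ex_larger_realizers:
  assumes "wf_fm L A" "typeds xs (hr_types A)" "\<Gamma> \<turnstile> hr_matrix A xs"
    and larger: "\<And>x \<tau>. x \<in> set xs \<Longrightarrow> typed x \<tau> \<Longrightarrow> \<exists>u. P u \<tau> \<and> typed (f u) \<tau> \<and> incl \<tau> \<Gamma> x (f u)"
  obtains us where "list_all2 P us (hr_types A)" "\<Gamma> \<turnstile> hr_matrix A (map f us)"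
proof -
  have "\<exists>us. list_all2 P us \<tau>s \<and> incls \<tau>s \<Gamma> xs (map f us)" if "typeds xs \<tau>s" for \<tau>s
    using that larger
  proof (induction rule: list_all2_induct)
    case (Cons x xs \<tau> \<tau>s)
    then obtain us where "list_all2 P us \<tau>s" "incls \<tau>s \<Gamma> xs (map f us)"
      by auto
    moreover obtain u where "P u \<tau>" "typed (f u) \<tau>" "incl \<tau> \<Gamma> x (f u)"
      using Cons.prems[of x \<tau>] Cons.hyps(1) by auto
    ultimately show ?case
      using Cons.hyps(1) by (intro exI[of _ "u # us"]) simp
  qed simp
  from this[OF assms(2)] obtain us
    where "list_all2 P us (hr_types A)" "incls (hr_types A) \<Gamma> xs (map f us)" by blast
  with hr_monotoneD[OF wf_fm_hr_monotone[OF assms(1)]] assms(3) that show thesis by blast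
qed

end

section \<open>Joins of realizers\<close>

locale inhabited_theory = il_theory L T
  for L :: "('f, 'r) language" and T :: "('f, 'r) fm set" +
  assumes ex_individual_constant: "\<exists>c\<in>funs L. fun_arity L c = 0"
begin

lemma ex_closed_term: "\<exists>t. fv_tm t = {} \<and> typed t \<tau>"
proof (induction \<tau>)
  case G
  from ex_individual_constant obtain c where "c \<in> funs L" "fun_arity L c = 0" by blast
  then show ?case
    by (intro exI[of _ "Con (CFun c)"]) simp
next
  case (Arr \<sigma> \<tau>)
  then obtain t where "fv_tm t = {}" "typed t \<tau>" by blast
  then show ?case
    by (intro exI[of _ "Con (CPi \<tau> \<sigma>) \<cdot> t"]) (simp add: has_type_App_iff)
next
  case (Star \<sigma>)
  then obtain t where "fv_tm t = {}" "typed t \<sigma>" by blast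
  then show ?case
    by (intro exI[of _ "Con (CSing \<sigma>) \<cdot> t"]) (simp add: has_type_App_iff)
qed

lemma ex_typeds: "\<exists>ts. typeds ts \<tau>s"
proof (induction \<tau>s)
  case (Cons \<tau> \<tau>s)
  then obtain ts where "typeds ts \<tau>s" by blast
  moreover obtain t where "typed t \<tau>" using ex_closed_term by blast
  ultimately have "typeds (t # ts) (\<tau> # \<tau>s)" by simp
  then show ?case by blast
qed simp

definition join_op :: "ty \<Rightarrow> 'f tm \<Rightarrow> bool" where
  "join_op \<tau> U \<longleftrightarrow> fv_tm U = {} \<and> typed U (\<tau> \<rightarrow>\<^sub>t \<tau> \<rightarrow>\<^sub>t \<tau>) \<and>
     (\<forall>\<Gamma> x y. wfs \<Gamma> \<longrightarrow> typed x \<tau> \<longrightarrow> typed y \<tau> \<longrightarrow>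
       incl \<tau> \<Gamma> x (U \<cdot> x \<cdot> y) \<and> incl \<tau> \<Gamma> y (U \<cdot> x \<cdot> y))"

lemma join_op_upper:
  assumes "join_op \<tau> U" "wfs \<Gamma>" "typed x \<tau>" "typed y \<tau>"
  shows "incl \<tau> \<Gamma> x (U \<cdot> x \<cdot> y)" "incl \<tau> \<Gamma> y (U \<cdot> x \<cdot> y)"
  using assms by (auto simp: join_op_def)

lemma join_op_CUn: "join_op (Star \<sigma>) (Con (CUn \<sigma>))"
proof -
  have "\<Gamma>' \<turnstile> In \<sigma> w (Con (CUn \<sigma>) \<cdot> sub_tm s x \<cdot> sub_tm s y)"
    if "\<Gamma> \<leadsto>\<^bsub>s\<^esub> \<Gamma>'" "typed x (Star \<sigma>)" "typed y (Star \<sigma>)"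
      "\<Gamma>' \<turnstile> In \<sigma> w (sub_tm s x) \<or> \<Gamma>' \<turnstile> In \<sigma> w (sub_tm s y)" for \<Gamma> \<Gamma>' s w x y
  proof -
    have "typed (sub_tm s x) (Star \<sigma>)" "typed (sub_tm s y) (Star \<sigma>)" "typed w \<sigma>" "wfs \<Gamma>'"
      using that by (auto intro: typed_access dest: entails_wf)
    moreover from this that(4) have "\<Gamma>' \<turnstile> Or (In \<sigma> w (sub_tm s x)) (In \<sigma> w (sub_tm s y))"
      by (auto intro: entails_OrI1 entails_OrI2)
    ultimately show ?thesis
      by (simp add: entails_In_Un_iff)
  qed
  then show ?thesis
    by (auto simp: join_op_def)
qed

text \<open>At a function type, \<open>V x y q = U (x q) (y q)\<close>.\<close>

lemma ex_join_op_Arr: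
  assumes "join_op \<tau> U"
  shows "\<exists>V. join_op (\<rho> \<rightarrow>\<^sub>t \<tau>) V"
proof -
  let ?\<tau> = "\<rho> \<rightarrow>\<^sub>t \<tau>"
  let ?t = "U \<cdot> (Var ?\<tau> 0 \<cdot> Var \<rho> 2) \<cdot> (Var ?\<tau> 1 \<cdot> Var \<rho> 2)"
  have U: "fv_tm U = {}" "typed U (\<tau> \<rightarrow>\<^sub>t \<tau> \<rightarrow>\<^sub>t \<tau>)"
    using assms by (auto simp: join_op_def)
  have t: "typed ?t \<tau>"
    using U(2) by (auto intro!: has_type.App)
  obtain V where V: "fv_tm V = {}" "typed V (arrs [?\<tau>, ?\<tau>, \<rho>] \<tau>)"
    and V_eq: "\<And>\<Gamma> qs. wfs \<Gamma> \<Longrightarrow> typeds qs [?\<tau>, ?\<tau>, \<rho>] \<Longrightarrow>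
      \<Gamma> \<turnstile> Eq \<tau> (apps V qs) (sub_tm (assign [?\<tau>, ?\<tau>, \<rho>] qs) ?t)"
    by (rule combinatory_completeness[OF t, of "[?\<tau>, ?\<tau>, \<rho>]"]) (use U(1) in auto)
  have eq: "incl \<tau> \<Gamma> (U \<cdot> (x \<cdot> q) \<cdot> (y \<cdot> q)) (V \<cdot> x \<cdot> y \<cdot> q)"
    if "wfs \<Gamma>" "typed x ?\<tau>" "typed y ?\<tau>" "typed q \<rho>" for \<Gamma> x y q
    using V_eq[of \<Gamma> "[x, y, q]"] that
    by (auto simp: assign_def sub_tm_closed[OF U(1)] intro: incl_Eq entails_Eq_sym)
  have "incl \<tau> \<Gamma> (x \<cdot> q) (V \<cdot> x \<cdot> y \<cdot> q) \<and> incl \<tau> \<Gamma> (y \<cdot> q) (V \<cdot> x \<cdot> y \<cdot> q)"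
    if "wfs \<Gamma>" "typed x ?\<tau>" "typed y ?\<tau>" "typed q \<rho>" for \<Gamma> x y q
    using join_op_upper[OF assms that(1) has_type.App[OF that(2,4)] has_type.App[OF that(3,4)]]
      eq[OF that] by (blast intro: incl_trans)
  then have "incl ?\<tau> \<Gamma> x (V \<cdot> x \<cdot> y) \<and> incl ?\<tau> \<Gamma> y (V \<cdot> x \<cdot> y)"
    if "typed x ?\<tau>" "typed y ?\<tau>" for \<Gamma> x y
    using that by (simp add: sub_tm_closed[OF V(1)] typed_access access_wfs)
  with V show ?thesis
    by (intro exI[of _ V]) (auto simp: join_op_def)
qed

lemma ex_join_op: "\<exists>U. join_op \<tau> U"
proof (induction \<tau>)
  case G
  then show ?case
    using ex_closed_term by (auto simp: join_op_def)
qed (use join_op_CUn ex_join_op_Arr in blast)+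

lemma ex_common_incls:
  assumes "wfs \<Gamma>" "wfs \<Delta>"
  shows "typeds xs \<tau>s \<Longrightarrow> typeds ys \<tau>s \<Longrightarrow> \<exists>zs. incls \<tau>s \<Gamma> xs zs \<and> incls \<tau>s \<Delta> ys zs"
proof (induction \<tau>s arbitrary: xs ys)
  case (Cons \<tau> \<tau>s)
  then obtain x xs' y ys' where xs: "xs = x # xs'" "typed x \<tau>" "typeds xs' \<tau>s"
    and ys: "ys = y # ys'" "typed y \<tau>" "typeds ys' \<tau>s"
    by (auto simp: list_all2_Cons2)
  obtain zs where zs: "incls \<tau>s \<Gamma> xs' zs" "incls \<tau>s \<Delta> ys' zs"
    using Cons.IH[OF xs(3) ys(3)] by blast
  obtain U where U: "join_op \<tau> U" using ex_join_op by blast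
  then have "typed (U \<cdot> x \<cdot> y) \<tau>"
    using xs(2) ys(2) by (auto simp: join_op_def intro: has_type.App)
  moreover have "incl \<tau> \<Gamma> x (U \<cdot> x \<cdot> y)" "incl \<tau> \<Delta> y (U \<cdot> x \<cdot> y)"
    using join_op_upper[OF U] xs(2) ys(2) assms by blast+
  ultimately show ?case
    using zs xs ys
    by (intro exI[of _ "U \<cdot> x \<cdot> y # zs"]) simp
qed (auto intro: exI[of _ "[]"])

definition big_join_op :: "ty \<Rightarrow> ty \<Rightarrow> 'f tm \<Rightarrow> bool" where
  "big_join_op \<rho> \<tau> B \<longleftrightarrow> fv_tm B = {} \<and> typed B (Star \<rho> \<rightarrow>\<^sub>t (\<rho> \<rightarrow>\<^sub>t \<tau>) \<rightarrow>\<^sub>t \<tau>) \<and>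
     (\<forall>\<Gamma> t u z. typed u (\<rho> \<rightarrow>\<^sub>t \<tau>) \<longrightarrow> \<Gamma> \<turnstile> In \<rho> z t \<longrightarrow> incl \<tau> \<Gamma> (u \<cdot> z) (B \<cdot> t \<cdot> u))"

lemma big_join_op_upper:
  "big_join_op \<rho> \<tau> B \<Longrightarrow> typed u (\<rho> \<rightarrow>\<^sub>t \<tau>) \<Longrightarrow> \<Gamma> \<turnstile> In \<rho> z t \<Longrightarrow> incl \<tau> \<Gamma> (u \<cdot> z) (B \<cdot> t \<cdot> u)"
  by (simp add: big_join_op_def)

lemma big_join_op_CBigUn: "big_join_op \<rho> (Star \<sigma>) (Con (CBigUn \<rho> \<sigma>))"
proof -
  have "\<Gamma>' \<turnstile> In \<sigma> w (Con (CBigUn \<rho> \<sigma>) \<cdot> sub_tm s t \<cdot> sub_tm s u)"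
    if "\<Gamma> \<leadsto>\<^bsub>s\<^esub> \<Gamma>'" "typed u (\<rho> \<rightarrow>\<^sub>t Star \<sigma>)" "\<Gamma> \<turnstile> In \<rho> z t" "\<Gamma>' \<turnstile> In \<sigma> w (sub_tm s u \<cdot> sub_tm s z)"
    for \<Gamma> \<Gamma>' s t u w z
    using entails_access[OF that(3,1)] typed_access[OF that(2,1)] that(4)
    by (auto intro: entails_In_BigUn)
  then show ?thesis
    by (auto simp: big_join_op_def)
qed

lemma ex_flip_combinator:
  obtains C where "fv_tm C = {}" "typed C ((\<rho> \<rightarrow>\<^sub>t \<sigma> \<rightarrow>\<^sub>t \<tau>) \<rightarrow>\<^sub>t \<sigma> \<rightarrow>\<^sub>t \<rho> \<rightarrow>\<^sub>t \<tau>)"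
    "\<And>\<Gamma> u y x. wfs \<Gamma> \<Longrightarrow> typed u (\<rho> \<rightarrow>\<^sub>t \<sigma> \<rightarrow>\<^sub>t \<tau>) \<Longrightarrow> typed y \<sigma> \<Longrightarrow> typed x \<rho> \<Longrightarrow>
      \<Gamma> \<turnstile> Eq \<tau> (C \<cdot> u \<cdot> y \<cdot> x) (u \<cdot> x \<cdot> y)"
proof -
  let ?\<tau>s = "[\<rho> \<rightarrow>\<^sub>t \<sigma> \<rightarrow>\<^sub>t \<tau>, \<sigma>, \<rho>]"
  let ?t = "Var (\<rho> \<rightarrow>\<^sub>t \<sigma> \<rightarrow>\<^sub>t \<tau>) 0 \<cdot> Var \<rho> 2 \<cdot> Var \<sigma> 1"
  have "typed ?t \<tau>"
    by (auto intro!: has_type.App)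
  then obtain C where C: "fv_tm C = {}" "typed C (arrs ?\<tau>s \<tau>)"
    and C_eq: "\<And>\<Gamma> qs. wfs \<Gamma> \<Longrightarrow> typeds qs ?\<tau>s \<Longrightarrow> \<Gamma> \<turnstile> Eq \<tau> (apps C qs) (sub_tm (assign ?\<tau>s qs) ?t)"
    by (rule combinatory_completeness[of _ _ ?\<tau>s]) auto
  have "\<Gamma> \<turnstile> Eq \<tau> (C \<cdot> u \<cdot> y \<cdot> x) (u \<cdot> x \<cdot> y)"
    if "wfs \<Gamma>" "typed u (\<rho> \<rightarrow>\<^sub>t \<sigma> \<rightarrow>\<^sub>t \<tau>)" "typed y \<sigma>" "typed x \<rho>" for \<Gamma> u y x
    using C_eq[of \<Gamma> "[u, y, x]"] that by (simp add: assign_def)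
  with C show thesis
    by (intro that) simp_all
qed

text \<open>At a function type, \<open>D t u q = B t (C u q)\<close> where \<open>C u q = (\<lambda>z. u z q)\<close>.\<close>

lemma ex_big_join_op_Arr:
  assumes "big_join_op \<rho> \<tau> B"
  shows "\<exists>D. big_join_op \<rho> (\<sigma> \<rightarrow>\<^sub>t \<tau>) D"
proof -
  let ?\<tau> = "\<rho> \<rightarrow>\<^sub>t \<sigma> \<rightarrow>\<^sub>t \<tau>" and ?\<tau>s = "[Star \<rho>, \<rho> \<rightarrow>\<^sub>t \<sigma> \<rightarrow>\<^sub>t \<tau>, \<sigma>]"
  have B: "fv_tm B = {}" "typed B (Star \<rho> \<rightarrow>\<^sub>t (\<rho> \<rightarrow>\<^sub>t \<tau>) \<rightarrow>\<^sub>t \<tau>)"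
    using assms by (auto simp: big_join_op_def)
  obtain C where C: "fv_tm C = {}" "typed C (?\<tau> \<rightarrow>\<^sub>t \<sigma> \<rightarrow>\<^sub>t \<rho> \<rightarrow>\<^sub>t \<tau>)"
    and C_eq: "\<And>\<Gamma> u q z. wfs \<Gamma> \<Longrightarrow> typed u ?\<tau> \<Longrightarrow> typed q \<sigma> \<Longrightarrow> typed z \<rho> \<Longrightarrow>
      \<Gamma> \<turnstile> Eq \<tau> (C \<cdot> u \<cdot> q \<cdot> z) (u \<cdot> z \<cdot> q)"
    using ex_flip_combinator[of \<rho> \<sigma> \<tau>] by blast
  note C_typed = has_type.App[OF has_type.App[OF C(2)]]
  let ?t = "B \<cdot> Var (Star \<rho>) 0 \<cdot> (C \<cdot> Var ?\<tau> 1 \<cdot> Var \<sigma> 2)"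
  have t: "typed ?t \<tau>"
    using has_type.App[OF has_type.App[OF B(2)] C_typed] by simp
  obtain D where D: "fv_tm D = {}" "typed D (arrs ?\<tau>s \<tau>)"
    and D_eq: "\<And>\<Gamma> qs. wfs \<Gamma> \<Longrightarrow> typeds qs ?\<tau>s \<Longrightarrow> \<Gamma> \<turnstile> Eq \<tau> (apps D qs) (sub_tm (assign ?\<tau>s qs) ?t)"
    by (rule combinatory_completeness[OF t, of ?\<tau>s]) (use B(1) C(1) in auto)
  have "incl \<tau> \<Gamma> (u \<cdot> z \<cdot> q) (D \<cdot> t \<cdot> u \<cdot> q)"
    if u: "typed u ?\<tau>" and z: "\<Gamma> \<turnstile> In \<rho> z t" and q: "typed q \<sigma>" for \<Gamma> t u z q
  proof -
    have wf: "wfs \<Gamma>" "typed z \<rho>" "typed t (Star \<rho>)"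
      using entails_wf[OF z] by auto
    have "incl \<tau> \<Gamma> (u \<cdot> z \<cdot> q) (C \<cdot> u \<cdot> q \<cdot> z)"
      using C_eq[OF wf(1) u q wf(2)] by (blast intro: incl_Eq entails_Eq_sym)
    moreover have "incl \<tau> \<Gamma> (C \<cdot> u \<cdot> q \<cdot> z) (B \<cdot> t \<cdot> (C \<cdot> u \<cdot> q))"
      using assms C_typed[OF u q] z by (rule big_join_op_upper)
    moreover have "incl \<tau> \<Gamma> (B \<cdot> t \<cdot> (C \<cdot> u \<cdot> q)) (D \<cdot> t \<cdot> u \<cdot> q)"
      using D_eq[of \<Gamma> "[t, u, q]"] u q wf
      by (auto simp: assign_def sub_tm_closed[OF B(1)] sub_tm_closed[OF C(1)]
          intro: incl_Eq entails_Eq_sym)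
    ultimately show ?thesis
      by (blast intro: incl_trans)
  qed
  then have "incl (\<sigma> \<rightarrow>\<^sub>t \<tau>) \<Gamma> (u \<cdot> z) (D \<cdot> t \<cdot> u)" if "typed u ?\<tau>" "\<Gamma> \<turnstile> In \<rho> z t" for \<Gamma> t u z
    using that(1) typed_access entails_access[OF that(2)]
    by (auto simp: sub_tm_closed[OF D(1)])
  with D show ?thesis
    by (intro exI[of _ D]) (auto simp: big_join_op_def)
qed

lemma ex_big_join_op: "\<exists>B. big_join_op \<rho> \<tau> B"
proof (induction \<tau>)
  case G
  then show ?case
    using ex_closed_term by (auto simp: big_join_op_def)
qed (use big_join_op_CBigUn ex_big_join_op_Arr in blast)+

lemma ex_bounding_term:
  assumes "typed x \<tau>" "typed Z (Star \<rho>)" "\<Gamma> \<turnstile> in_bound \<rho> Z"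
  shows "\<exists>d. typed d \<tau> \<and> incl \<tau> \<Gamma> x (lift_tm \<rho> d)"
proof -
  obtain B where B: "big_join_op \<rho> \<tau> B" using ex_big_join_op by blast
  then have closed: "fv_tm B = {}" by (simp add: big_join_op_def)
  obtain u where u: "typed u (\<rho> \<rightarrow>\<^sub>t \<tau>)" "[] \<turnstile> Eq \<tau> (lift_tm \<rho> u \<cdot> Var \<rho> 0) x"
    using ex_abstraction_block[OF assms(1), of "[\<rho>]"] by auto
  have "incl \<tau> \<Gamma> x (lift_tm \<rho> u \<cdot> Var \<rho> 0)"
    using u(2) entails_wf[OF assms(3)] by (intro incl_provable_Eq) auto
  moreover have "incl \<tau> \<Gamma> (lift_tm \<rho> u \<cdot> Var \<rho> 0) (B \<cdot> lift_tm \<rho> Z \<cdot> lift_tm \<rho> u)"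
    using B u(1) assms(3) by (simp add: big_join_op_upper)
  ultimately have "incl \<tau> \<Gamma> x (lift_tm \<rho> (B \<cdot> Z \<cdot> u))"
    by (auto simp: ren_tm_eq_sub_tm sub_tm_closed[OF closed] intro: incl_trans)
  moreover have "typed (B \<cdot> Z \<cdot> u) \<tau>"
    using B u(1) assms(2) by (auto simp: big_join_op_def intro: has_type.App)
  ultimately show ?thesis by blast
qed

lemma ex_bounding_realizers:
  assumes "wf_fm L A" "typeds xs (hr_types A)" "\<Gamma> \<turnstile> hr_matrix A xs"
    and "typed Z (Star \<rho>)" "\<Gamma> \<turnstile> in_bound \<rho> Z"
  obtains ds where "typeds ds (hr_types A)" "\<Gamma> \<turnstile> hr_matrix A (map (lift_tm \<rho>) ds)"
  using ex_larger_realizers[OF assms(1-3), of typed "lift_tm \<rho>"] ex_bounding_term[OF _ assms(4,5)]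
  by auto

section \<open>Forcing\<close>

definition forces :: "('f, 'r) fm list \<Rightarrow> ('f, 'r) fm \<Rightarrow> bool" (infix \<open>\<tturnstile>\<close> 50) where
  "\<Gamma> \<tturnstile> A \<longleftrightarrow> wf_fm L A \<and> (\<exists>xs. typeds xs (hr_types A) \<and> \<Gamma> \<turnstile> hr_matrix A xs)"

lemma forcesI: "wf_fm L A \<Longrightarrow> typeds xs (hr_types A) \<Longrightarrow> \<Gamma> \<turnstile> hr_matrix A xs \<Longrightarrow> \<Gamma> \<tturnstile> A"
  by (auto simp: forces_def)

lemma forcesE:
  assumes "\<Gamma> \<tturnstile> A"
  obtains xs where "wf_fm L A" "wfs \<Gamma>" "typeds xs (hr_types A)" "length xs = length (hr_types A)"
    "\<Gamma> \<turnstile> hr_matrix A xs"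
  using assms by (auto simp: forces_def dest: entails_wf list_all2_lengthD)

lemma forces_wf: "\<Gamma> \<tturnstile> A \<Longrightarrow> wfs \<Gamma> \<and> wf_fm L A"
  by (auto elim: forcesE)

lemma forces_ex_free: "ex_free A \<Longrightarrow> \<Gamma> \<tturnstile> A \<longleftrightarrow> \<Gamma> \<turnstile> A"
  by (auto simp: forces_def hr_types_ex_free hr_matrix_ex_free dest: entails_wf)

lemma forces_access:
  assumes "\<Gamma> \<tturnstile> A" "\<Gamma> \<leadsto>\<^bsub>s\<^esub> \<Gamma>'"
  shows "\<Gamma>' \<tturnstile> sub_fm s A"
proof -
  from assms(1) obtain xs where xs: "wf_fm L A" "typeds xs (hr_types A)"
    "length xs = length (hr_types A)" "\<Gamma> \<turnstile> hr_matrix A xs"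
    by (rule forcesE)
  show ?thesis
  proof (rule forcesI)
    show "wf_fm L (sub_fm s A)"
      using xs(1) assms(2) by (auto intro: wf_fm_sub_fm access_typed_sub)
    show "typeds (map (sub_tm s) xs) (hr_types (sub_fm s A))"
      using xs(2) assms(2) by (auto simp: list_all2_conv_all_nth intro: typed_access)
    show "\<Gamma>' \<turnstile> hr_matrix (sub_fm s A) (map (sub_tm s) xs)"
      using entails_access[OF xs(4) assms(2)] xs(3) by (simp add: sub_fm_hr_matrix)
  qed
qed

lemma forces_weaken: "\<Gamma> \<tturnstile> A \<Longrightarrow> set \<Gamma> \<subseteq> set \<Delta> \<Longrightarrow> wfs \<Delta> \<Longrightarrow> \<Delta> \<tturnstile> A"
  using forces_access[of \<Gamma> A Var \<Delta>] by (simp add: access_Var)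

lemma forces_And_iff: "\<Gamma> \<tturnstile> And A B \<longleftrightarrow> \<Gamma> \<tturnstile> A \<and> \<Gamma> \<tturnstile> B"
proof
  assume "\<Gamma> \<tturnstile> And A B"
  then obtain xs ys where "wf_fm L A" "wf_fm L B"
    and "typeds xs (hr_types A)" "typeds ys (hr_types B)"
    and "\<Gamma> \<turnstile> And (hr_matrix A xs) (hr_matrix B ys)"
    by (auto elim!: forcesE simp: list_all2_append2 list_all2_lengthD)
  then show "\<Gamma> \<tturnstile> A \<and> \<Gamma> \<tturnstile> B"
    by (blast intro: forcesI entails_AndE1 entails_AndE2)
next
  assume "\<Gamma> \<tturnstile> A \<and> \<Gamma> \<tturnstile> B"
  then obtain xs ys where "wf_fm L A" "typeds xs (hr_types A)" "\<Gamma> \<turnstile> hr_matrix A xs"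
    and "wf_fm L B" "typeds ys (hr_types B)" "\<Gamma> \<turnstile> hr_matrix B ys"
    by (blast elim: forcesE)
  then show "\<Gamma> \<tturnstile> And A B"
    by (intro forcesI[of _ "xs @ ys"])
      (auto simp: list_all2_lengthD intro: list_all2_appendI entails_AndI)
qed

lemma forces_Or_iff:
  "\<Gamma> \<tturnstile> Or A B \<longleftrightarrow> wf_fm L (Or A B) \<and> (\<exists>xs ys. typeds xs (hr_types A) \<and> typeds ys (hr_types B) \<and>
     \<Gamma> \<turnstile> Or (hr_matrix A xs) (hr_matrix B ys))"
proof
  assume "\<Gamma> \<tturnstile> Or A B"
  then obtain xs ys where "wf_fm L (Or A B)" "typeds xs (hr_types A)" "typeds ys (hr_types B)"
    "\<Gamma> \<turnstile> Or (hr_matrix A xs) (hr_matrix B ys)"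
    by (auto elim!: forcesE simp: list_all2_append2 list_all2_lengthD)
  then show "wf_fm L (Or A B) \<and> (\<exists>xs ys. typeds xs (hr_types A) \<and> typeds ys (hr_types B) \<and>
     \<Gamma> \<turnstile> Or (hr_matrix A xs) (hr_matrix B ys))"
    by blast
next
  assume "wf_fm L (Or A B) \<and> (\<exists>xs ys. typeds xs (hr_types A) \<and> typeds ys (hr_types B) \<and>
     \<Gamma> \<turnstile> Or (hr_matrix A xs) (hr_matrix B ys))"
  then obtain xs ys where "wf_fm L (Or A B)" "typeds xs (hr_types A)" "typeds ys (hr_types B)"
    "\<Gamma> \<turnstile> Or (hr_matrix A xs) (hr_matrix B ys)"
    by blast
  then show "\<Gamma> \<tturnstile> Or A B"
    by (intro forcesI[of _ "xs @ ys"]) (auto simp: list_all2_lengthD intro: list_all2_appendI)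
qed

lemma forces_OrI1: "\<Gamma> \<tturnstile> A \<Longrightarrow> wf_fm L B \<Longrightarrow> \<Gamma> \<tturnstile> Or A B"
  using ex_typeds[of "hr_types B"]
  by (auto simp: forces_Or_iff elim!: forcesE intro: entails_OrI1 wf_fm_hr_matrix)

lemma forces_OrI2: "\<Gamma> \<tturnstile> B \<Longrightarrow> wf_fm L A \<Longrightarrow> \<Gamma> \<tturnstile> Or A B"
  using ex_typeds[of "hr_types A"]
  by (auto simp: forces_Or_iff elim!: forcesE intro: entails_OrI2 wf_fm_hr_matrix)

lemma forces_Ex_iff:
  "\<Gamma> \<tturnstile> Ex \<rho> A \<longleftrightarrow> wf_fm L A \<and> (\<exists>Z xs. typed Z (Star \<rho>) \<and> typeds xs (hr_types A) \<and>
     \<Gamma> \<turnstile> BEx \<rho> Z (hr_matrix A (map (lift_tm \<rho>) xs)))"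
  by (force simp: forces_def list_all2_Cons2)

lemma forces_BotE: "\<Gamma> \<tturnstile> Bot \<Longrightarrow> wf_fm L A \<Longrightarrow> \<Gamma> \<tturnstile> A"
  using ex_typeds[of "hr_types A"]
  by (auto simp: forces_ex_free intro: forcesI entails_BotE wf_fm_hr_matrix)

lemma forces_ImpE:
  assumes "\<Gamma> \<tturnstile> Imp A B" "\<Gamma> \<tturnstile> A"
  shows "\<Gamma> \<tturnstile> B"
proof -
  from assms(1) obtain us where us: "wf_fm L B" "typeds us (map (arrs (hr_types A)) (hr_types B))"
    "length us = length (hr_types B)" "\<Gamma> \<turnstile> hr_matrix (Imp A B) us"
    by (elim forcesE) auto
  from assms(2) obtain xs where xs: "typeds xs (hr_types A)" "\<Gamma> \<turnstile> hr_matrix A xs"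
    by (elim forcesE) auto
  show ?thesis
  proof (rule forcesI[OF us(1)])
    show "typeds (map (\<lambda>u. apps u xs) us) (hr_types B)"
      using us(2) has_type_apps[OF _ xs(1)] by (auto simp: list_all2_conv_all_nth)
  qed (rule entails_hr_matrix_ImpE[OF us(4,3) xs])
qed

lemma forces_OrE:
  assumes AC: "\<Gamma> \<tturnstile> Imp A C" and BC: "\<Gamma> \<tturnstile> Imp B C" and "\<Gamma> \<tturnstile> Or A B"
  shows "\<Gamma> \<tturnstile> C"
proof -
  have wf: "wf_fm L A" "wf_fm L B" "wf_fm L C"
    using forces_wf[OF AC] forces_wf[OF BC] by auto
  from assms(3) obtain xs ys where xs: "typeds xs (hr_types A)" and ys: "typeds ys (hr_types B)"
    and disj: "\<Gamma> \<turnstile> Or (hr_matrix A xs) (hr_matrix B ys)"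
    by (auto simp: forces_Or_iff)
  let ?\<Gamma> = "hr_matrix A xs # \<Gamma>" and ?\<Delta> = "hr_matrix B ys # \<Gamma>"
  have wfs: "wfs ?\<Gamma>" "wfs ?\<Delta>"
    using entails_wf[OF disj] by auto
  have "?\<Gamma> \<tturnstile> A" "?\<Delta> \<tturnstile> B"
    using entails_assm[OF wfs(1)] entails_assm[OF wfs(2)] wf xs ys by (auto intro!: forcesI)
  then have "?\<Gamma> \<tturnstile> C" "?\<Delta> \<tturnstile> C"
    using forces_weaken[OF AC, of ?\<Gamma>] forces_weaken[OF BC, of ?\<Delta>] wfs by (auto intro: forces_ImpE)
  then obtain cs ds where cs: "typeds cs (hr_types C)" "?\<Gamma> \<turnstile> hr_matrix C cs"
    and ds: "typeds ds (hr_types C)" "?\<Delta> \<turnstile> hr_matrix C ds"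
    by (auto elim!: forcesE)
  obtain es where es: "incls (hr_types C) ?\<Gamma> cs es" "incls (hr_types C) ?\<Delta> ds es"
    using ex_common_incls[OF wfs cs(1) ds(1)] by blast
  then have "?\<Gamma> \<turnstile> hr_matrix C es" "?\<Delta> \<turnstile> hr_matrix C es"
    using wf_fm_hr_monotone[OF wf(3)] cs(2) ds(2) by (blast intro: hr_monotoneD)+
  with disj have "\<Gamma> \<turnstile> hr_matrix C es"
    by (rule entails_OrE)
  then show ?thesis
    using wf(3) incls_typeds[OF es(1)] by (blast intro: forcesI)
qed

lemma ex_abstracted_realizers:
  assumes "wf_fm L A" "typeds xs (hr_types A)" "\<Gamma> \<turnstile> hr_matrix A xs"
  obtains us where "typeds us (map (arrs \<rho>s) (hr_types A))"
    "\<Gamma> \<turnstile> hr_matrix A (map (apply_block \<rho>s) us)"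
proof -
  have wfs: "wfs \<Gamma>"
    using entails_wf[OF assms(3)] by blast
  have "\<exists>u. typed u (arrs \<rho>s \<tau>) \<and> typed (apply_block \<rho>s u) \<tau> \<and> incl \<tau> \<Gamma> x (apply_block \<rho>s u)"
    if "typed x \<tau>" for x \<tau>
    using ex_abstraction_block[OF that, of \<rho>s] wfs
    by (auto intro: incl_provable_Eq has_type_apps[OF has_type_lifts_tm has_type_block_vars])
  with ex_larger_realizers[OF assms, of "\<lambda>u \<tau>. typed u (arrs \<rho>s \<tau>)" "apply_block \<rho>s"] that
  show thesis
    by (auto simp: list_all2_map2)
qed

lemma forces_ImpI_generic:
  assumes "wf_fm L A" "wf_fm L B" "generic A \<Gamma> \<tturnstile> lifts_fm (hr_types A) B"
  shows "\<Gamma> \<tturnstile> Imp A B"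
proof -
  from assms(3) obtain xs where "wf_fm L (lifts_fm (hr_types A) B)"
    "typeds xs (hr_types (lifts_fm (hr_types A) B))"
    "generic A \<Gamma> \<turnstile> hr_matrix (lifts_fm (hr_types A) B) xs"
    by (rule forcesE)
  then obtain us where "typeds us (map (arrs (hr_types A)) (hr_types B))"
    "generic A \<Gamma> \<turnstile> hr_matrix (lifts_fm (hr_types A) B) (map (apply_block (hr_types A)) us)"
    by (rule ex_abstracted_realizers[where \<rho>s = "hr_types A"]) auto
  with assms(1,2) show ?thesis
    by (intro forcesI[of _ us] entails_hr_matrix_ImpI) auto
qed

lemma forces_ImpI:
  assumes "wf_fm L A" "wf_fm L B" "wfs \<Gamma>"
    and "\<And>s \<Gamma>'. \<Gamma> \<leadsto>\<^bsub>s\<^esub> \<Gamma>' \<Longrightarrow> \<Gamma>' \<tturnstile> sub_fm s A \<Longrightarrow> \<Gamma>' \<tturnstile> sub_fm s B"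
  shows "\<Gamma> \<tturnstile> Imp A B"
proof (rule forces_ImpI_generic[OF assms(1,2)])
  have "generic A \<Gamma> \<tturnstile> lifts_fm (hr_types A) A"
    by (rule forcesI[OF _ _ entails_generic])
      (use assms(1,3) in \<open>auto simp: wf_fm_lifts_fm has_type_block_vars\<close>)
  then show "generic A \<Gamma> \<tturnstile> lifts_fm (hr_types A) B"
    using assms(4) access_generic[OF assms(1,3)] by (simp add: lifts_fm_eq_sub_fm)
qed

lemma forces_Imp_ex_free:
  assumes "ex_free A"
  shows "\<Gamma> \<tturnstile> Imp A B \<longleftrightarrow> A # \<Gamma> \<tturnstile> B"
proof
  assume imp: "\<Gamma> \<tturnstile> Imp A B"
  then have wfs: "wfs (A # \<Gamma>)"
    by (auto dest: forces_wf)
  then have "A # \<Gamma> \<tturnstile> A"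
    using assms by (auto simp: forces_ex_free intro!: entails_assm)
  moreover have "A # \<Gamma> \<tturnstile> Imp A B"
    using imp _ wfs by (rule forces_weaken) auto
  ultimately show "A # \<Gamma> \<tturnstile> B"
    by (blast intro: forces_ImpE)
next
  assume "A # \<Gamma> \<tturnstile> B"
  moreover from this have "wf_fm L A" "wf_fm L B"
    by (auto dest: forces_wf)
  ultimately show "\<Gamma> \<tturnstile> Imp A B"
    using assms
    by (intro forces_ImpI_generic)
      (simp_all add: generic_def hr_types_ex_free hr_matrix_ex_free map_idI)
qed

lemma forces_All_iff: "\<Gamma> \<tturnstile> All \<rho> A \<longleftrightarrow> map (lift_fm \<rho>) \<Gamma> \<tturnstile> A"
proof
  assume "\<Gamma> \<tturnstile> All \<rho> A"
  then obtain xs where xs: "wf_fm L A" "typeds xs (map (Arr \<rho>) (hr_types A))"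
    "\<Gamma> \<turnstile> All \<rho> (hr_matrix A (map (\<lambda>x. lift_tm \<rho> x \<cdot> Var \<rho> 0) xs))"
    by (elim forcesE) auto
  have "typeds (map (\<lambda>x. lift_tm \<rho> x \<cdot> Var \<rho> 0) xs) (hr_types A)"
    using xs(2) by (auto simp: list_all2_conv_all_nth intro!: has_type.App)
  then show "map (lift_fm \<rho>) \<Gamma> \<tturnstile> A"
    using xs(1) entails_AllD[OF xs(3)] by (blast intro: forcesI)
next
  assume "map (lift_fm \<rho>) \<Gamma> \<tturnstile> A"
  then obtain xs where wf: "wf_fm L A" and "typeds xs (hr_types A)"
    "map (lift_fm \<rho>) \<Gamma> \<turnstile> hr_matrix A xs"
    by (rule forcesE)
  then obtain us where "typeds us (map (Arr \<rho>) (hr_types A))"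
    "map (lift_fm \<rho>) \<Gamma> \<turnstile> hr_matrix A (map (apply_block [\<rho>]) us)"
    by (rule ex_abstracted_realizers[where \<rho>s = "[\<rho>]"]) (simp add: arrs_singleton)
  with wf show "\<Gamma> \<tturnstile> All \<rho> A"
    by (intro forcesI[of _ us]) (auto intro: entails_AllI)
qed

lemma forces_AllE:
  assumes "\<Gamma> \<tturnstile> All \<rho> A" "typed t \<rho>"
  shows "\<Gamma> \<tturnstile> inst \<rho> t A"
proof -
  have "map (lift_fm \<rho>) \<Gamma> \<leadsto>\<^bsub>sub_cons \<rho> t Var\<^esub> \<Gamma>"
    using assms forces_wf[OF assms(1)] by (auto simp: access_def typed_sub_sub_cons)
  then show ?thesis
    using assms(1) by (auto simp: forces_All_iff inst_eq_sub_fm intro: forces_access)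
qed

lemma forces_ExI:
  assumes "\<Gamma> \<tturnstile> inst \<rho> t A" "typed t \<rho>" "wf_fm L A"
  shows "\<Gamma> \<tturnstile> Ex \<rho> A"
proof -
  from assms(1) obtain xs where xs: "typeds xs (hr_types A)" "length xs = length (hr_types A)"
    "\<Gamma> \<turnstile> hr_matrix (inst \<rho> t A) xs" and wfs: "wfs \<Gamma>"
    by (auto elim!: forcesE simp: inst_eq_sub_fm)
  let ?Z = "Con (CSing \<rho>) \<cdot> t"
  have "inst \<rho> t (hr_matrix A (map (lift_tm \<rho>) xs)) = hr_matrix (inst \<rho> t A) xs"
    using xs(2) by (simp add: inst_eq_sub_fm sub_fm_hr_matrix o_def)
  moreover have "wf_fm L (hr_matrix A (map (lift_tm \<rho>) xs))"
    using assms(3) xs(1) by (intro wf_fm_hr_matrix has_type_map_ren_tm)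
  ultimately have "\<Gamma> \<turnstile> BEx \<rho> ?Z (hr_matrix A (map (lift_tm \<rho>) xs))"
    using xs(3) assms(2) wfs by (intro entails_BExI[of _ _ t]) (simp_all add: entails_In_Sing)
  moreover have "typed ?Z (Star \<rho>)"
    using assms(2) by (simp add: has_type_App_iff)
  ultimately show ?thesis
    using xs(1) assms(3) unfolding forces_Ex_iff by blast
qed

lemma forces_sub_fm_ExI:
  assumes "\<Gamma> \<tturnstile> sub_fm (sub_cons \<rho> t s) A" "typed t \<rho>" "wf_fm L A" "typed_sub L s"
  shows "\<Gamma> \<tturnstile> sub_fm s (Ex \<rho> A)"
  using assms
  by (auto simp flip: inst_sub_fm_up_sub intro!: forces_ExI wf_fm_sub_fm typed_sub_up_sub)

lemma forces_ExE:
  assumes "\<Gamma> \<tturnstile> Ex \<rho> A" "wf_fm L C"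
    and "\<And>\<Gamma>'. \<Gamma> \<leadsto>\<^bsub>shift_sub \<rho>\<^esub> \<Gamma>' \<Longrightarrow> \<Gamma>' \<tturnstile> A \<Longrightarrow> \<Gamma>' \<tturnstile> lift_fm \<rho> C"
  shows "\<Gamma> \<tturnstile> C"
proof -
  from assms(1) obtain Z xs where wf: "wf_fm L A" and Z: "typed Z (Star \<rho>)"
    and xs: "typeds xs (hr_types A)" and ex: "\<Gamma> \<turnstile> BEx \<rho> Z (hr_matrix A (map (lift_tm \<rho>) xs))"
    by (auto simp: forces_Ex_iff)
  let ?\<Gamma> = "hr_matrix A (map (lift_tm \<rho>) xs) # in_bound \<rho> Z # map (lift_fm \<rho>) \<Gamma>"
  have wfs: "wfs ?\<Gamma>"
    using entails_wf[OF ex] by auto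
  then have hyps: "?\<Gamma> \<turnstile> hr_matrix A (map (lift_tm \<rho>) xs)" "?\<Gamma> \<turnstile> in_bound \<rho> Z"
    by (auto intro!: entails_assm)
  have "?\<Gamma> \<tturnstile> A"
    using wf has_type_map_ren_tm[OF xs] hyps(1) by (rule forcesI)
  then have "?\<Gamma> \<tturnstile> lift_fm \<rho> C"
    using wfs by (intro assms(3)) (auto simp: access_shift_sub)
  then obtain cs where "wf_fm L (lift_fm \<rho> C)" "typeds cs (hr_types (lift_fm \<rho> C))"
    "?\<Gamma> \<turnstile> hr_matrix (lift_fm \<rho> C) cs"
    by (rule forcesE)
  from ex_bounding_realizers[OF this Z hyps(2)] obtain ds where ds: "typeds ds (hr_types C)"
    "?\<Gamma> \<turnstile> hr_matrix (lift_fm \<rho> C) (map (lift_tm \<rho>) ds)"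
    by auto
  have "hr_matrix (lift_fm \<rho> C) (map (lift_tm \<rho>) ds) = lift_fm \<rho> (hr_matrix C ds)"
    using list_all2_lengthD[OF ds(1)]
    by (simp add: ren_fm_eq_sub_fm ren_tm_eq_sub_tm[abs_def] sub_fm_hr_matrix)
  with ex ds(2) have "\<Gamma> \<turnstile> hr_matrix C ds"
    by (auto intro: entails_BExE)
  with assms(2) ds(1) show ?thesis
    by (rule forcesI)
qed

lemma forces_BAll_iff: "\<Gamma> \<tturnstile> BAll \<rho> t A \<longleftrightarrow> in_bound \<rho> t # map (lift_fm \<rho>) \<Gamma> \<tturnstile> A"
proof
  assume "\<Gamma> \<tturnstile> BAll \<rho> t A"
  then obtain xs where "wf_fm L A" "typeds xs (hr_types A)"
    "\<Gamma> \<turnstile> BAll \<rho> t (hr_matrix A (map (lift_tm \<rho>) xs))"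
    by (elim forcesE) auto
  then show "in_bound \<rho> t # map (lift_fm \<rho>) \<Gamma> \<tturnstile> A"
    by (blast intro: forcesI has_type_map_ren_tm entails_BAllD)
next
  let ?\<Gamma> = "in_bound \<rho> t # map (lift_fm \<rho>) \<Gamma>"
  assume "?\<Gamma> \<tturnstile> A"
  then obtain xs where xs: "wf_fm L A" "typeds xs (hr_types A)" "?\<Gamma> \<turnstile> hr_matrix A xs"
    and wfs: "wfs ?\<Gamma>"
    by (rule forcesE)
  from wfs have t: "typed t (Star \<rho>)" and "?\<Gamma> \<turnstile> in_bound \<rho> t"
    by (auto intro!: entails_assm)
  from ex_bounding_realizers[OF xs this] obtain ds where "typeds ds (hr_types A)"
    "?\<Gamma> \<turnstile> hr_matrix A (map (lift_tm \<rho>) ds)" by blast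
  with t xs(1) show "\<Gamma> \<tturnstile> BAll \<rho> t A"
    by (intro forcesI[of _ ds]) (auto intro: entails_BAllI)
qed

lemma forces_BAll_iff_All: "\<Gamma> \<tturnstile> BAll \<rho> t A \<longleftrightarrow> \<Gamma> \<tturnstile> All \<rho> (Imp (in_bound \<rho> t) A)"
  by (simp add: forces_BAll_iff forces_All_iff forces_Imp_ex_free)

lemma forces_BEx_iff_Ex:
  "\<Gamma> \<tturnstile> BEx \<rho> t A \<longleftrightarrow> typed t (Star \<rho>) \<and> \<Gamma> \<tturnstile> Ex \<rho> (And (in_bound \<rho> t) A)"
proof (intro iffI conjI)
  assume "\<Gamma> \<tturnstile> BEx \<rho> t A"
  then obtain xs where xs: "wf_fm L A" "typed t (Star \<rho>)" "typeds xs (hr_types A)"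
    "\<Gamma> \<turnstile> BEx \<rho> t (hr_matrix A (map (lift_tm \<rho>) xs))"
    by (elim forcesE) auto
  then show "typed t (Star \<rho>)" by simp
  from xs(4) have "\<Gamma> \<turnstile> BEx \<rho> t (And (in_bound \<rho> t) (hr_matrix A (map (lift_tm \<rho>) xs)))"
    by (rule entails_BEx_mono) (auto intro: entails_AndI)
  with xs show "\<Gamma> \<tturnstile> Ex \<rho> (And (in_bound \<rho> t) A)"
    by (auto simp: forces_Ex_iff)
next
  assume ex: "typed t (Star \<rho>) \<and> \<Gamma> \<tturnstile> Ex \<rho> (And (in_bound \<rho> t) A)"
  then obtain Z xs where xs: "wf_fm L A" "typeds xs (hr_types A)"
    "\<Gamma> \<turnstile> BEx \<rho> Z (And (in_bound \<rho> t) (hr_matrix A (map (lift_tm \<rho>) xs)))"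
    by (auto simp: forces_Ex_iff)
  from xs(3) have "\<Gamma> \<turnstile> BEx \<rho> t (hr_matrix A (map (lift_tm \<rho>) xs))"
    by (rule entails_BEx_mono) (auto intro: entails_AndE1 entails_AndE2)
  with xs(1,2) ex show "\<Gamma> \<tturnstile> BEx \<rho> t A"
    by (intro forcesI[of _ xs]) auto
qed


section \<open>Soundness\<close>

definition kripke_entails :: "('f, 'r) fm list \<Rightarrow> ('f, 'r) fm \<Rightarrow> bool" (infix \<open>\<TTurnstile>\<close> 50) where
  "\<Delta> \<TTurnstile> A \<longleftrightarrow> (\<forall>s \<Gamma>. [] \<leadsto>\<^bsub>s\<^esub> \<Gamma> \<longrightarrow> (\<forall>B\<in>set \<Delta>. \<Gamma> \<tturnstile> sub_fm s B) \<longrightarrow> \<Gamma> \<tturnstile> sub_fm s A)"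

lemma kripke_entailsD: "\<Delta> \<TTurnstile> A \<Longrightarrow> [] \<leadsto>\<^bsub>s\<^esub> \<Gamma> \<Longrightarrow> (\<And>B. B \<in> set \<Delta> \<Longrightarrow> \<Gamma> \<tturnstile> sub_fm s B) \<Longrightarrow> \<Gamma> \<tturnstile> sub_fm s A"
  by (auto simp: kripke_entails_def)

lemma kripke_entails_assm: "A \<in> set \<Delta> \<Longrightarrow> \<Delta> \<TTurnstile> A"
  by (simp add: kripke_entails_def)

lemma kripke_entails_Imp_iff:
  assumes "wf_fm L (Imp A B)"
  shows "\<Delta> \<TTurnstile> Imp A B \<longleftrightarrow> A # \<Delta> \<TTurnstile> B"
proof
  assume "\<Delta> \<TTurnstile> Imp A B"
  then show "A # \<Delta> \<TTurnstile> B"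
    by (auto simp: kripke_entails_def intro: forces_ImpE)
next
  assume B: "A # \<Delta> \<TTurnstile> B"
  show "\<Delta> \<TTurnstile> Imp A B"
    unfolding kripke_entails_def sub_fm.simps
  proof (intro allI impI forces_ImpI)
    fix s \<Gamma> s' \<Gamma>' assume s: "[] \<leadsto>\<^bsub>s\<^esub> \<Gamma>" "\<Gamma> \<leadsto>\<^bsub>s'\<^esub> \<Gamma>'" and \<Delta>: "\<forall>C\<in>set \<Delta>. \<Gamma> \<tturnstile> sub_fm s C"
      and A: "\<Gamma>' \<tturnstile> sub_fm s' (sub_fm s A)"
    have "\<Gamma>' \<tturnstile> sub_fm (s' \<odot> s) C" if "C \<in> set (A # \<Delta>)" for C
      using that A \<Delta> forces_access[OF _ s(2)] by (auto simp flip: sub_fm_sub_fm)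
    with kripke_entailsD[OF B access_comp_sub[OF s]] show "\<Gamma>' \<tturnstile> sub_fm s' (sub_fm s B)"
      by (simp add: sub_fm_sub_fm)
  qed (use assms in \<open>auto simp: access_Nil intro: wf_fm_sub_fm\<close>)
qed

lemma kripke_entails_And_iff: "\<Delta> \<TTurnstile> And A B \<longleftrightarrow> \<Delta> \<TTurnstile> A \<and> \<Delta> \<TTurnstile> B"
  by (auto simp: kripke_entails_def forces_And_iff)

lemma access_up_sub:
  assumes "[] \<leadsto>\<^bsub>s\<^esub> \<Gamma>" "\<Gamma> \<leadsto>\<^bsub>shift_sub \<rho>\<^esub> \<Gamma>'"
  shows "[] \<leadsto>\<^bsub>up_sub \<rho> s\<^esub> \<Gamma>'"
  using assms by (simp add: access_def typed_sub_up_sub)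

lemma kripke_entails_AllE: "\<Delta> \<TTurnstile> All \<rho> A \<Longrightarrow> typed t \<rho> \<Longrightarrow> \<Delta> \<TTurnstile> inst \<rho> t A"
  by (auto simp: kripke_entails_def sub_fm_inst access_Nil intro: forces_AllE has_type_sub_tm)

lemma kripke_entails_ExI: "\<Delta> \<TTurnstile> inst \<rho> t A \<Longrightarrow> typed t \<rho> \<Longrightarrow> wf_fm L A \<Longrightarrow> \<Delta> \<TTurnstile> Ex \<rho> A"
  by (auto simp: kripke_entails_def sub_fm_inst access_Nil
      intro: forces_ExI wf_fm_sub_fm typed_sub_up_sub has_type_sub_tm)

lemma kripke_entails_BAll_iff_All: "\<Delta> \<TTurnstile> BAll \<rho> t A \<longleftrightarrow> \<Delta> \<TTurnstile> All \<rho> (Imp (in_bound \<rho> t) A)"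
  by (simp add: kripke_entails_def forces_BAll_iff_All sub_tm_up_sub_lift_tm)

lemma kripke_entails_BEx_iff_Ex:
  "typed t (Star \<rho>) \<Longrightarrow> \<Delta> \<TTurnstile> BEx \<rho> t A \<longleftrightarrow> \<Delta> \<TTurnstile> Ex \<rho> (And (in_bound \<rho> t) A)"
  by (simp add: kripke_entails_def forces_BEx_iff_Ex sub_tm_up_sub_lift_tm access_Nil
      has_type_sub_tm)

lemma kripke_entails_AllI:
  assumes "map (lift_fm \<rho>) \<Delta> \<TTurnstile> A"
  shows "\<Delta> \<TTurnstile> All \<rho> A"
  unfolding kripke_entails_def sub_fm.simps forces_All_iff
proof (intro allI impI)
  fix s \<Gamma> assume s: "[] \<leadsto>\<^bsub>s\<^esub> \<Gamma>" and \<Delta>: "\<forall>B\<in>set \<Delta>. \<Gamma> \<tturnstile> sub_fm s B"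
  have shift: "\<Gamma> \<leadsto>\<^bsub>shift_sub \<rho>\<^esub> map (lift_fm \<rho>) \<Gamma>"
    using s by (simp add: access_Nil access_shift_sub)
  have "map (lift_fm \<rho>) \<Gamma> \<tturnstile> sub_fm (up_sub \<rho> s) (lift_fm \<rho> B)" if "B \<in> set \<Delta>" for B
    using \<Delta> that forces_access[OF _ shift] unfolding sub_fm_up_sub_lift_fm
    by (auto simp: ren_fm_eq_sub_fm)
  then show "map (lift_fm \<rho>) \<Gamma> \<tturnstile> sub_fm (up_sub \<rho> s) A"
    by (intro kripke_entailsD[OF assms access_up_sub[OF s shift]]) auto
qed

lemma kripke_entails_ExE:
  assumes "[A] \<TTurnstile> lift_fm \<rho> B" "wf_fm L B"
  shows "[Ex \<rho> A] \<TTurnstile> B"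
  unfolding kripke_entails_def
proof (intro allI impI)
  fix s \<Gamma> assume s: "[] \<leadsto>\<^bsub>s\<^esub> \<Gamma>" and "\<forall>C\<in>set [Ex \<rho> A]. \<Gamma> \<tturnstile> sub_fm s C"
  then have "\<Gamma> \<tturnstile> Ex \<rho> (sub_fm (up_sub \<rho> s) A)" by simp
  then show "\<Gamma> \<tturnstile> sub_fm s B"
  proof (rule forces_ExE)
    show "wf_fm L (sub_fm s B)"
      using s assms(2) by (simp add: access_Nil wf_fm_sub_fm)
    fix \<Gamma>' assume "\<Gamma> \<leadsto>\<^bsub>shift_sub \<rho>\<^esub> \<Gamma>'" "\<Gamma>' \<tturnstile> sub_fm (up_sub \<rho> s) A"
    then show "\<Gamma>' \<tturnstile> lift_fm \<rho> (sub_fm s B)"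
      unfolding sub_fm_up_sub_lift_fm[symmetric]
      by (intro kripke_entailsD[OF assms(1) access_up_sub[OF s]]) simp_all
  qed
qed

lemma kripke_entails_Nil_iff: "[] \<TTurnstile> A \<longleftrightarrow> [] \<tturnstile> A"
proof
  assume "[] \<TTurnstile> A"
  from kripke_entailsD[OF this, of Var "[]"] show "[] \<tturnstile> A"
    by (simp add: access_Nil)
next
  assume "[] \<tturnstile> A"
  then show "[] \<TTurnstile> A"
    by (auto simp: kripke_entails_def intro: forces_access)
qed

lemma kripke_entails_ex_free: "ex_free A \<Longrightarrow> provable L T A \<Longrightarrow> [] \<TTurnstile> A"
  by (simp add: kripke_entails_Nil_iff forces_ex_free entails_Nil)


lemma repl_fm_ex_free: "repl_fm x y A A' \<Longrightarrow> ex_free A \<and> ex_free A'"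
  by (auto elim: repl_fm.cases)

lemma kripke_entails_axiom:
  assumes "il_axiom L F" "wf_fm L F"
  shows "[] \<TTurnstile> F"
  using assms
proof (induction rule: il_axiom.induct)
  case (AllE t \<rho> A)
  then show ?case
    by (simp add: kripke_entails_Imp_iff kripke_entails_AllE[OF kripke_entails_assm])
next
  case (ExI t \<rho> A)
  then show ?case
    by (simp add: kripke_entails_Imp_iff kripke_entails_ExI[OF kripke_entails_assm])
next
  case (eq_repl x \<rho> i y j A A')
  then show ?case
    using repl_fm_ex_free[OF eq_repl(3)]
    by (intro kripke_entails_ex_free provable.logical il_axiom.eq_repl) auto
next
  case (in_bigun x \<sigma> i y \<tau> j z k w l)
  then show ?case
    by (intro kripke_entails_ex_free provable.logical il_axiom.in_bigun) auto
next
  case (BAll \<rho> t A)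
  have "[BAll \<rho> t A] \<TTurnstile> All \<rho> (Imp (in_bound \<rho> t) A)"
    by (simp add: kripke_entails_assm flip: kripke_entails_BAll_iff_All)
  moreover have "[All \<rho> (Imp (in_bound \<rho> t) A)] \<TTurnstile> BAll \<rho> t A"
    by (simp add: kripke_entails_assm kripke_entails_BAll_iff_All)
  ultimately show ?case
    using BAll by (simp add: kripke_entails_And_iff kripke_entails_Imp_iff)
next
  case (BEx \<rho> t A)
  then have t: "typed t (Star \<rho>)" by simp
  then have "[BEx \<rho> t A] \<TTurnstile> Ex \<rho> (And (in_bound \<rho> t) A)"
    by (simp add: kripke_entails_assm flip: kripke_entails_BEx_iff_Ex)
  moreover from t have "[Ex \<rho> (And (in_bound \<rho> t) A)] \<TTurnstile> BEx \<rho> t A"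
    by (simp add: kripke_entails_assm kripke_entails_BEx_iff_Ex)
  ultimately show ?case
    using BEx by (simp add: kripke_entails_And_iff kripke_entails_Imp_iff)
qed (simp_all add: kripke_entails_ex_free provable.logical il_axiom.intros kripke_entails_Imp_iff,
    auto simp: kripke_entails_def forces_And_iff access_Nil
      intro: forces_ImpE forces_OrI1 forces_OrI2 forces_OrE forces_BotE wf_fm_sub_fm)

lemma forces_Ex_bounded: "\<Gamma> \<tturnstile> Ex \<sigma> A \<Longrightarrow> \<exists>Z. typed Z (Star \<sigma>) \<and> \<Gamma> \<tturnstile> BEx \<sigma> Z A"
  by (force simp: forces_Ex_iff intro: forcesI)

lemma forces_AC:
  assumes "\<Gamma> \<tturnstile> All \<rho> (Ex \<sigma> A)"
  shows "\<exists>Z. typed Z (\<rho> \<rightarrow>\<^sub>t Star \<sigma>) \<and> \<Gamma> \<tturnstile> All \<rho> (BEx \<sigma> (lift_tm \<rho> Z \<cdot> Var \<rho> 0) A)"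
proof -
  from assms obtain Z xs where Z: "typed Z (\<rho> \<rightarrow>\<^sub>t Star \<sigma>)" and "wf_fm L A"
    "typeds xs (map (Arr \<rho>) (hr_types A))"
    "\<Gamma> \<turnstile> hr_matrix (All \<rho> (BEx \<sigma> (lift_tm \<rho> Z \<cdot> Var \<rho> 0) A)) xs"
    by (auto elim!: forcesE simp: list_all2_Cons2)
  moreover have "typed (lift_tm \<rho> Z \<cdot> Var \<rho> 0) (Star \<sigma>)"
    using Z by (auto intro: has_type.App)
  ultimately have "\<Gamma> \<tturnstile> All \<rho> (BEx \<sigma> (lift_tm \<rho> Z \<cdot> Var \<rho> 0) A)"
    by (intro forcesI[of _ xs]) simp_all
  with Z show ?thesis by blast
qed

lemma forces_IP:
  assumes "ex_free B" "\<Gamma> \<tturnstile> Imp B (Ex \<sigma> A)"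
  shows "\<exists>Z. typed Z (Star \<sigma>) \<and> \<Gamma> \<tturnstile> Imp B (BEx \<sigma> Z A)"
  using assms by (simp add: forces_Imp_ex_free forces_Ex_bounded)

lemma kripke_entails_AC:
  assumes "F \<in> AC" "wf_fm L F"
  shows "[] \<TTurnstile> F"
proof -
  from assms(1) obtain \<rho> \<sigma> A where F: "F = Imp (All \<rho> (Ex \<sigma> A))
             (Ex (\<rho> \<rightarrow>\<^sub>t Star \<sigma>) (All \<rho>
               (BEx \<sigma> (lift_tm \<rho> (Var (\<rho> \<rightarrow>\<^sub>t Star \<sigma>) 0) \<cdot> Var \<rho> 0)
                 (ren_fm (up_ren \<sigma> (up_ren \<rho> (shift (\<rho> \<rightarrow>\<^sub>t Star \<sigma>)))) A))))"
    (is "F = Imp ?P (Ex ?\<tau> ?C)") by (auto simp: AC_def)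
  have "[?P] \<TTurnstile> Ex ?\<tau> ?C"
    unfolding kripke_entails_def
  proof (intro allI impI)
    fix s \<Gamma> assume s: "[] \<leadsto>\<^bsub>s\<^esub> \<Gamma>" and "\<forall>B\<in>set [?P]. \<Gamma> \<tturnstile> sub_fm s B"
    then obtain Z where Z: "typed Z ?\<tau>"
      "\<Gamma> \<tturnstile> All \<rho> (BEx \<sigma> (lift_tm \<rho> Z \<cdot> Var \<rho> 0) (sub_fm (up_sub \<sigma> (up_sub \<rho> s)) A))"
      using forces_AC[of \<Gamma> \<rho> \<sigma>] by auto
    have "sub_fm (sub_cons ?\<tau> Z s) ?C =
      All \<rho> (BEx \<sigma> (lift_tm \<rho> Z \<cdot> Var \<rho> 0) (sub_fm (up_sub \<sigma> (up_sub \<rho> s)) A))"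
      by (simp add: ren_fm_eq_sub_fm sub_fm_sub_fm up_sub_comp_up_sub flip: up_sub_ren_sub)
    then show "\<Gamma> \<tturnstile> sub_fm s (Ex ?\<tau> ?C)"
      using Z assms(2) s by (intro forces_sub_fm_ExI[of _ _ Z]) (simp_all add: F access_Nil)
  qed
  then show ?thesis
    using assms(2) by (simp add: F kripke_entails_Imp_iff)
qed

lemma kripke_entails_IP:
  assumes "F \<in> IP" "wf_fm L F"
  shows "[] \<TTurnstile> F"
proof -
  from assms(1) obtain B \<sigma> A where B: "ex_free B" and F: "F = Imp (Imp B (Ex \<sigma> A))
             (Ex (Star \<sigma>) (Imp (lift_fm (Star \<sigma>) B)
               (BEx \<sigma> (Var (Star \<sigma>) 0) (ren_fm (up_ren \<sigma> (shift (Star \<sigma>))) A))))"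
    (is "F = Imp ?P (Ex ?\<tau> ?C)") by (auto simp: IP_def)
  have "[?P] \<TTurnstile> Ex ?\<tau> ?C"
    unfolding kripke_entails_def
  proof (intro allI impI)
    fix s \<Gamma> assume s: "[] \<leadsto>\<^bsub>s\<^esub> \<Gamma>" and "\<forall>D\<in>set [?P]. \<Gamma> \<tturnstile> sub_fm s D"
    then obtain Z where Z: "typed Z ?\<tau>" "\<Gamma> \<tturnstile> Imp (sub_fm s B) (BEx \<sigma> Z (sub_fm (up_sub \<sigma> s) A))"
      using forces_IP[of "sub_fm s B" \<Gamma> \<sigma>] B by auto
    have "sub_fm (sub_cons ?\<tau> Z s) ?C = Imp (sub_fm s B) (BEx \<sigma> Z (sub_fm (up_sub \<sigma> s) A))"
      by (simp add: ren_fm_eq_sub_fm sub_fm_sub_fm up_sub_comp_up_sub flip: up_sub_ren_sub)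
    then show "\<Gamma> \<tturnstile> sub_fm s (Ex ?\<tau> ?C)"
      using Z assms(2) s by (intro forces_sub_fm_ExI[of _ _ Z]) (simp_all add: F access_Nil)
  qed
  then show ?thesis
    using assms(2) by (simp add: F kripke_entails_Imp_iff)
qed

theorem soundness:
  assumes "provable L (AC \<union> IP \<union> T) A" "\<forall>B\<in>T. ex_free B"
  shows "[] \<TTurnstile> A"
  using assms(1)
proof (induction rule: provable.induct)
  case (logical A)
  then show ?case by (rule kripke_entails_axiom)
next
  case (nonlogical A)
  then show ?case
    using assms(2)
    by (auto intro: kripke_entails_AC kripke_entails_IP kripke_entails_ex_free provable.nonlogical)
next
  case (MP A B)
  then show ?case
    by (auto simp: kripke_entails_Nil_iff intro: forces_ImpE)
next
  case (AllI \<rho> B A)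
  then have "wf_fm L (Imp (lift_fm \<rho> B) A)"
    by (auto simp: kripke_entails_Nil_iff dest: forces_wf)
  with AllI have "map (lift_fm \<rho>) [B] \<TTurnstile> A"
    by (simp add: kripke_entails_Imp_iff)
  then have "[B] \<TTurnstile> All \<rho> A"
    by (rule kripke_entails_AllI)
  with \<open>wf_fm L (Imp (lift_fm \<rho> B) A)\<close> show ?case
    by (simp add: kripke_entails_Imp_iff)
next
  case (ExE A \<rho> B)
  then have "wf_fm L (Imp A (lift_fm \<rho> B))"
    by (auto simp: kripke_entails_Nil_iff dest: forces_wf)
  with ExE have "[A] \<TTurnstile> lift_fm \<rho> B" "wf_fm L B"
    by (simp_all add: kripke_entails_Imp_iff)
  then have "[Ex \<rho> A] \<TTurnstile> B"
    by (rule kripke_entails_ExE)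
  with \<open>wf_fm L (Imp A (lift_fm \<rho> B))\<close> show ?case
    by (simp add: kripke_entails_Imp_iff)
qed


section \<open>Closed realizers\<close>

lemma ex_closing_sub:
  obtains s where "typed_sub L s" "agree_on V s Var" "\<forall>t. fv_tm (sub_tm s t) \<subseteq> V"
proof -
  from ex_closed_term obtain d where d: "\<And>\<tau>. fv_tm (d \<tau>) = {}" "\<And>\<tau>. typed (d \<tau>) \<tau>"
    by metis
  let ?s = "\<lambda>\<sigma> n. if (\<sigma>, n) \<in> V then Var \<sigma> n else d \<sigma>"
  show thesis
  proof (rule that[of ?s])
    show "typed_sub L ?s"
      by (simp add: typed_sub_def d(2))
    show "agree_on V ?s Var"
      by (auto simp: agree_on_def)
    show "\<forall>t. fv_tm (sub_tm ?s t) \<subseteq> V"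
      by (auto simp: fv_sub_tm d(1) split: if_splits)
  qed
qed

lemma ex_realizers_fv:
  assumes "[] \<tturnstile> A"
  obtains xs where "typeds xs (hr_types A)" "[] \<turnstile> hr_matrix A xs" "\<forall>x\<in>set xs. fv_tm x \<subseteq> fv_fm A"
proof -
  from assms obtain xs where xs: "typeds xs (hr_types A)" "length xs = length (hr_types A)"
    "[] \<turnstile> hr_matrix A xs"
    by (rule forcesE)
  obtain s where s: "typed_sub L s" "agree_on (fv_fm A) s Var" "\<forall>t. fv_tm (sub_tm s t) \<subseteq> fv_fm A"
    by (rule ex_closing_sub)
  have "sub_fm s A = A"
    using sub_fm_cong[OF s(2)] by simp
  then have "[] \<turnstile> hr_matrix A (map (sub_tm s) xs)"
    using entails_sub_fm[OF xs(3) s(1)] xs(2) by (simp add: sub_fm_hr_matrix)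
  moreover have "typeds (map (sub_tm s) xs) (hr_types A)"
    using xs(1) s(1) by (auto simp: list_all2_conv_all_nth intro: has_type_sub_tm)
  ultimately show thesis
    using s(3) by (intro that[of "map (sub_tm s) xs"]) auto
qed

lemma ex_closed_realizers:
  assumes "[] \<tturnstile> A" "fv_fm A \<subseteq> set a"
  shows "\<exists>ts. list_all2 (\<lambda>t \<tau>. fv_tm t = {} \<and> typed t (arrs (map fst a) \<tau>)) ts (hr_types A) \<and>
    [] \<turnstile> hr_matrix A (map (\<lambda>t. apps t (vars a)) ts)"
proof -
  obtain xs where xs: "typeds xs (hr_types A)" "[] \<turnstile> hr_matrix A xs"
    and fv: "\<forall>x\<in>set xs. fv_tm x \<subseteq> fv_fm A"
    using assms(1) by (rule ex_realizers_fv)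
  have closed: "\<exists>t. (fv_tm t = {} \<and> typed t (arrs (map fst a) \<tau>)) \<and> typed (apps t (vars a)) \<tau> \<and>
      incl \<tau> [] x (apps t (vars a))" if x: "x \<in> set xs" "typed x \<tau>" for x \<tau>
  proof -
    obtain t where t: "typed t (arrs (map fst a) \<tau>)" "fv_tm t \<subseteq> fv_tm x - set a"
      "[] \<turnstile> Eq \<tau> (apps t (vars a)) x"
      using ex_abstraction_vars[OF x(2)] by blast
    have "fv_tm t = {}"
      using t(2) fv assms(2) x(1) by blast
    moreover have "typed (apps t (vars a)) \<tau>"
      using t(1) typeds_vars by (rule has_type_apps)
    moreover have "incl \<tau> [] x (apps t (vars a))"
      using t(3) by (simp add: incl_provable_Eq)
    ultimately show ?thesis
      using t(1) by blast
  qed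
  have "wf_fm L A"
    using forces_wf[OF assms(1)] by blast
  from ex_larger_realizers[OF this xs closed] show ?thesis
    by blast
qed

end

theorem theorem6:
  fixes L :: "('f, 'r) language"
    and A :: "('f, 'r) fm"
    and T :: "('f, 'r) fm set"
    and a :: "(ty \<times> nat) list"
  assumes "\<exists>c\<in>funs L. fun_arity L c = 0"
    and "wf_fm L A"
    and "distinct a" and "set a = fv_fm A"
    and "\<forall>B\<in>T. wf_fm L B \<and> ex_free B"
    and "provable L (AC \<union> IP \<union> T) A"
  shows "\<exists>ts. list_all2 (\<lambda>t \<tau>. fv_tm t = {} \<and> has_type L t (arrs (map fst a) \<tau>)) ts (hr_types A)
    \<and> provable L T (hr_matrix A (map (\<lambda>t. apps t (map (\<lambda>(\<sigma>, n). Var \<sigma> n) a)) ts))"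
proof -
  interpret inhabited_theory L T
    by unfold_locales (rule assms(1))
  have "[] \<tturnstile> A"
    using soundness[OF assms(6)] assms(5) by (simp add: kripke_entails_Nil_iff)
  then show ?thesis
    using assms(4) ex_closed_realizers[of A a] by (simp add: entails_Nil)
qed

end
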